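(* The Connected Odd Cycle Transversal problem is NP-complete when restricted to line graphs.
   Context: All graphs are finite and simple. An odd cycle transversal of a graph $G$ is a set $S\subseteq V(G)$ such that $G-S$ is bipartite; it is connected if $G[S]$ (the subgraph induced by $S$) is connected. The Connected Odd Cycle Transversal problem: given a graph $G$ and an integer $k$, decide whether $G$ has a connected odd cycle transversal $S$ with $|S|\le k$. The line graph $L(G)$ of $G=(V,E)$ has vertex set $E$, with two vertices adjacent if and only if the corresponding edges share an end-vertex in $G$; a line graph is a graph isomorphic to $L(G)$ for some graph $G$. *)

theory Defs
  imports "HOL-Computational_Algebra.Polynomial"
begin

section \<open>Graphs\<close>

record 'a sgraph =
  verts :: "'a set"
  edges :: "'a set set"

definition simple_graph :: "'a sgraph \<Rightarrow> bool" where
  "simple_graph G \<longleftrightarrow> finite (verts G) \<and> (\<forall>e\<in>edges G. e \<subseteq> verts G \<and> card e = 2)"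

definition induced :: "'a sgraph \<Rightarrow> 'a set \<Rightarrow> 'a sgraph" where
  "induced G S = \<lparr>verts = verts G \<inter> S, edges = {e \<in> edges G. e \<subseteq> S}\<rparr>"

definition delete_verts :: "'a sgraph \<Rightarrow> 'a set \<Rightarrow> 'a sgraph" where
  "delete_verts G S = induced G (verts G - S)"

definition bipartite :: "'a sgraph \<Rightarrow> bool" where
  "bipartite G \<longleftrightarrow> (\<exists>A B. A \<union> B = verts G \<and> A \<inter> B = {} \<and>
     (\<forall>e\<in>edges G. \<exists>a\<in>A. \<exists>b\<in>B. e = {a, b}))"

text \<open>The graph without vertices counts as connected, so the empty set is a connected
  odd cycle transversal of every bipartite graph.\<close>

definition connected_graph :: "'a sgraph \<Rightarrow> bool" where
  "connected_graph G \<longleftrightarrow>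
     (\<forall>u\<in>verts G. \<forall>v\<in>verts G. (u, v) \<in> {(x, y). {x, y} \<in> edges G}\<^sup>*)"

definition odd_cycle_transversal :: "'a sgraph \<Rightarrow> 'a set \<Rightarrow> bool" where
  "odd_cycle_transversal G S \<longleftrightarrow> S \<subseteq> verts G \<and> bipartite (delete_verts G S)"

definition connected_oct :: "'a sgraph \<Rightarrow> 'a set \<Rightarrow> bool" where
  "connected_oct G S \<longleftrightarrow> odd_cycle_transversal G S \<and> connected_graph (induced G S)"

definition line_graph :: "'a sgraph \<Rightarrow> 'a set sgraph" where
  "line_graph G = \<lparr>verts = edges G,
     edges = {{e, f} | e f. e \<in> edges G \<and> f \<in> edges G \<and> e \<noteq> f \<and> e \<inter> f \<noteq> {}}\<rparr>"

definition graph_iso :: "'a sgraph \<Rightarrow> 'b sgraph \<Rightarrow> bool" where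
  "graph_iso G H \<longleftrightarrow> (\<exists>f. bij_betw f (verts G) (verts H) \<and>
     (\<forall>u\<in>verts G. \<forall>v\<in>verts G. {u, v} \<in> edges G \<longleftrightarrow> {f u, f v} \<in> edges H))"

text \<open>Roots with natural numbers as vertices suffice, since every finite graph has an
  isomorphic copy of that kind.\<close>

definition is_line_graph :: "'a sgraph \<Rightarrow> bool" where
  "is_line_graph G \<longleftrightarrow> (\<exists>H :: nat sgraph. simple_graph H \<and> graph_iso G (line_graph H))"


section \<open>Multi-tape Turing machines\<close>

text \<open>Deterministic machines with two-way infinite tapes. The symbols are
  \<open>0, \<dots>, num_symbols - 1\<close>, where 0 is the blank and 1, 2 stand for the bits. The states are
  \<open>0, \<dots>, num_states\<close>; the machine starts in state 0 and halts in state \<open>num_states\<close>. Tape 0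
  initially holds the input, and tape 1 holds the output at the end.\<close>

datatype move = MoveLeft | Stay | MoveRight

record turing_machine =
  num_tapes :: nat
  num_symbols :: nat
  num_states :: nat
  trans :: "nat \<Rightarrow> nat list \<Rightarrow> nat \<times> (nat \<times> move) list"

definition wf_tm :: "turing_machine \<Rightarrow> bool" where
  "wf_tm M \<longleftrightarrow> num_tapes M \<ge> 2 \<and> num_symbols M \<ge> 3 \<and>
     (\<forall>q ss q' as. q < num_states M \<longrightarrow> length ss = num_tapes M \<longrightarrow>
        (\<forall>s\<in>set ss. s < num_symbols M) \<longrightarrow> trans M q ss = (q', as) \<longrightarrow>
        q' \<le> num_states M \<and> length as = num_tapes M \<and> (\<forall>(s, d)\<in>set as. s < num_symbols M))"

text \<open>Contents of the cells and position of the head.\<close>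

type_synonym tape = "(int \<Rightarrow> nat) \<times> int"

type_synonym tm_config = "nat \<times> tape list"

fun head_shift :: "move \<Rightarrow> int" where
  "head_shift MoveLeft = -1"
| "head_shift Stay = 0"
| "head_shift MoveRight = 1"

definition read_tape :: "tape \<Rightarrow> nat" where
  "read_tape t = fst t (snd t)"

definition act :: "nat \<times> move \<Rightarrow> tape \<Rightarrow> tape" where
  "act a t = ((fst t)(snd t := fst a), snd t + head_shift (snd a))"

definition tm_step :: "turing_machine \<Rightarrow> tm_config \<Rightarrow> tm_config" where
  "tm_step M c =
     (if fst c < num_states M
      then (let (q, as) = trans M (fst c) (map read_tape (snd c)) in (q, map2 act as (snd c)))
      else c)"

definition bit_symbol :: "bool \<Rightarrow> nat" where
  "bit_symbol b = (if b then 2 else 1)"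

definition word_tape :: "bool list \<Rightarrow> tape" where
  "word_tape x =
     ((\<lambda>i. if 0 \<le> i \<and> i < int (length x) then bit_symbol (x ! nat i) else 0), 0)"

definition init_config :: "turing_machine \<Rightarrow> bool list \<Rightarrow> tm_config" where
  "init_config M x = (0, word_tape x # replicate (num_tapes M - 1) (word_tape []))"

text \<open>The output is the word that starts in cell 0 of tape 1 and extends to the first blank.\<close>

definition tm_output :: "tm_config \<Rightarrow> bool list \<Rightarrow> bool" where
  "tm_output c y \<longleftrightarrow>
     (\<forall>i<length y. fst (snd c ! 1) (int i) = bit_symbol (y ! i)) \<and>
     fst (snd c ! 1) (int (length y)) = 0"

definition computes_within ::
  "turing_machine \<Rightarrow> (bool list \<Rightarrow> bool list) \<Rightarrow> (nat \<Rightarrow> nat) \<Rightarrow> bool" where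
  "computes_within M f T \<longleftrightarrow> (\<forall>x. \<exists>t\<le>T (length x).
     let c = (tm_step M ^^ t) (init_config M x)
     in fst c = num_states M \<and> tm_output c (f x))"


section \<open>Polynomial time and NP-completeness\<close>

definition polytime :: "(bool list \<Rightarrow> bool list) \<Rightarrow> bool" where
  "polytime f \<longleftrightarrow> (\<exists>M (p :: nat poly). wf_tm M \<and> computes_within M f (poly p))"

definition complexity_P :: "bool list set set" where
  "complexity_P = {A. polytime (\<lambda>x. [x \<in> A])}"

text \<open>Self-delimiting pairing: every bit of \<open>x\<close> is preceded by the flag \<open>True\<close>, and the flag
  \<open>False\<close> announces \<open>u\<close>.\<close>

definition pair_word :: "bool list \<Rightarrow> bool list \<Rightarrow> bool list" where
  "pair_word x u = concat (map (\<lambda>b. [True, b]) x) @ [False] @ u"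

definition complexity_NP :: "bool list set set" where
  "complexity_NP = {A. \<exists>V\<in>complexity_P. \<exists>p :: nat poly.
     \<forall>x. x \<in> A \<longleftrightarrow> (\<exists>u. length u \<le> poly p (length x) \<and> pair_word x u \<in> V)}"

definition poly_reducible :: "bool list set \<Rightarrow> bool list set \<Rightarrow> bool" where
  "poly_reducible A B \<longleftrightarrow> (\<exists>f. polytime f \<and> (\<forall>x. x \<in> A \<longleftrightarrow> f x \<in> B))"

definition NP_complete :: "bool list set \<Rightarrow> bool" where
  "NP_complete B \<longleftrightarrow> B \<in> complexity_NP \<and> (\<forall>A\<in>complexity_NP. poly_reducible A B)"


section \<open>The problem as a formal language\<close>

text \<open>Binary representation, least significant bit first.\<close>

fun nat_bits :: "nat \<Rightarrow> bool list" where
  "nat_bits k = (if k = 0 then [] else odd k # nat_bits (k div 2))"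

declare nat_bits.simps [simp del]

text \<open>A graph on the vertices \<open>0, \<dots>, n - 1\<close> with edge set \<open>E\<close> is encoded by \<open>n\<close> in unary
  followed by its adjacency matrix, row by row.\<close>

definition encode_instance :: "nat \<Rightarrow> nat set set \<Rightarrow> nat \<Rightarrow> bool list" where
  "encode_instance n E k =
     replicate n True @ [False] @
     concat (map (\<lambda>i. map (\<lambda>j. {i, j} \<in> E) [0..<n]) [0..<n]) @
     nat_bits k"

text \<open>The problem restricted to the class \<open>C\<close>: the codes of its yes-instances.\<close>

definition connected_oct_language :: "(nat sgraph \<Rightarrow> bool) \<Rightarrow> bool list set" where
  "connected_oct_language C =
     {encode_instance n E k | n E k.
        simple_graph \<lparr>verts = {..<n}, edges = E\<rparr> \<and> C \<lparr>verts = {..<n}, edges = E\<rparr> \<and>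
        (\<exists>S. connected_oct \<lparr>verts = {..<n}, edges = E\<rparr> S \<and> card S \<le> k)}"

lemma nat_bits_inject: "nat_bits k = nat_bits l \<longleftrightarrow> k = l"
proof
  show "nat_bits k = nat_bits l \<Longrightarrow> k = l"
  proof (induction k arbitrary: l rule: less_induct)
    case (less k)
    show ?case
    proof (cases "k = 0 \<or> l = 0")
      case True
      then show ?thesis
        using less.prems nat_bits.simps[of k] nat_bits.simps[of l] by (auto split: if_splits)
    next
      case False
      then have "odd k = odd l" "nat_bits (k div 2) = nat_bits (l div 2)"
        using less.prems nat_bits.simps[of k] nat_bits.simps[of l] by auto
      moreover have "k div 2 < k"
        using False by simp
      ultimately have "k div 2 = l div 2" "k mod 2 = l mod 2"
        using less.IH by (auto simp: odd_iff_mod_2_eq_one parity_cases)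
      then show ?thesis
        by (metis div_mult_mod_eq)
    qed
  qed
qed simp

lemma encode_instance_inject:
  assumes "simple_graph \<lparr>verts = {..<n}, edges = E\<rparr>"
    and "simple_graph \<lparr>verts = {..<m}, edges = F\<rparr>"
    and eq: "encode_instance n E k = encode_instance m F l"
  shows "n = m \<and> E = F \<and> k = l"
proof -
  let ?adj = "\<lambda>n E. concat (map (\<lambda>i. map (\<lambda>j. {i, j} \<in> E) [0..<n]) [0..<n])"
  have prefix_length: "length (takeWhile id (encode_instance n E k)) = n" for n E k
    by (simp add: encode_instance_def takeWhile_append)
  have nm: "n = m"
    using prefix_length[of n E k] prefix_length[of m F l] eq by simp
  have len: "length (?adj n E) = n * n" for n and E :: "nat set set"
    by (simp add: length_concat comp_def sum_list_triv)
  have "?adj n E @ nat_bits k = ?adj n F @ nat_bits l"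
    using eq by (simp add: encode_instance_def nm)
  then have adj: "?adj n E = ?adj n F" and bits: "nat_bits k = nat_bits l"
    using len[of E n] len[of F n] by (simp_all add: append_eq_append_conv)
  have rows: "map (\<lambda>i. map (\<lambda>j. {i, j} \<in> E) [0..<n]) [0..<n] =
      map (\<lambda>i. map (\<lambda>j. {i, j} \<in> F) [0..<n]) [0..<n]"
    using adj by (subst (asm) concat_eq_concat_iff) (auto simp: zip_map_map set_zip)
  have same: "{i, j} \<in> E \<longleftrightarrow> {i, j} \<in> F" if "i < n" "j < n" for i j
    using rows that by auto
  have "\<exists>i j. i < n \<and> j < n \<and> e = {i, j}" if "e \<in> E \<union> F" for e
  proof -
    have "e \<subseteq> {..<n}" "card e = 2"
      using that assms(1,2) nm by (auto simp: simple_graph_def)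
    then show ?thesis
      by (auto simp: card_2_iff)
  qed
  then have "E = F"
    using same by blast
  then show ?thesis
    using nm bits by (simp add: nat_bits_inject)
qed

end

theory Submission imports Defs begin

text \<open>\<^emph>\<open>Hardness.\<close> In the line graph of \<open>H\<close>, a set \<open>S\<close> of edges of \<open>H\<close> is a connected odd cycle
  transversal only if \<open>S\<close> is connected in \<open>H\<close> and at every vertex at most two edges are left. Take a
  cycle for every variable, attach a pendant edge to each of its vertices, and link each of its
  vertices to a hub, which has two pendant edges. For the smallest possible \<open>|S|\<close> the edges left
  are all pendant edges and a perfect matching of every cycle, that is, a truth assignment. The
  other half of a cycle consists of single edges that join hubs, and the hubs are chosen such that
  such an edge joins the hub of a clause to the central hub exactly if the variable makes the clause
  true. Hence \<open>S\<close> is connected if and only if the assignment satisfies all clauses.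

  The clauses describe the computation of a verifier. They are implications that force the true
  configurations step by step, so no clause has to state that a configuration is unique.

  \<^emph>\<open>Polynomial time.\<close> The adjacency matrix of the reduction and the check of the certificates are
  given by arithmetic expressions with bounded sums in the bits of the input. All values are
  polynomially bounded, and such expressions are evaluated in unary, where a counter is the head
  position of a tape.\<close>

text \<open>Three edges left at a common vertex of \<open>H\<close> form a triangle in the line
  graph, hence the bound of two per vertex. This bound alone does not make the rest bipartite, but
  what an optimal solution leaves consists of short paths.

  A pendant edge can be left at the price of capacity at one gadget vertex only. The two at a hub
  exhaust its capacity, so a link can be left only in place of one of them. A cycle vertex that
  keeps its pendant edge has room for one more, and a cycle edge uses such room at both ends. With
  \<open>X\<close> variables and \<open>J\<close> clauses the cycles have
  \<open>M = 4 * X * J\<close> vertices in all. So the \<open>M\<close> links and half of the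
  \<open>M\<close> cycle edges have to go, which is the bound \<open>6 * X * J\<close>.

  The formula is never built as an object. Its literals are the values of a function of clause
  number and variable number, so clauses may have any length and the instance is computed entry by
  entry.\<close>

section \<open>A counter language and its compilation to Turing machines\<close>

text \<open>Register \<open>r \<noteq> 1\<close> is the head position of tape \<open>r\<close>, and tape 1 is write-only. A test
  sees the symbol under the head: on tape 0 that is an input symbol, and on the other tapes
  cell 0 carries the symbol 1, so the symbol 1 means that the register is zero.\<close>

datatype com = Inc nat | Dec nat | Out bool | Seq com com (infixr \<open>;;\<close> 60)
  | While nat "nat \<Rightarrow> bool" com | Cond nat "nat \<Rightarrow> bool" com

definition seen :: "bool list \<Rightarrow> (nat \<Rightarrow> nat) \<Rightarrow> nat \<Rightarrow> nat" where
  "seen x s r = (if r = 0 then (if s 0 < length x then bit_symbol (x ! s 0) else 0)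
     else if s r = 0 then 1 else 0)"

text \<open>The number counts the steps of the compiled machine exactly: a round of a loop pays for
  its test and for the jump back. Decrementing a zero register has no rule, so heads never move left
  of cell 0.\<close>

inductive exec :: "bool list \<Rightarrow> com \<Rightarrow> (nat \<Rightarrow> nat) \<times> bool list \<Rightarrow> nat \<Rightarrow>
    (nat \<Rightarrow> nat) \<times> bool list \<Rightarrow> bool" for x where
  Inc: "r \<noteq> 1 \<Longrightarrow> exec x (Inc r) (s, w) 1 (s(r := Suc (s r)), w)"
| Dec: "r \<noteq> 1 \<Longrightarrow> s r > 0 \<Longrightarrow> exec x (Dec r) (s, w) 1 (s(r := s r - 1), w)"
| Out: "exec x (Out b) (s, w) 1 (s, w @ [b])"
| Seq: "exec x c u m u' \<Longrightarrow> exec x d u' n u'' \<Longrightarrow> exec x (c ;; d) u (m + n) u''"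
| WhileF: "\<not> p (seen x (fst u) r) \<Longrightarrow> exec x (While r p c) u 1 u"
| WhileT: "p (seen x (fst u) r) \<Longrightarrow> exec x c u m u' \<Longrightarrow> exec x (While r p c) u' n u'' \<Longrightarrow>
    exec x (While r p c) u (m + n + 2) u''"
| CondF: "\<not> p (seen x (fst u) r) \<Longrightarrow> exec x (Cond r p c) u 1 u"
| CondT: "p (seen x (fst u) r) \<Longrightarrow> exec x c u m u' \<Longrightarrow> exec x (Cond r p c) u (m + 1) u'"

text \<open>\<open>ITest r p a\<close> falls through if the test succeeds and jumps to \<open>a\<close> otherwise.\<close>

datatype instr = IMove nat move | IOut bool | ITest nat "nat \<Rightarrow> bool" nat

section \<open>Compilation of counter programs to Turing machines\<close>

fun com_size :: "com \<Rightarrow> nat" where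
  "com_size (Inc r) = 1"
| "com_size (Dec r) = 1"
| "com_size (Out b) = 1"
| "com_size (c ;; d) = com_size c + com_size d"
| "com_size (While r p c) = com_size c + 2"
| "com_size (Cond r p c) = com_size c + 1"

text \<open>The number is the absolute address of the first instruction. An unconditional jump is a
  test that always fails; it is put on tape 0, which every machine has.\<close>

fun code :: "com \<Rightarrow> nat \<Rightarrow> instr list" where
  "code (Inc r) a = [IMove r MoveRight]"
| "code (Dec r) a = [IMove r MoveLeft]"
| "code (Out b) a = [IOut b]"
| "code (c ;; d) a = code c a @ code d (a + com_size c)"
| "code (While r p c) a =
     ITest r p (a + com_size c + 2) # code c (Suc a) @ [ITest 0 (\<lambda>_. False) a]"
| "code (Cond r p c) a = ITest r p (a + com_size c + 1) # code c (Suc a)"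

fun regs :: "com \<Rightarrow> nat set" where
  "regs (Inc r) = {r}"
| "regs (Dec r) = {r}"
| "regs (Out b) = {}"
| "regs (c ;; d) = regs c \<union> regs d"
| "regs (While r p c) = insert r (regs c)"
| "regs (Cond r p c) = insert r (regs c)"

lemma finite_regs: "finite (regs c)"
  by (induction c) auto

lemma length_code [simp]: "length (code c a) = com_size c"
  by (induction c arbitrary: a) auto

lemma code_target_le: "ITest r p b \<in> set (code c a) \<Longrightarrow> b \<le> a + com_size c"
  by (induction c arbitrary: a) fastforce+

text \<open>State 0 is spent on writing the mark 1 into cell 0 of the tapes from 2 on, so state
  \<open>q > 0\<close> executes instruction \<open>q - 1\<close> and addresses start at 1.\<close>

definition com_trans :: "instr list \<Rightarrow> nat \<Rightarrow> nat \<Rightarrow> nat list \<Rightarrow> nat \<times> (nat \<times> move) list" where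
  "com_trans P k q ss =
     (if q = 0 then (1, map (\<lambda>j. (if j \<ge> 2 then 1 else ss ! j, Stay)) [0..<k])
      else case P ! (q - 1) of
        IMove r d \<Rightarrow> (q + 1, map (\<lambda>j. (ss ! j, if j = r then d else Stay)) [0..<k])
      | IOut b \<Rightarrow> (q + 1, map (\<lambda>j. if j = 1 then (bit_symbol b, MoveRight) else (ss ! j, Stay)) [0..<k])
      | ITest r p a \<Rightarrow> (if p (ss ! r) then q + 1 else a, map (\<lambda>j. (ss ! j, Stay)) [0..<k]))"

definition com_tm :: "com \<Rightarrow> nat \<Rightarrow> turing_machine" where
  "com_tm c k = \<lparr>num_tapes = k, num_symbols = 3, num_states = 1 + com_size c,
     trans = com_trans (code c 1) k\<rparr>"

lemma com_tm_simps [simp]: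
  "num_tapes (com_tm c k) = k" "num_symbols (com_tm c k) = 3"
  "num_states (com_tm c k) = Suc (com_size c)" "trans (com_tm c k) = com_trans (code c 1) k"
  by (simp_all add: com_tm_def)

lemma wf_com_tm:
  assumes "k \<ge> 2"
  shows "wf_tm (com_tm c k)"
proof -
  have *: "q' \<le> Suc (com_size c) \<and> length as = k \<and> (\<forall>(s, d)\<in>set as. s < 3)"
    if q: "q < Suc (com_size c)" and ss: "length ss = k" "\<forall>s\<in>set ss. s < 3"
      and tr: "com_trans (code c 1) k q ss = (q', as)" for q ss q' as
  proof (cases "q = 0")
    case True
    then show ?thesis
      using tr ss by (auto simp: com_trans_def)
  next
    case False
    then have mem: "code c 1 ! (q - 1) \<in> set (code c 1)"
      using q by (intro nth_mem) auto
    show ?thesis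
    proof (cases "code c 1 ! (q - 1)")
      case (ITest r p b)
      then have "b \<le> 1 + com_size c"
        using code_target_le[of r p b c 1] mem by auto
      then show ?thesis
        using False q tr ss ITest by (auto simp: com_trans_def)
    qed (use False q tr ss in \<open>auto simp: com_trans_def bit_symbol_def split: if_splits\<close>)
  qed
  show ?thesis
    unfolding wf_tm_def using assms * by simp
qed

definition com_tape :: "bool list \<Rightarrow> (nat \<Rightarrow> nat) \<Rightarrow> bool list \<Rightarrow> nat \<Rightarrow> tape" where
  "com_tape x s w j =
     (if j = 0 then (fst (word_tape x), int (s 0))
      else if j = 1 then (fst (word_tape w), int (length w))
      else ((\<lambda>i. if i = 0 then 1 else 0), int (s j)))"

definition com_conf :: "bool list \<Rightarrow> nat \<Rightarrow> nat \<Rightarrow> (nat \<Rightarrow> nat) \<times> bool list \<Rightarrow> tm_config" where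
  "com_conf x k q u = (q, map (com_tape x (fst u) (snd u)) [0..<k])"

lemma read_com_tape: "j \<noteq> 1 \<Longrightarrow> read_tape (com_tape x s w j) = seen x s j"
  by (auto simp: read_tape_def com_tape_def seen_def word_tape_def)

lemma act_read: "act (read_tape t, Stay) t = t"
  by (cases t) (auto simp: act_def read_tape_def)

lemma tm_step_com_tm:
  assumes "q > 0" "q \<le> com_size c"
  shows "tm_step (com_tm c k) (q, map T [0..<k]) =
    (let (q', as) = com_trans (code c 1) k q (map (\<lambda>j. read_tape (T j)) [0..<k])
     in (q', map2 act as (map T [0..<k])))"
  using assms by (simp add: tm_step_def comp_def)

lemma map2_map_upt: "map2 f (map g [0..<k]) (map h [0..<k]) = map (\<lambda>j. f (g j) (h j)) [0..<k]"
  by (simp add: zip_map_map map_zip_map zip_same_conv_map comp_def)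

lemma step_move:
  assumes q: "q > 0" "q \<le> com_size c" and i: "code c 1 ! (q - 1) = IMove r d"
    and r: "r < k" "r \<noteq> 1" and s': "int s' = int (s r) + head_shift d"
  shows "tm_step (com_tm c k) (com_conf x k q (s, w)) = com_conf x k (Suc q) (s(r := s'), w)"
proof -
  have "act (map (\<lambda>j. read_tape (com_tape x s w j)) [0..<k] ! j, if j = r then d else Stay)
      (com_tape x s w j) = com_tape x (s(r := s')) w j" if "j < k" for j
  proof (cases "j = r")
    case True
    then show ?thesis
      using r s' by (auto simp: act_def read_tape_def com_tape_def)
  next
    case False
    then show ?thesis
      using that by (simp add: act_read) (simp add: com_tape_def)
  qed
  then show ?thesis
    using q i unfolding com_conf_def
    by (auto simp: tm_step_com_tm com_trans_def map2_map_upt Let_def)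
qed

lemma step_out:
  assumes q: "q > 0" "q \<le> com_size c" and i: "code c 1 ! (q - 1) = IOut b"
  shows "tm_step (com_tm c k) (com_conf x k q (s, w)) = com_conf x k (Suc q) (s, w @ [b])"
proof -
  have "act (if j = 1 then (bit_symbol b, MoveRight)
        else (map (\<lambda>j. read_tape (com_tape x s w j)) [0..<k] ! j, Stay))
      (com_tape x s w j) = com_tape x s (w @ [b]) j" if "j < k" for j
  proof (cases "j = 1")
    case True
    then show ?thesis
      by (auto simp: act_def com_tape_def word_tape_def nth_append fun_eq_iff nat_eq_iff)
  next
    case False
    then show ?thesis
      using that by (simp add: act_read) (simp add: com_tape_def)
  qed
  then show ?thesis
    using q i unfolding com_conf_def
    by (auto simp: tm_step_com_tm com_trans_def map2_map_upt Let_def)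
qed

lemma step_test:
  assumes q: "q > 0" "q \<le> com_size c" and i: "code c 1 ! (q - 1) = ITest r p a"
    and r: "r < k" "r \<noteq> 1"
  shows "tm_step (com_tm c k) (com_conf x k q u) =
    com_conf x k (if p (seen x (fst u) r) then Suc q else a) u"
proof -
  have "act (map (\<lambda>j. read_tape (com_tape x (fst u) (snd u) j)) [0..<k] ! j, Stay)
      (com_tape x (fst u) (snd u) j) = com_tape x (fst u) (snd u) j" if "j < k" for j
    using that by (simp add: act_read)
  then show ?thesis
    using q i r unfolding com_conf_def
    by (auto simp: tm_step_com_tm com_trans_def map2_map_upt Let_def read_com_tape)
qed

text \<open>The code of \<open>c\<close> is located by an arbitrary prefix \<open>pre\<close>, so
  that the induction applies to subprograms at their own addresses.\<close>

lemma exec_steps: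
  assumes "exec x c u t u'" "regs c \<subseteq> {..<k} - {1}" "code c0 1 = pre @ code c (Suc (length pre)) @ post"
    "k > 0"
  shows "(tm_step (com_tm c0 k) ^^ t) (com_conf x k (Suc (length pre)) u) =
    com_conf x k (Suc (length pre) + com_size c) u'"
  using assms
proof (induction arbitrary: pre post rule: exec.induct)
  case (Inc r s w)
  have "length pre < com_size c0"
    using arg_cong[OF Inc.prems(2), of length] by simp
  with Inc show ?case
    using step_move[of "Suc (length pre)" c0 r MoveRight k "Suc (s r)" s x w] by simp
next
  case (Dec r s w)
  have "length pre < com_size c0"
    using arg_cong[OF Dec.prems(2), of length] by simp
  with Dec show ?case
    using step_move[of "Suc (length pre)" c0 r MoveLeft k "s r - 1" s x w] by simp
next
  case (Out b s w)
  have "length pre < com_size c0"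
    using arg_cong[OF Out.prems(2), of length] by simp
  with Out show ?case
    using step_out[of "Suc (length pre)" c0 b k x s w] by simp
next
  case (Seq c u m u' d n u'')
  have "(tm_step (com_tm c0 k) ^^ m) (com_conf x k (Suc (length pre)) u) =
      com_conf x k (Suc (length pre) + com_size c) u'"
    using Seq.prems by (intro Seq.IH(1)) auto
  moreover have "(tm_step (com_tm c0 k) ^^ n) (com_conf x k (Suc (length (pre @ code c (Suc (length pre))))) u') =
      com_conf x k (Suc (length (pre @ code c (Suc (length pre)))) + com_size d) u''"
    using Seq.prems by (intro Seq.IH(2)) auto
  ultimately show ?case
    by (simp add: add.commute[of m n] funpow_add add.assoc)
next
  case (WhileF p u r c)
  have "length pre < com_size c0"
    using arg_cong[OF WhileF.prems(2), of length] by simp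
  with WhileF show ?case
    using step_test[of "Suc (length pre)" c0 r p "Suc (length pre) + com_size c + 2" k x u] by simp
next
  case (WhileT p u r c m u' n u'')
  let ?M = "tm_step (com_tm c0 k)"
  have len: "length pre + com_size c + 2 \<le> com_size c0"
    using arg_cong[OF WhileT.prems(2), of length] by simp
  have 1: "?M (com_conf x k (Suc (length pre)) u) = com_conf x k (Suc (Suc (length pre))) u"
    using WhileT.hyps WhileT.prems len
      step_test[of "Suc (length pre)" c0 r p "Suc (length pre) + com_size c + 2" k x u] by simp
  let ?pre = "pre @ [ITest r p (Suc (length pre) + com_size c + 2)]"
  have 2: "(?M ^^ m) (com_conf x k (Suc (length ?pre)) u) =
      com_conf x k (Suc (length ?pre) + com_size c) u'"
    using WhileT.prems by (intro WhileT.IH(1)) auto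
  have "code c0 1 ! (Suc (length pre) + com_size c) = ITest 0 (\<lambda>_. False) (Suc (length pre))"
    using WhileT.prems by (simp add: nth_append)
  then have 3: "?M (com_conf x k (Suc (Suc (length pre)) + com_size c) u') =
      com_conf x k (Suc (length pre)) u'"
    using len WhileT.prems
      step_test[of "Suc (Suc (length pre)) + com_size c" c0 0 "\<lambda>_. False" "Suc (length pre)" k x u'] by simp
  have 4: "(?M ^^ n) (com_conf x k (Suc (length pre)) u') =
      com_conf x k (Suc (length pre) + com_size (While r p c)) u''"
    using WhileT.prems by (intro WhileT.IH(2))
  have "m + n + 2 = n + (1 + (m + 1))"
    by simp
  then have "(?M ^^ (m + n + 2)) (com_conf x k (Suc (length pre)) u) =
      (?M ^^ n) (?M ((?M ^^ m) (?M (com_conf x k (Suc (length pre)) u))))"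
    by (simp only: funpow_add o_apply funpow_simps_right(2) funpow.simps One_nat_def id_apply)
  then show ?case
    using 1 2 3 4 by simp
next
  case (CondF p u r c)
  have "length pre < com_size c0"
    using arg_cong[OF CondF.prems(2), of length] by simp
  with CondF show ?case
    using step_test[of "Suc (length pre)" c0 r p "Suc (length pre) + com_size c + 1" k x u] by simp
next
  case (CondT p u r c m u')
  let ?M = "tm_step (com_tm c0 k)"
  have len: "length pre < com_size c0"
    using arg_cong[OF CondT.prems(2), of length] by simp
  have 1: "?M (com_conf x k (Suc (length pre)) u) = com_conf x k (Suc (Suc (length pre))) u"
    using CondT.hyps CondT.prems len
      step_test[of "Suc (length pre)" c0 r p "Suc (length pre) + com_size c + 1" k x u] by simp
  let ?pre = "pre @ [ITest r p (Suc (length pre) + com_size c + 1)]"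
  have 2: "(?M ^^ m) (com_conf x k (Suc (length ?pre)) u) =
      com_conf x k (Suc (length ?pre) + com_size c) u'"
    using CondT.prems by (intro CondT.IH) auto
  have "(?M ^^ (m + 1)) (com_conf x k (Suc (length pre)) u) =
      (?M ^^ m) (?M (com_conf x k (Suc (length pre)) u))"
    by (simp only: funpow_add o_apply funpow.simps One_nat_def id_apply)
  then show ?case
    using 1 2 by simp
qed

lemma exec_polytime:
  fixes p :: "nat poly"
  assumes run: "\<And>x. \<exists>t s. t \<le> poly p (length x) \<and> exec x c (\<lambda>_. 0, []) t (s, f x)"
    and c: "1 \<notin> regs c"
  shows "polytime f"
proof -
  obtain k0 where k0: "\<forall>r\<in>regs c. r < k0"
    using finite_regs[of c] finite_nat_set_iff_bounded by blast
  define k where "k = k0 + 2"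
  have k: "regs c \<subseteq> {..<k} - {1}" "k \<ge> 2"
    using k0 c by (auto simp: k_def dest!: bspec)
  \<comment> \<open>The additional step is the initialisation in state 0.\<close>
  have "\<exists>t\<le>poly (p + 1) (length x). let e = (tm_step (com_tm c k) ^^ t) (init_config (com_tm c k) x)
     in fst e = num_states (com_tm c k) \<and> tm_output e (f x)" for x
  proof -
    obtain t s where t: "t \<le> poly p (length x)" and ex: "exec x c (\<lambda>_. 0, []) t (s, f x)"
      using run by blast
    let ?M = "tm_step (com_tm c k)"
    have init: "snd (init_config (com_tm c k) x) =
        map (\<lambda>j. if j = 0 then word_tape x else word_tape []) [0..<k]"
      using k by (intro nth_equalityI) (auto simp: init_config_def nth_Cons split: nat.splits)
    have rd: "map read_tape (snd (init_config (com_tm c k) x)) =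
        map (\<lambda>j. if j = 0 then read_tape (word_tape x) else 0) [0..<k]"
      unfolding init by (auto simp: read_tape_def word_tape_def)
    have 1: "?M (init_config (com_tm c k) x) = com_conf x k (Suc (length ([] :: instr list))) (\<lambda>_. 0, [])"
    proof -
      have "fst (init_config (com_tm c k) x) = 0"
        by (simp add: init_config_def)
      then show ?thesis
        unfolding tm_step_def rd init
        by (auto simp: com_trans_def map2_map_upt Let_def com_conf_def act_def com_tape_def
            word_tape_def read_tape_def fun_eq_iff)
    qed
    have "(?M ^^ t) (com_conf x k (Suc (length ([] :: instr list))) (\<lambda>_. 0, [])) =
        com_conf x k (Suc (length ([] :: instr list)) + com_size c) (s, f x)"
      using k by (intro exec_steps[OF ex, where post = "[]"]) auto
    then have "(?M ^^ (t + 1)) (init_config (com_tm c k) x) = com_conf x k (Suc (com_size c)) (s, f x)"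
      using 1 by (simp only: funpow_add o_apply funpow.simps One_nat_def id_apply) simp
    moreover have "tm_output (com_conf x k (Suc (com_size c)) (s, f x)) (f x)"
      using k by (auto simp: tm_output_def com_conf_def com_tape_def word_tape_def)
    ultimately show ?thesis
      using t by (intro exI[of _ "t + 1"]) (auto simp: Let_def com_conf_def)
  qed
  then show ?thesis
    unfolding polytime_def computes_within_def using wf_com_tm[OF k(2), of c] by blast
qed

section \<open>Expressions with bounded sums\<close>

text \<open>Variables are de Bruijn indices: \<open>Sum a b\<close> binds \<open>Var 0\<close> in
  \<open>b\<close>. Multiplication, division, comparison and bounded quantifiers are all obtained
  from bounded sums and truncated subtraction.\<close>

datatype exp = Var nat | One | Len | Bit exp | Plus exp exp | Minus exp exp | Sum exp exp

definition bit_at :: "bool list \<Rightarrow> nat \<Rightarrow> bool" where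
  "bit_at x i \<longleftrightarrow> i < length x \<and> x ! i"

fun eval :: "exp \<Rightarrow> bool list \<Rightarrow> (nat \<Rightarrow> nat) \<Rightarrow> nat" where
  "eval (Var i) x \<sigma> = \<sigma> i"
| "eval One x \<sigma> = 1"
| "eval Len x \<sigma> = length x"
| "eval (Bit a) x \<sigma> = of_bool (bit_at x (eval a x \<sigma>))"
| "eval (Plus a b) x \<sigma> = eval a x \<sigma> + eval b x \<sigma>"
| "eval (Minus a b) x \<sigma> = eval a x \<sigma> - eval b x \<sigma>"
| "eval (Sum a b) x \<sigma> = (\<Sum>i<eval a x \<sigma>. eval b x (case_nat i \<sigma>))"

section \<open>Upper bounds on running times\<close>

definition runs where
  "runs x c u \<tau> u' \<longleftrightarrow> (\<exists>t\<le>\<tau>. exec x c u t u')"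

lemma runs_mono: "runs x c u \<tau> u' \<Longrightarrow> \<tau> \<le> \<tau>' \<Longrightarrow> runs x c u \<tau>' u'"
  unfolding runs_def using le_trans by blast

lemma runs_Inc: "r \<noteq> 1 \<Longrightarrow> s' = s(r := Suc (s r)) \<Longrightarrow> runs x (Inc r) (s, w) 1 (s', w)"
  unfolding runs_def using exec.Inc by blast

lemma runs_Dec: "r \<noteq> 1 \<Longrightarrow> s r > 0 \<Longrightarrow> s' = s(r := s r - 1) \<Longrightarrow> runs x (Dec r) (s, w) 1 (s', w)"
  unfolding runs_def using exec.Dec by blast

lemma runs_Out: "runs x (Out b) (s, w) 1 (s, w @ [b])"
  unfolding runs_def using exec.Out by blast

lemma runs_Seq:
  assumes "runs x c u m u'" "runs x d u' n u''"
  shows "runs x (c ;; d) u (m + n) u''"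
  using assms unfolding runs_def by (meson add_mono exec.Seq)

lemma runs_Inc_Seq:
  assumes "r \<noteq> 1" "runs x d (s(r := Suc (s r)), w) n u"
  shows "runs x (Inc r ;; d) (s, w) (Suc n) u"
  using runs_Seq[OF runs_Inc[OF assms(1) refl[of "s(r := Suc (s r))"]] assms(2)] unfolding plus_1_eq_Suc .

lemma runs_Dec_Seq:
  assumes "r \<noteq> 1" "s r > 0" "runs x d (s(r := s r - 1), w) n u"
  shows "runs x (Dec r ;; d) (s, w) (Suc n) u"
  using runs_Seq[OF runs_Dec[OF assms(1,2) refl[of "s(r := s r - 1)"]] assms(3)] unfolding plus_1_eq_Suc .

lemma runs_CondF: "\<not> p (seen x (fst u) r) \<Longrightarrow> u' = u \<Longrightarrow> runs x (Cond r p c) u (Suc m) u'"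
  unfolding runs_def using exec.CondF by (metis One_nat_def Suc_le_mono zero_le)

lemma runs_CondT: "p (seen x (fst u) r) \<Longrightarrow> runs x c u m u' \<Longrightarrow> runs x (Cond r p c) u (Suc m) u'"
  unfolding runs_def by (metis Suc_eq_plus1 Suc_le_mono exec.CondT)

text \<open>\<open>S i\<close> is the state before round \<open>i\<close>, so the loop invariant is
  an explicit sequence of states. The 2 pays for test and jump, the final 1 for the failing
  test.\<close>

lemma runs_While:
  assumes "\<And>i. i < n \<Longrightarrow> p (seen x (fst (S i)) r)" "\<And>i. i < n \<Longrightarrow> runs x c (S i) \<tau> (S (Suc i))"
    and "\<not> p (seen x (fst (S n)) r)"
  shows "runs x (While r p c) (S 0) (n * (\<tau> + 2) + 1) (S n)"
  using assms
proof (induction n arbitrary: S)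
  case 0
  then show ?case
    unfolding runs_def using exec.WhileF[of p x "S 0" r c] by auto
next
  case (Suc n)
  have "runs x (While r p c) (S (Suc 0)) (n * (\<tau> + 2) + 1) (S (Suc n))"
    using Suc.prems by (intro Suc.IH[of "\<lambda>i. S (Suc i)"]) auto
  then obtain t2 where t2: "t2 \<le> n * (\<tau> + 2) + 1" "exec x (While r p c) (S (Suc 0)) t2 (S (Suc n))"
    unfolding runs_def by blast
  obtain t1 where t1: "t1 \<le> \<tau>" "exec x c (S 0) t1 (S (Suc 0))"
    using Suc.prems(2)[of 0] unfolding runs_def by blast
  have "exec x (While r p c) (S 0) (t1 + t2 + 2) (S (Suc n))"
    using Suc.prems(1)[of 0] t1 t2 by (intro exec.WhileT) auto
  moreover have "t1 + t2 + 2 \<le> Suc n * (\<tau> + 2) + 1"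
    using t1(1) t2(1) by simp
  ultimately show ?case
    unfolding runs_def by blast
qed

text \<open>The argument is the symbol seen, not the register: the blank 0 is seen exactly when the
  head is off the marked cell 0.\<close>

definition nz :: "nat \<Rightarrow> bool" where "nz v \<longleftrightarrow> v = 0"

lemma nz_seen: "r \<noteq> 0 \<Longrightarrow> nz (seen x s r) \<longleftrightarrow> s r > 0"
  by (simp add: nz_def seen_def)

text \<open>\<open>comp e \<rho> d m\<close> adds the value of \<open>e\<close> to register \<open>d\<close>. Variable \<open>i\<close> is kept in register
  \<open>\<rho> i\<close>, and the registers from \<open>m\<close> on are scratch: they are zero before and after.\<close>

fun comp :: "exp \<Rightarrow> (nat \<Rightarrow> nat) \<Rightarrow> nat \<Rightarrow> nat \<Rightarrow> com" where
  "comp (Var i) \<rho> d m =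
     While (\<rho> i) nz (Dec (\<rho> i) ;; Inc d ;; Inc m) ;; While m nz (Dec m ;; Inc (\<rho> i))"
| "comp One \<rho> d m = Inc d"
| "comp Len \<rho> d m =
     While 0 (\<lambda>v. v \<noteq> 0) (Inc 0 ;; Inc d ;; Inc m) ;; While m nz (Dec m ;; Dec 0)"
| "comp (Bit a) \<rho> d m =
     comp a \<rho> m (m + 1) ;; While m nz (Dec m ;; Inc (m + 1) ;; Inc 0) ;;
     Cond 0 (\<lambda>v. v = 2) (Inc d) ;; While (m + 1) nz (Dec (m + 1) ;; Dec 0)"
| "comp (Plus a b) \<rho> d m = comp a \<rho> d m ;; comp b \<rho> d m"
| "comp (Minus a b) \<rho> d m =
     comp a \<rho> m (m + 2) ;; comp b \<rho> (m + 1) (m + 2) ;;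
     While (m + 1) nz (Dec (m + 1) ;; Cond m nz (Dec m)) ;; While m nz (Dec m ;; Inc d)"
| "comp (Sum a b) \<rho> d m =
     comp a \<rho> m (m + 1) ;;
     While m nz (Dec m ;; comp b (case_nat (m + 1) \<rho>) d (m + 2) ;; Inc (m + 1)) ;;
     While (m + 1) nz (Dec (m + 1))"

lemma regs_comp:
  assumes "\<And>i. 1 \<noteq> \<rho> i" "1 \<noteq> d" "m \<ge> 2"
  shows "1 \<notin> regs (comp e \<rho> d m)"
  using assms by (induction e arbitrary: \<rho> d m) (auto split: nat.splits)

section \<open>Polynomial bounds for the values of expressions and their evaluation\<close>

lemma poly_nat_mono: "a \<le> b \<Longrightarrow> poly p a \<le> poly p (b :: nat)"
  by (induction p) (auto intro: add_mono mult_mono)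

text \<open>The argument bounds the variables and the input length. Inside \<open>Sum a b\<close>
  the bound variable can be as large as the value of \<open>a\<close>, hence the composition with
  the old bound plus that value.\<close>

fun val_poly :: "exp \<Rightarrow> nat poly" where
  "val_poly (Var i) = [:0, 1:]"
| "val_poly One = 1"
| "val_poly Len = [:0, 1:]"
| "val_poly (Bit a) = 1"
| "val_poly (Plus a b) = val_poly a + val_poly b"
| "val_poly (Minus a b) = val_poly a"
| "val_poly (Sum a b) = val_poly a * pcompose (val_poly b) ([:0, 1:] + val_poly a)"

lemma case_nat_le: "(\<And>j. \<sigma> j \<le> B) \<Longrightarrow> i \<le> B' \<Longrightarrow> B \<le> B' \<Longrightarrow> case_nat i \<sigma> j \<le> (B' :: nat)"
  by (cases j) (auto intro: order_trans)

lemma eval_le: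
  assumes "\<And>i. \<sigma> i \<le> B" "length x \<le> B"
  shows "eval e x \<sigma> \<le> poly (val_poly e) B"
  using assms
proof (induction e arbitrary: \<sigma> B)
  case (Sum a b)
  have a: "eval a x \<sigma> \<le> poly (val_poly a) B"
    using Sum by blast
  have "eval b x (case_nat i \<sigma>) \<le> poly (val_poly b) (B + poly (val_poly a) B)" if "i < eval a x \<sigma>" for i
    using that a Sum.prems by (intro Sum.IH case_nat_le[of \<sigma> B]) auto
  then have "eval (Sum a b) x \<sigma> \<le>
      of_nat (card {..<eval a x \<sigma>}) * poly (val_poly b) (B + poly (val_poly a) B)"
    unfolding eval.simps by (intro sum_bounded_above) auto
  also have "\<dots> \<le> poly (val_poly a) B * poly (val_poly b) (B + poly (val_poly a) B)"
    using a by (simp add: mult_right_mono)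
  finally show ?case
    by (simp add: poly_pcompose)
qed (auto intro: add_mono simp: le_diff_conv trans_le_add1)

text \<open>A unit of a variable costs 5 steps to be moved into \<open>d\<close> and
  \<open>m\<close> and 4 to be restored, and both loops end with a failing test: this gives
  \<open>[:2, 9:]\<close>. In \<open>Sum\<close> a round costs 4 steps besides the body, and
  clearing the index register 3 more per round.\<close>

fun time_poly :: "exp \<Rightarrow> nat poly" where
  "time_poly (Var i) = [:2, 9:]"
| "time_poly One = 1"
| "time_poly Len = [:2, 9:]"
| "time_poly (Bit a) = time_poly a + 9 * val_poly a + 4"
| "time_poly (Plus a b) = time_poly a + time_poly b"
| "time_poly (Minus a b) = time_poly a + time_poly b + 5 * val_poly b + 4 * val_poly a + 2"
| "time_poly (Sum a b) = time_poly a +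
     val_poly a * (pcompose (time_poly b) ([:0, 1:] + val_poly a) + 7) + 2"

lemma runs_comp:
  assumes "\<And>i. s (\<rho> i) = \<sigma> i" "\<And>i. 2 \<le> \<rho> i \<and> \<rho> i < m \<and> \<rho> i \<noteq> d" "2 \<le> d" "d < m"
    and "\<And>r. r \<ge> m \<Longrightarrow> s r = 0" "s 0 = 0" "\<And>i. \<sigma> i \<le> B" "length x \<le> B"
  shows "runs x (comp e \<rho> d m) (s, w) (poly (time_poly e) B) (s(d := s d + eval e x \<sigma>), w)"
  using assms
proof (induction e arbitrary: \<rho> \<sigma> d m s B)
  case (Var i)
  let ?r = "\<rho> i"
  let ?v = "\<sigma> i"
  have r: "?r \<noteq> 0" "?r \<noteq> 1" "?r \<noteq> d" "?r \<noteq> m" "d \<noteq> m" "d \<noteq> 1" "m \<noteq> 1" "d \<noteq> 0" "m \<noteq> 0"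
    using Var.prems(2)[of i] Var.prems(3,4) by auto
  have s: "s ?r = ?v" "s m = 0"
    using Var.prems by auto
  \<comment> \<open>Reading a register destroys it, so \<open>m\<close> keeps a copy from which the
    second loop restores it.\<close>
  let ?S = "\<lambda>j. (s(?r := ?v - j, d := s d + j, m := j), w)"
  have 1: "runs x (While ?r nz (Dec ?r ;; Inc d ;; Inc m)) (?S 0) (?v * (Suc (Suc 1) + 2) + 1) (?S ?v)"
    using r s
    by (intro runs_While runs_Dec_Seq runs_Inc_Seq runs_Dec runs_Inc) (auto simp: nz_seen fun_eq_iff)
  let ?S' = "\<lambda>j. (s(?r := j, d := s d + ?v, m := ?v - j), w)"
  have 2: "runs x (While m nz (Dec m ;; Inc ?r)) (?S' 0) (?v * (Suc 1 + 2) + 1) (?S' ?v)"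
    using r s
    by (intro runs_While runs_Dec_Seq runs_Inc_Seq runs_Dec runs_Inc) (auto simp: nz_seen fun_eq_iff)
  have e: "?S 0 = (s, w)" "?S' 0 = ?S ?v" "?S' ?v = (s(d := s d + eval (Var i) x \<sigma>), w)"
    using r s by (auto simp: fun_eq_iff)
  have "runs x (comp (Var i) \<rho> d m) (s, w) (?v * (Suc (Suc 1) + 2) + 1 + (?v * (Suc 1 + 2) + 1))
      (s(d := s d + eval (Var i) x \<sigma>), w)"
    using runs_Seq[OF 1[unfolded e(1)] 2[unfolded e(2,3)]] by simp
  then show ?case
    by (rule runs_mono) (use Var.prems(7)[of i] in simp)
next
  case One
  then show ?case
    by (simp only: comp.simps time_poly.simps poly_1 eval.simps) (rule runs_Inc; auto simp: fun_eq_iff)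
next
  case Len
  let ?v = "length x"
  have r: "d \<noteq> m" "d \<noteq> 1" "m \<noteq> 1" "d \<noteq> 0" "m \<noteq> 0"
    using Len.prems(3,4) by auto
  have s: "s 0 = 0" "s m = 0"
    using Len.prems by auto
  let ?S = "\<lambda>j. (s(0 := j, d := s d + j, m := j), w)"
  have 1: "runs x (While 0 (\<lambda>v. v \<noteq> 0) (Inc 0 ;; Inc d ;; Inc m)) (?S 0) (?v * (Suc (Suc 1) + 2) + 1) (?S ?v)"
    using r s
    by (intro runs_While runs_Dec_Seq runs_Inc_Seq runs_Dec runs_Inc)
      (auto simp: seen_def bit_symbol_def fun_eq_iff)
  let ?S' = "\<lambda>j. (s(0 := ?v - j, d := s d + ?v, m := ?v - j), w)"
  have 2: "runs x (While m nz (Dec m ;; Dec 0)) (?S' 0) (?v * (Suc 1 + 2) + 1) (?S' ?v)"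
    using r s
    by (intro runs_While runs_Dec_Seq runs_Inc_Seq runs_Dec runs_Inc) (auto simp: nz_seen fun_eq_iff)
  have e: "?S 0 = (s, w)" "?S' 0 = ?S ?v" "?S' ?v = (s(d := s d + eval Len x \<sigma>), w)"
    using r s by (auto simp: fun_eq_iff)
  have "runs x (comp Len \<rho> d m) (s, w) (?v * (Suc (Suc 1) + 2) + 1 + (?v * (Suc 1 + 2) + 1))
      (s(d := s d + eval Len x \<sigma>), w)"
    using runs_Seq[OF 1[unfolded e(1)] 2[unfolded e(2,3)]] by simp
  then show ?case
    by (rule runs_mono) (use Len.prems(8) in simp)
next
  case (Bit a)
  let ?v = "eval a x \<sigma>"
  have r: "d \<noteq> m" "d \<noteq> Suc m" "d \<noteq> 1" "m \<noteq> 1" "Suc m \<noteq> 1" "d \<noteq> 0" "m \<noteq> 0"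
    using Bit.prems(3,4) by auto
  have s: "s 0 = 0" "s m = 0" "s (Suc m) = 0"
    using Bit.prems by auto
  have 0: "runs x (comp a \<rho> m (m + 1)) (s, w) (poly (time_poly a) B) (s(m := s m + ?v), w)"
    using Bit.prems
    by (intro Bit.IH) (auto simp: less_Suc_eq) 
  \<comment> \<open>The value becomes the head position on tape 0; \<open>m + 1\<close> remembers
    how far the head has to return.\<close>
  let ?S = "\<lambda>j. (s(m := ?v - j, Suc m := j, 0 := j), w)"
  have 1: "runs x (While m nz (Dec m ;; Inc (m + 1) ;; Inc 0)) (?S 0) (?v * (Suc (Suc 1) + 2) + 1) (?S ?v)"
    using r s
    by (intro runs_While runs_Dec_Seq runs_Inc_Seq runs_Dec runs_Inc) (auto simp: nz_seen fun_eq_iff)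
  let ?S' = "\<lambda>j. (s(Suc m := ?v - j, 0 := ?v - j, d := s d + of_bool (bit_at x ?v)), w)"
  have 2: "runs x (Cond 0 (\<lambda>v. v = 2) (Inc d)) (?S ?v) (Suc 1) (?S' 0)"
  proof (cases "bit_at x ?v")
    case True
    then show ?thesis
      using r s
      by (intro runs_CondT runs_Inc) (auto simp: seen_def bit_at_def bit_symbol_def fun_eq_iff)
  next
    case False
    then show ?thesis
      using r s
      by (intro runs_CondF) (auto simp: seen_def bit_at_def bit_symbol_def fun_eq_iff)
  qed
  have 3: "runs x (While (m + 1) nz (Dec (m + 1) ;; Dec 0)) (?S' 0) (?v * (Suc 1 + 2) + 1) (?S' ?v)"
    using r s
    by (intro runs_While runs_Dec_Seq runs_Inc_Seq runs_Dec runs_Inc) (auto simp: nz_seen fun_eq_iff)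
  have e: "?S 0 = (s(m := s m + ?v), w)" "?S' ?v = (s(d := s d + eval (Bit a) x \<sigma>), w)"
    using r s by (auto simp: fun_eq_iff)
  have "runs x (comp (Bit a) \<rho> d m) (s, w)
      (poly (time_poly a) B + ((?v * (Suc (Suc 1) + 2) + 1) + (Suc 1 + (?v * (Suc 1 + 2) + 1))))
      (s(d := s d + eval (Bit a) x \<sigma>), w)"
    using runs_Seq[OF 0 runs_Seq[OF 1[unfolded e(1)] runs_Seq[OF 2 3[unfolded e(2)]]]] by simp
  then show ?case
    by (rule runs_mono) (use eval_le[of \<sigma> B x a] Bit.prems(7,8) in simp)
next
  case (Plus a b)
  have 1: "runs x (comp a \<rho> d m) (s, w) (poly (time_poly a) B) (s(d := s d + eval a x \<sigma>), w)"
    using Plus.prems by (intro Plus.IH)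
  let ?s = "s(d := s d + eval a x \<sigma>)"
  have 2: "runs x (comp b \<rho> d m) (?s, w) (poly (time_poly b) B) (?s(d := ?s d + eval b x \<sigma>), w)"
    using Plus.prems by (intro Plus.IH) auto
  have "?s(d := ?s d + eval b x \<sigma>) = s(d := s d + eval (Plus a b) x \<sigma>)"
    by (auto simp: fun_eq_iff)
  then show ?case
    using runs_Seq[OF 1 2] by (simp only: comp.simps time_poly.simps poly_add)
next
  case (Minus a b)
  let ?a = "eval a x \<sigma>"
  let ?b = "eval b x \<sigma>"
  have r: "d \<noteq> m" "d \<noteq> Suc m" "d \<noteq> 1" "m \<noteq> 1" "Suc m \<noteq> 1" "d \<noteq> 0" "m \<noteq> 0"
    using Minus.prems(3,4) by auto
  have s: "s 0 = 0" "s m = 0" "s (Suc m) = 0"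
    using Minus.prems by auto
  have \<rho>: "\<rho> i \<noteq> m" "\<rho> i \<noteq> Suc m" "\<rho> i < Suc (Suc m)" for i
    using Minus.prems(2)[of i] by auto
  have 0: "runs x (comp a \<rho> m (m + 2)) (s, w) (poly (time_poly a) B) (s(m := s m + ?a), w)"
    using Minus.prems \<rho> by (intro Minus.IH) auto
  let ?s = "s(m := s m + ?a)"
  have 1: "runs x (comp b \<rho> (m + 1) (m + 2)) (?s, w) (poly (time_poly b) B)
      (?s(m + 1 := ?s (m + 1) + ?b), w)"
    using Minus.prems \<rho> by (intro Minus.IH) auto
  \<comment> \<open>The conditional decrement leaves \<open>m\<close> at zero once it is exhausted,
    which is truncated subtraction.\<close>
  let ?S = "\<lambda>j. (s(m := ?a - j, Suc m := ?b - j), w)"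
  have 2: "runs x (While (m + 1) nz (Dec (m + 1) ;; Cond m nz (Dec m))) (?S 0)
      (?b * ((1 + Suc 1) + 2) + 1) (?S ?b)"
  proof (intro runs_While runs_Seq)
    fix j
    assume j: "j < ?b"
    show "runs x (Dec (m + 1)) (?S j) 1 (s(m := ?a - j, Suc m := ?b - Suc j), w)"
      using r j by (intro runs_Dec) (auto simp: fun_eq_iff)
    show "runs x (Cond m nz (Dec m)) (s(m := ?a - j, Suc m := ?b - Suc j), w) (Suc 1) (?S (Suc j))"
    proof (cases "j < ?a")
      case True
      then show ?thesis
        using r by (intro runs_CondT runs_Dec) (auto simp: nz_seen fun_eq_iff)
    next
      case False
      then show ?thesis
        using r by (intro runs_CondF) (auto simp: nz_seen fun_eq_iff)
    qed
  qed (use r in \<open>auto simp: nz_seen\<close>)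
  let ?S' = "\<lambda>j. (s(m := ?a - ?b - j, d := s d + j), w)"
  have 3: "runs x (While m nz (Dec m ;; Inc d)) (?S' 0) ((?a - ?b) * (Suc 1 + 2) + 1) (?S' (?a - ?b))"
    using r s
    by (intro runs_While runs_Dec_Seq runs_Inc_Seq runs_Dec runs_Inc) (auto simp: nz_seen fun_eq_iff)
  have e: "?S 0 = (?s(m + 1 := ?s (m + 1) + ?b), w)" "?S' 0 = ?S ?b"
    "?S' (?a - ?b) = (s(d := s d + eval (Minus a b) x \<sigma>), w)"
    using r s by (auto simp: fun_eq_iff)
  have "runs x (comp (Minus a b) \<rho> d m) (s, w)
      (poly (time_poly a) B + (poly (time_poly b) B + ((?b * ((1 + Suc 1) + 2) + 1) +
        ((?a - ?b) * (Suc 1 + 2) + 1))))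
      (s(d := s d + eval (Minus a b) x \<sigma>), w)"
    using runs_Seq[OF 0 runs_Seq[OF 1 runs_Seq[OF 2[unfolded e(1)] 3[unfolded e(2,3)]]]] by simp
  then show ?case
    by (rule runs_mono)
      (use eval_le[of \<sigma> B x a] eval_le[of \<sigma> B x b] Minus.prems(7,8) in \<open>simp\<close>)
next
  case (Sum a b)
  let ?a = "eval a x \<sigma>"
  let ?B = "B + poly (val_poly a) B"
  have r: "d \<noteq> m" "d \<noteq> Suc m" "d \<noteq> 1" "m \<noteq> 1" "Suc m \<noteq> 1" "d \<noteq> 0" "m \<noteq> 0"
    using Sum.prems(3,4) by auto
  have s: "s 0 = 0" "s m = 0" "s (Suc m) = 0"
    using Sum.prems by auto
  have \<rho>: "\<rho> i \<noteq> m" "\<rho> i \<noteq> Suc m" "\<rho> i < Suc (Suc m)" "\<rho> i < Suc m" for i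
    using Sum.prems(2)[of i] by auto
  have va: "?a \<le> poly (val_poly a) B"
    using Sum.prems by (intro eval_le)
  have 0: "runs x (comp a \<rho> m (m + 1)) (s, w) (poly (time_poly a) B) (s(m := s m + ?a), w)"
    using Sum.prems \<rho> by (intro Sum.IH) auto
  \<comment> \<open>Register \<open>m\<close> holds the number of rounds that remain and
    \<open>m + 1\<close> the bound variable.\<close>
  let ?S = "\<lambda>j. (s(m := ?a - j, Suc m := j, d := s d + (\<Sum>i<j. eval b x (case_nat i \<sigma>))), w)"
  have 1: "runs x (While m nz (Dec m ;; comp b (case_nat (m + 1) \<rho>) d (m + 2) ;; Inc (m + 1))) (?S 0)
      (?a * ((1 + (poly (time_poly b) ?B + 1)) + 2) + 1) (?S ?a)"
  proof (intro runs_While runs_Seq)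
    fix j
    assume j: "j < ?a"
    let ?s = "s(m := ?a - Suc j, Suc m := j, d := s d + (\<Sum>i<j. eval b x (case_nat i \<sigma>)))"
    show "runs x (Dec m) (?S j) 1 (?s, w)"
      using r j by (intro runs_Dec) (auto simp: fun_eq_iff)
    show "runs x (comp b (case_nat (m + 1) \<rho>) d (m + 2)) (?s, w) (poly (time_poly b) ?B)
        (?s(d := ?s d + eval b x (case_nat j \<sigma>)), w)"
    proof (intro Sum.IH case_nat_le)
      show "?s (case_nat (m + 1) \<rho> i) = case_nat j \<sigma> i" for i
        using Sum.prems(1,2) r \<rho> by (cases i) auto
      show "2 \<le> case_nat (m + 1) \<rho> i \<and> case_nat (m + 1) \<rho> i < m + 2 \<and> case_nat (m + 1) \<rho> i \<noteq> d" for i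
        using Sum.prems(2) r \<rho> by (cases i) auto
    qed (use Sum.prems j va r in auto)
    show "runs x (Inc (m + 1)) (?s(d := ?s d + eval b x (case_nat j \<sigma>)), w) 1 (?S (Suc j))"
      using r j by (intro runs_Inc) (auto simp: fun_eq_iff)
  qed (use r in \<open>auto simp: nz_seen\<close>)
  let ?S' = "\<lambda>j. (s(Suc m := ?a - j, d := s d + eval (Sum a b) x \<sigma>), w)"
  have 2: "runs x (While (m + 1) nz (Dec (m + 1))) (?S' 0) (?a * (1 + 2) + 1) (?S' ?a)"
    using r s by (intro runs_While runs_Dec) (auto simp: nz_seen fun_eq_iff)
  have e: "?S 0 = (s(m := s m + ?a), w)" "?S' 0 = ?S ?a" "?S' ?a = (s(d := s d + eval (Sum a b) x \<sigma>), w)"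
    using r s by (auto simp: fun_eq_iff)
  have "runs x (comp (Sum a b) \<rho> d m) (s, w)
      (poly (time_poly a) B + ((?a * ((1 + (poly (time_poly b) ?B + 1)) + 2) + 1) + (?a * (1 + 2) + 1)))
      (s(d := s d + eval (Sum a b) x \<sigma>), w)"
    using runs_Seq[OF 0 runs_Seq[OF 1[unfolded e(1)] 2[unfolded e(2,3)]]] by simp
  moreover have "?a * ((1 + (poly (time_poly b) ?B + 1)) + 2) + ?a * (1 + 2) =
      ?a * (poly (time_poly b) ?B + 7)"
    by algebra
  moreover have "?a * (poly (time_poly b) ?B + 7) \<le> poly (val_poly a) B * (poly (time_poly b) ?B + 7)"
    using va by (rule mult_right_mono) simp
  ultimately show ?case
    by (elim runs_mono) (simp add: poly_pcompose)
qed

text \<open>Every output bit is computed afresh from its index. Register 3 counts the bits to come,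
  4 is the index and 5 the value; all other variables share register 2, which is always
  zero.\<close>

theorem polytime_map_eval:
  "polytime (\<lambda>x. map (\<lambda>i. eval b x (case_nat i (\<lambda>_. 0)) > 0) [0..<eval l x (\<lambda>_. 0)])"
proof -
  let ?\<rho> = "\<lambda>_ :: nat. 2 :: nat"
  let ?z = "\<lambda>_ :: nat. 0 :: nat"
  let ?out = "\<lambda>x n. map (\<lambda>i. eval b x (case_nat i (\<lambda>_. 0)) > 0) [0..<n]"
  let ?body = "Dec 3 ;; comp b (case_nat 4 ?\<rho>) 5 6 ;; Cond 5 (\<lambda>v. v = 1) (Out False) ;;
    Cond 5 nz (Out True) ;; While 5 nz (Dec 5) ;; Inc 4"
  let ?c = "comp l ?\<rho> 3 4 ;; While 3 nz ?body"
  let ?B = "[:0, 1:] + val_poly l"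
  let ?tb = "pcompose (time_poly b) ?B + 3 * pcompose (val_poly b) ?B + 7"
  let ?T = "time_poly l + (val_poly l * (?tb + 2) + 1)"
  show ?thesis
  proof (rule exec_polytime)
    show "1 \<notin> regs ?c"
      using regs_comp[of ?\<rho> 3 4 l] regs_comp[of "case_nat 4 ?\<rho>" 5 6 b]
      by (auto split: nat.splits)
    fix x
    let ?L = "eval l x ?z"
    have L: "?L \<le> poly (val_poly l) (length x)"
      by (intro eval_le) auto
    have 0: "runs x (comp l ?\<rho> 3 4) (?z, []) (poly (time_poly l) (length x)) (?z(3 := ?z 3 + ?L), [])"
      by (intro runs_comp) auto
    let ?S = "\<lambda>j. (?z(3 := ?L - j, 4 := j), ?out x j)"
    have 1: "runs x (While 3 nz ?body) (?S 0) (?L * (poly ?tb (length x) + 2) + 1) (?S ?L)"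
    proof (intro runs_While)
      fix j
      assume j: "j < ?L"
      let ?v = "eval b x (case_nat j ?z)"
      let ?s = "?z(3 := ?L - Suc j, 4 := j)"
      let ?t = "?s(5 := ?s 5 + ?v)"
      let ?n = "poly ?B (length x)"
      have jn: "j \<le> ?n"
        using j L by simp
      have v: "?v \<le> poly (val_poly b) ?n"
        using jn by (intro eval_le case_nat_le[of _ 0]) auto
      have a: "runs x (Dec 3) (?S j) 1 (?s, ?out x j)"
        using j by (intro runs_Dec) (auto simp: fun_eq_iff)
      have b: "runs x (comp b (case_nat 4 ?\<rho>) 5 6) (?s, ?out x j) (poly (time_poly b) ?n) (?t, ?out x j)"
        using jn by (intro runs_comp case_nat_le[of _ 0]) (auto split: nat.splits)
      have c: "runs x (Cond 5 (\<lambda>v. v = 1) (Out False)) (?t, ?out x j) (Suc 1)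
          (?t, if ?v = 0 then ?out x (Suc j) else ?out x j)"
      proof (cases "?v = 0")
        case True
        then show ?thesis
          using runs_Out[of x False ?t "?out x j"] by (intro runs_CondT) (auto simp: seen_def)
      next
        case False
        then show ?thesis
          by (intro runs_CondF) (auto simp: seen_def)
      qed
      have d: "runs x (Cond 5 nz (Out True)) (?t, if ?v = 0 then ?out x (Suc j) else ?out x j) (Suc 1)
          (?t, ?out x (Suc j))"
      proof (cases "?v = 0")
        case True
        then show ?thesis
          by (intro runs_CondF) (auto simp: nz_seen)
      next
        case False
        then show ?thesis
          using runs_Out[of x True ?t "?out x j"] by (intro runs_CondT) (auto simp: nz_seen)
      qed
      let ?S' = "\<lambda>i. (?s(5 := ?v - i), ?out x (Suc j))"
      have e: "runs x (While 5 nz (Dec 5)) (?S' 0) (?v * (1 + 2) + 1) (?S' ?v)"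
        by (intro runs_While runs_Dec) (auto simp: nz_seen fun_eq_iff)
      have f: "runs x (Inc 4) (?S' ?v) 1 (?S (Suc j))"
        by (intro runs_Inc) (auto simp: fun_eq_iff)
      have e0: "?S' 0 = (?t, ?out x (Suc j))"
        by simp
      have "runs x ?body (?S j) (1 + (poly (time_poly b) ?n + (Suc 1 + (Suc 1 + ((?v * (1 + 2) + 1) + 1)))))
          (?S (Suc j))"
        by (intro runs_Seq[OF a] runs_Seq[OF b] runs_Seq[OF c] runs_Seq[OF d] runs_Seq[OF e[unfolded e0] f])
      then show "runs x ?body (?S j) (poly ?tb (length x)) (?S (Suc j))"
        by (rule runs_mono) (use v in \<open>simp add: poly_pcompose\<close>)
    qed (auto simp: nz_seen)
    have e: "?S 0 = (?z(3 := ?z 3 + ?L), [])"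
      by (auto simp: fun_eq_iff)
    have "?L * (poly ?tb (length x) + 2) \<le> poly (val_poly l) (length x) * (poly ?tb (length x) + 2)"
      using L by (rule mult_right_mono) simp
    then have "runs x ?c (?z, []) (poly ?T (length x)) (?S ?L)"
      by (intro runs_mono[OF runs_Seq[OF 0 1[unfolded e]]]) simp
    then show "\<exists>t s. t \<le> poly ?T (length x) \<and> exec x ?c (?z, []) t (s, ?out x ?L)"
      unfolding runs_def by blast
  qed
qed

section \<open>Functions given by expressions\<close>

fun rename :: "(nat \<Rightarrow> nat) \<Rightarrow> exp \<Rightarrow> exp" where
  "rename f (Var i) = Var (f i)"
| "rename f One = One"
| "rename f Len = Len"
| "rename f (Bit a) = Bit (rename f a)"
| "rename f (Plus a b) = Plus (rename f a) (rename f b)"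
| "rename f (Minus a b) = Minus (rename f a) (rename f b)"
| "rename f (Sum a b) = Sum (rename f a) (rename (case_nat 0 (\<lambda>i. Suc (f i))) b)"

fun subst :: "(nat \<Rightarrow> exp) \<Rightarrow> exp \<Rightarrow> exp" where
  "subst \<theta> (Var i) = \<theta> i"
| "subst \<theta> One = One"
| "subst \<theta> Len = Len"
| "subst \<theta> (Bit a) = Bit (subst \<theta> a)"
| "subst \<theta> (Plus a b) = Plus (subst \<theta> a) (subst \<theta> b)"
| "subst \<theta> (Minus a b) = Minus (subst \<theta> a) (subst \<theta> b)"
| "subst \<theta> (Sum a b) = Sum (subst \<theta> a) (subst (case_nat (Var 0) (\<lambda>i. rename Suc (\<theta> i))) b)"

lemma eval_rename: "eval (rename f e) x \<sigma> = eval e x (\<lambda>i. \<sigma> (f i))"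
proof (induction e arbitrary: f \<sigma>)
  case (Sum a b)
  have "(\<lambda>j. case_nat i \<sigma> (case_nat 0 (\<lambda>i. Suc (f i)) j)) = case_nat i (\<lambda>i. \<sigma> (f i))" for i
    by (auto simp: fun_eq_iff split: nat.splits)
  then show ?case
    by (simp add: Sum)
qed simp_all

lemma eval_subst: "eval (subst \<theta> e) x \<sigma> = eval e x (\<lambda>i. eval (\<theta> i) x \<sigma>)"
proof (induction e arbitrary: \<theta> \<sigma>)
  case (Sum a b)
  have "(\<lambda>j. eval (case_nat (Var 0) (\<lambda>i. rename Suc (\<theta> i)) j) x (case_nat i \<sigma>)) =
      case_nat i (\<lambda>i. eval (\<theta> i) x \<sigma>)" for i
    by (auto simp: fun_eq_iff eval_rename split: nat.splits)
  then show ?case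
    by (simp add: Sum)
qed simp_all

section \<open>Closure properties of the functions given by expressions\<close>

definition pexp :: "(bool list \<Rightarrow> (nat \<Rightarrow> nat) \<Rightarrow> nat) \<Rightarrow> bool" where
  "pexp F \<longleftrightarrow> (\<exists>e. \<forall>x \<sigma>. eval e x \<sigma> = F x \<sigma>)"

definition ppred :: "(bool list \<Rightarrow> (nat \<Rightarrow> nat) \<Rightarrow> bool) \<Rightarrow> bool" where
  "ppred P \<longleftrightarrow> pexp (\<lambda>x \<sigma>. of_bool (P x \<sigma>))"

lemma pexpI: "(\<And>x \<sigma>. eval e x \<sigma> = F x \<sigma>) \<Longrightarrow> pexp F"
  unfolding pexp_def by blast

lemma pexp_cong: "pexp F \<Longrightarrow> (\<And>x \<sigma>. F x \<sigma> = G x \<sigma>) \<Longrightarrow> pexp G"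
  unfolding pexp_def by simp

lemma ppred_cong: "ppred F \<Longrightarrow> (\<And>x \<sigma>. F x \<sigma> = G x \<sigma>) \<Longrightarrow> ppred G"
  unfolding ppred_def pexp_def by simp

lemma pexp_rename: "pexp F \<Longrightarrow> pexp (\<lambda>x \<sigma>. F x (\<lambda>i. \<sigma> (f i)))"
  unfolding pexp_def by (metis eval_rename)

lemma pexp_subst:
  assumes "pexp F" "\<And>i. pexp (G i)"
  shows "pexp (\<lambda>x \<sigma>. F x (\<lambda>i. G i x \<sigma>))"
proof -
  obtain e where e: "\<And>x \<sigma>. eval e x \<sigma> = F x \<sigma>"
    using assms(1) unfolding pexp_def by blast
  obtain \<theta> where \<theta>: "\<And>i x \<sigma>. eval (\<theta> i) x \<sigma> = G i x \<sigma>"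
    using assms(2) unfolding pexp_def by metis
  show ?thesis
    by (rule pexpI[of "subst \<theta> e"]) (simp add: eval_subst e \<theta>)
qed

named_theorems pexp_intros

lemma pexp_var [pexp_intros]: "pexp (\<lambda>x \<sigma>. \<sigma> k)"
  by (rule pexpI[of "Var k"]) simp

lemma pexp_length [pexp_intros]: "pexp (\<lambda>x \<sigma>. length x)"
  by (rule pexpI[of Len]) simp

lemma pexp_add [pexp_intros]: "pexp A \<Longrightarrow> pexp B \<Longrightarrow> pexp (\<lambda>x \<sigma>. A x \<sigma> + B x \<sigma>)"
  unfolding pexp_def by (metis eval.simps(5))

lemma pexp_diff [pexp_intros]: "pexp A \<Longrightarrow> pexp B \<Longrightarrow> pexp (\<lambda>x \<sigma>. A x \<sigma> - B x \<sigma>)"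
  unfolding pexp_def by (metis eval.simps(6))

lemma pexp_const [pexp_intros]: "pexp (\<lambda>x \<sigma>. c)"
proof (induction c)
  case 0
  show ?case
    by (rule pexpI[of "Minus One One"]) simp
next
  case (Suc c)
  moreover have "pexp (\<lambda>x \<sigma>. 1)"
    by (rule pexpI[of One]) simp
  ultimately have "pexp (\<lambda>x \<sigma>. c + 1)"
    by (rule pexp_add)
  then show ?case
    by simp
qed

lemma pexp_Suc [pexp_intros]: "pexp A \<Longrightarrow> pexp (\<lambda>x \<sigma>. Suc (A x \<sigma>))"
  using pexp_add[OF _ pexp_const[of 1]] by simp

lemma pexp_of_bool [pexp_intros]: "ppred P \<Longrightarrow> pexp (\<lambda>x \<sigma>. of_bool (P x \<sigma>))"
  by (simp add: ppred_def)

text \<open>\<open>B\<close> takes the outer environment and the bound variable separately; within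
  the premise these are the shifted environment and index 0.\<close>

lemma pexp_sum [pexp_intros]:
  assumes "pexp A" "pexp (\<lambda>x \<sigma>. B x (\<lambda>i. \<sigma> (Suc i)) (\<sigma> 0))"
  shows "pexp (\<lambda>x \<sigma>. \<Sum>i<A x \<sigma>. B x \<sigma> i)"
proof -
  obtain a where a: "\<And>x \<sigma>. eval a x \<sigma> = A x \<sigma>"
    using assms(1) unfolding pexp_def by blast
  obtain b where b: "\<And>x \<sigma>. eval b x \<sigma> = B x (\<lambda>i. \<sigma> (Suc i)) (\<sigma> 0)"
    using assms(2) unfolding pexp_def by blast
  show ?thesis
    by (rule pexpI[of "Sum a b"]) (simp add: a b)
qed

lemma pexp_mult [pexp_intros]: "pexp A \<Longrightarrow> pexp B \<Longrightarrow> pexp (\<lambda>x \<sigma>. A x \<sigma> * B x \<sigma>)"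
  using pexp_sum[of A "\<lambda>x \<sigma> i. B x \<sigma>"] pexp_rename[of B Suc] by simp

lemma ppred_bit [pexp_intros]: "pexp A \<Longrightarrow> ppred (\<lambda>x \<sigma>. bit_at x (A x \<sigma>))"
  unfolding ppred_def pexp_def by (metis eval.simps(4))

lemma ppred_pos: 
  assumes "pexp A"
  shows "ppred (\<lambda>x \<sigma>. 0 < A x \<sigma>)"
proof -
  have "pexp (\<lambda>x \<sigma>. 1 - (1 - A x \<sigma>))"
    by (intro pexp_intros assms)
  then show ?thesis
    unfolding ppred_def by (rule pexp_cong) auto
qed

lemma ppred_less [pexp_intros]: "pexp A \<Longrightarrow> pexp B \<Longrightarrow> ppred (\<lambda>x \<sigma>. A x \<sigma> < B x \<sigma>)"
  using ppred_pos[OF pexp_diff[of B A]] by simp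

lemma ppred_not [pexp_intros]:
  assumes "ppred P"
  shows "ppred (\<lambda>x \<sigma>. \<not> P x \<sigma>)"
proof -
  have "pexp (\<lambda>x \<sigma>. 1 - of_bool (P x \<sigma>))"
    by (intro pexp_intros assms)
  then show ?thesis
    unfolding ppred_def by (rule pexp_cong) auto
qed

lemma ppred_conj [pexp_intros]:
  assumes "ppred P" "ppred Q"
  shows "ppred (\<lambda>x \<sigma>. P x \<sigma> \<and> Q x \<sigma>)"
proof -
  have "pexp (\<lambda>x \<sigma>. of_bool (P x \<sigma>) * of_bool (Q x \<sigma>))"
    by (intro pexp_intros assms)
  then show ?thesis
    unfolding ppred_def by (rule pexp_cong) auto
qed

lemma ppred_disj [pexp_intros]:
  assumes "ppred P" "ppred Q"
  shows "ppred (\<lambda>x \<sigma>. P x \<sigma> \<or> Q x \<sigma>)"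
proof -
  have "ppred (\<lambda>x \<sigma>. \<not> (\<not> P x \<sigma> \<and> \<not> Q x \<sigma>))"
    by (intro pexp_intros assms)
  then show ?thesis
    by (rule ppred_cong) auto
qed

lemma ppred_imp [pexp_intros]:
  assumes "ppred P" "ppred Q"
  shows "ppred (\<lambda>x \<sigma>. P x \<sigma> \<longrightarrow> Q x \<sigma>)"
proof -
  have "ppred (\<lambda>x \<sigma>. \<not> P x \<sigma> \<or> Q x \<sigma>)"
    by (intro pexp_intros assms)
  then show ?thesis
    by (rule ppred_cong) auto
qed

lemma ppred_iff [pexp_intros]:
  assumes "ppred P" "ppred Q"
  shows "ppred (\<lambda>x \<sigma>. P x \<sigma> \<longleftrightarrow> Q x \<sigma>)"
proof -
  have "ppred (\<lambda>x \<sigma>. (P x \<sigma> \<longrightarrow> Q x \<sigma>) \<and> (Q x \<sigma> \<longrightarrow> P x \<sigma>))"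
    by (intro pexp_intros assms)
  then show ?thesis
    by (rule ppred_cong) auto
qed

lemma ppred_le [pexp_intros]:
  assumes "pexp A" "pexp B"
  shows "ppred (\<lambda>x \<sigma>. A x \<sigma> \<le> B x \<sigma>)"
proof -
  have "ppred (\<lambda>x \<sigma>. \<not> B x \<sigma> < A x \<sigma>)"
    by (intro pexp_intros assms)
  then show ?thesis
    by (rule ppred_cong) auto
qed

lemma ppred_eq [pexp_intros]:
  assumes "pexp A" "pexp B"
  shows "ppred (\<lambda>x \<sigma>. A x \<sigma> = B x \<sigma>)"
proof -
  have "ppred (\<lambda>x \<sigma>. A x \<sigma> \<le> B x \<sigma> \<and> B x \<sigma> \<le> A x \<sigma>)"
    by (intro pexp_intros assms)
  then show ?thesis
    by (rule ppred_cong) auto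
qed

lemma ppred_const [pexp_intros]: "ppred (\<lambda>x \<sigma>. c)"
  unfolding ppred_def by (rule pexp_const)

lemma ppred_ex [pexp_intros]:
  assumes "pexp A" "ppred (\<lambda>x \<sigma>. P x (\<lambda>i. \<sigma> (Suc i)) (\<sigma> 0))"
  shows "ppred (\<lambda>x \<sigma>. \<exists>i<A x \<sigma>. P x \<sigma> i)"
proof -
  have "pexp (\<lambda>x \<sigma>. \<Sum>i<A x \<sigma>. of_bool (P x \<sigma> i))"
    by (intro pexp_intros assms)
  then have "ppred (\<lambda>x \<sigma>. 0 < (\<Sum>i<A x \<sigma>. of_bool (P x \<sigma> i) :: nat))"
    by (rule ppred_pos)
  then show ?thesis
    by (rule ppred_cong) (auto simp: neq0_conv[symmetric] simp del: neq0_conv)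
qed

lemma ppred_all [pexp_intros]:
  assumes "pexp A" "ppred (\<lambda>x \<sigma>. P x (\<lambda>i. \<sigma> (Suc i)) (\<sigma> 0))"
  shows "ppred (\<lambda>x \<sigma>. \<forall>i<A x \<sigma>. P x \<sigma> i)"
  using ppred_not[OF ppred_ex[OF assms(1) ppred_not[OF assms(2)]]] by (rule ppred_cong) auto

lemma pexp_if [pexp_intros]:
  assumes "ppred P" "pexp A" "pexp B"
  shows "pexp (\<lambda>x \<sigma>. if P x \<sigma> then A x \<sigma> else B x \<sigma>)"
proof -
  have "pexp (\<lambda>x \<sigma>. of_bool (P x \<sigma>) * A x \<sigma> + of_bool (\<not> P x \<sigma>) * B x \<sigma>)"
    by (intro pexp_intros assms)
  then show ?thesis
    by (rule pexp_cong) auto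
qed

lemma ppred_if [pexp_intros]:
  assumes "ppred P" "ppred A" "ppred B"
  shows "ppred (\<lambda>x \<sigma>. if P x \<sigma> then A x \<sigma> else B x \<sigma>)"
proof -
  have "ppred (\<lambda>x \<sigma>. (P x \<sigma> \<longrightarrow> A x \<sigma>) \<and> (\<not> P x \<sigma> \<longrightarrow> B x \<sigma>))"
    by (intro pexp_intros assms)
  then show ?thesis
    by (rule ppred_cong) auto
qed

text \<open>For \<open>b > 0\<close> the condition says \<open>i < a div b\<close>, so the sum
  counts the quotient; the guard yields the convention \<open>a div 0 = 0\<close>. Being a bounded
  sum, it makes division definable.\<close>

lemma div_eq_card: "(a :: nat) div b = (\<Sum>i<a. of_bool (0 < b \<and> Suc i * b \<le> a))"
proof (cases "b = 0")
  case False
  have "{..<a} \<inter> {i. 0 < b \<and> Suc i * b \<le> a} = {..<a div b}"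
  proof -
    have "Suc i * b \<le> a \<longleftrightarrow> i < a div b" for i
      using False by (simp add: less_eq_div_iff_mult_less_eq flip: Suc_le_eq)
    moreover have "a div b \<le> a"
      by simp
    ultimately show ?thesis
      using False by (auto intro: less_le_trans)
  qed
  then show ?thesis
    by (simp flip: of_bool_def)
qed simp

lemma pexp_div [pexp_intros]: 
  assumes "pexp A" "pexp B"
  shows "pexp (\<lambda>x \<sigma>. A x \<sigma> div B x \<sigma>)"
  unfolding div_eq_card by (intro pexp_intros assms assms[THEN pexp_rename])

lemma pexp_mod [pexp_intros]: "pexp A \<Longrightarrow> pexp B \<Longrightarrow> pexp (\<lambda>x \<sigma>. A x \<sigma> mod B x \<sigma>)"
  unfolding minus_mult_div_eq_mod[symmetric] by (intro pexp_intros)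

lemma ppred_dvd [pexp_intros]: "pexp A \<Longrightarrow> pexp B \<Longrightarrow> ppred (\<lambda>x \<sigma>. A x \<sigma> dvd B x \<sigma>)"
  unfolding dvd_eq_mod_eq_0 by (intro pexp_intros)

lemma pexp_power [pexp_intros]: "pexp A \<Longrightarrow> pexp (\<lambda>x \<sigma>. A x \<sigma> ^ k)"
  by (induction k) (simp_all add: pexp_const pexp_mult)

lemma pexp_poly [pexp_intros]: "pexp A \<Longrightarrow> pexp (\<lambda>x \<sigma>. poly p (A x \<sigma>))"
  by (induction p) (simp_all add: pexp_const pexp_mult pexp_add)

lemma pexp_sum_const: "(\<And>a. pexp (F a)) \<Longrightarrow> pexp (\<lambda>x \<sigma>. \<Sum>a<(c :: nat). F a x \<sigma>)"
  by (induction c) (simp_all add: pexp_const pexp_add)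

text \<open>On a fixed finite range every function is a finite sum of cases. This is how the
  transition table of an arbitrary machine gets into an expression.\<close>

lemma pexp_table:
  assumes "pexp A"
  shows "pexp (\<lambda>x \<sigma>. if A x \<sigma> < c then f (A x \<sigma>) else 0)"
proof -
  have "pexp (\<lambda>x \<sigma>. \<Sum>a<c. of_bool (A x \<sigma> = a) * f a)"
    by (intro pexp_sum_const pexp_intros assms)
  then show ?thesis
    by (rule pexp_cong) (auto simp: of_bool_def if_distrib[of "\<lambda>t. t * _"] cong: if_cong)
qed

lemma pexp_table2:
  assumes "pexp A" "pexp B"
  shows "pexp (\<lambda>x \<sigma>. if A x \<sigma> < c \<and> B x \<sigma> < d then f (A x \<sigma>) (B x \<sigma>) else 0)"
proof -
  have "pexp (\<lambda>x \<sigma>. \<Sum>a<c. of_bool (A x \<sigma> = a) * (if B x \<sigma> < d then f a (B x \<sigma>) else 0))"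
    by (intro pexp_sum_const pexp_intros pexp_table assms)
  then show ?thesis
    by (rule pexp_cong) (auto simp: of_bool_def if_distrib[of "\<lambda>t. t * _"] cong: if_cong)
qed

lemma pexp_app1: "pexp (\<lambda>x \<sigma>. f x (\<sigma> 0)) \<Longrightarrow> pexp A \<Longrightarrow> pexp (\<lambda>x \<sigma>. f x (A x \<sigma>))"
  by (drule pexp_subst[where G = "\<lambda>i. A"]) auto

lemma pexp_app2:
  assumes "pexp (\<lambda>x \<sigma>. f x (\<sigma> 0) (\<sigma> 1))" "pexp A" "pexp B"
  shows "pexp (\<lambda>x \<sigma>. f x (A x \<sigma>) (B x \<sigma>))"
  using pexp_subst[OF assms(1), of "\<lambda>i. if i = 0 then A else B"] assms(2,3) by simp

lemma pexp_app3:
  assumes "pexp (\<lambda>x \<sigma>. f x (\<sigma> 0) (\<sigma> 1) (\<sigma> 2))" "pexp A" "pexp B" "pexp C"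
  shows "pexp (\<lambda>x \<sigma>. f x (A x \<sigma>) (B x \<sigma>) (C x \<sigma>))"
  using pexp_subst[OF assms(1), of "\<lambda>i. if i = 0 then A else if i = 1 then B else C"] assms(2-4) by simp

lemma ppred_app1: "ppred (\<lambda>x \<sigma>. f x (\<sigma> 0)) \<Longrightarrow> pexp A \<Longrightarrow> ppred (\<lambda>x \<sigma>. f x (A x \<sigma>))"
  unfolding ppred_def by (rule pexp_app1)

lemma ppred_app2:
  "ppred (\<lambda>x \<sigma>. f x (\<sigma> 0) (\<sigma> 1)) \<Longrightarrow> pexp A \<Longrightarrow> pexp B \<Longrightarrow> ppred (\<lambda>x \<sigma>. f x (A x \<sigma>) (B x \<sigma>))"
  unfolding ppred_def by (rule pexp_app2)

lemma ppred_app3: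
  "ppred (\<lambda>x \<sigma>. f x (\<sigma> 0) (\<sigma> 1) (\<sigma> 2)) \<Longrightarrow> pexp A \<Longrightarrow> pexp B \<Longrightarrow> pexp C \<Longrightarrow>
    ppred (\<lambda>x \<sigma>. f x (A x \<sigma>) (B x \<sigma>) (C x \<sigma>))"
  unfolding ppred_def by (rule pexp_app3)

theorem polytime_pexp:
  assumes "pexp (\<lambda>x \<sigma>. L x)" "ppred (\<lambda>x \<sigma>. B x (\<sigma> 0))"
  shows "polytime (\<lambda>x. map (B x) [0..<L x])"
proof -
  obtain l where l: "\<And>x \<sigma>. eval l x \<sigma> = L x"
    using assms(1) unfolding pexp_def by blast
  obtain b where b: "\<And>x \<sigma>. eval b x \<sigma> = of_bool (B x (\<sigma> 0))"
    using assms(2) unfolding pexp_def ppred_def by blast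
  show ?thesis
    using polytime_map_eval[of b l] by (simp add: l b)
qed

section \<open>Binary representations as expressions\<close>

lemma nat_bits_0 [simp]: "nat_bits 0 = []"
  by (simp add: nat_bits.simps)

lemma nat_bits_pos: "k > 0 \<Longrightarrow> nat_bits k = odd k # nat_bits (k div 2)"
  by (simp add: nat_bits.simps)

lemma nat_bits_1 [simp]: "nat_bits (Suc 0) = [True]"
  by (simp add: nat_bits_pos[of "Suc 0"])

lemma length_nat_bits_le: "length (nat_bits k) \<le> l \<longleftrightarrow> k < 2 ^ l"
proof (induction k arbitrary: l rule: less_induct)
  case (less k)
  show ?case
  proof (cases "k = 0")
    case False
    show ?thesis
    proof (cases l)
      case 0
      then show ?thesis
        using False by (simp add: nat_bits_pos[of k])
    next
      case (Suc m)
      have "length (nat_bits (k div 2)) \<le> m \<longleftrightarrow> k div 2 < 2 ^ m"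
        by (rule less) (use False in simp)
      also have "\<dots> \<longleftrightarrow> k < 2 ^ l"
        by (simp add: Suc div_less_iff_less_mult mult.commute)
      finally show ?thesis
        using False by (simp add: nat_bits_pos[of k] Suc del: power_Suc)
    qed
  qed simp
qed

lemma nth_nat_bits: "l < length (nat_bits k) \<Longrightarrow> nat_bits k ! l \<longleftrightarrow> odd (k div 2 ^ l)"
proof (induction l arbitrary: k)
  case 0
  then show ?case
    by (cases "k = 0") (auto simp: nat_bits_pos[of k])
next
  case (Suc l)
  then show ?case
    by (cases "k = 0") (auto simp: nat_bits_pos[of k] div_mult2_eq)
qed

text \<open>The least significant bit comes first, so the leading bit, which is never zero, is the
  last one of the word.\<close>

lemma nat_bits_canonical: "ys = [] \<or> last ys \<Longrightarrow> \<exists>k. nat_bits k = ys"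
proof (induction ys)
  case Nil
  show ?case
    using nat_bits_0 by blast
next
  case (Cons y ys)
  then obtain k where k: "nat_bits k = ys"
    by (auto split: if_splits)
  have "nat_bits (2 * k + of_bool y) = y # ys"
    using k Cons.prems by (cases "k = 0"; cases y) (auto simp: nat_bits_pos[of "Suc (2 * k)"] nat_bits_pos[of "2 * k"])
  then show ?case
    by blast
qed

lemma last_nat_bits: "nat_bits k = [] \<or> last (nat_bits k)"
proof (induction k rule: less_induct)
  case (less k)
  then show ?case
  proof (cases "k div 2 = 0")
    case True
    then have "k = 0 \<or> k = 1"
      by auto
    then show ?thesis
      by (auto simp:)
  next
    case False
    then have "k div 2 > 0" "k > 0" "k div 2 < k"
      by auto
    moreover have "nat_bits (k div 2) \<noteq> []"
      using \<open>k div 2 > 0\<close> by (simp only: nat_bits_pos) simp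
    ultimately show ?thesis
      using less[of "k div 2"] by (simp add: nat_bits_pos[of k])
  qed
qed

text \<open>A power of two has no odd divisor except 1. This needs bounded quantifiers only, whereas
  \<open>2 ^ l\<close> is not definable: values of expressions are polynomially bounded.\<close>

definition ispow :: "nat \<Rightarrow> bool" where
  "ispow p \<longleftrightarrow> 0 < p \<and> (\<forall>d<Suc p. d dvd p \<longrightarrow> d = 1 \<or> even d)"

lemma ispow_iff: "ispow p \<longleftrightarrow> (\<exists>l. p = 2 ^ l)"
proof
  assume p: "ispow p"
  have "p > 0" "\<And>d. d dvd p \<Longrightarrow> d = 1 \<or> even d"
    using p dvd_imp_le[of _ p] unfolding ispow_def by (auto simp: less_Suc_eq_le)
  then show "\<exists>l. p = 2 ^ l"
  proof (induction p rule: less_induct)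
    case (less p)
    show ?case
    proof (cases "p = 1")
      case True
      then show ?thesis
        by (intro exI[of _ 0]) simp
    next
      case False
      then have "even p"
        using less.prems(2)[of p] by simp
      then obtain q where q: "p = 2 * q"
        by blast
      have "d = 1 \<or> even d" if "d dvd q" for d
        using less.prems(2)[of d] that q by simp
      then obtain l where "q = 2 ^ l"
        using less.IH[of q] q less.prems(1) by auto
      then show ?thesis
        using q by (intro exI[of _ "Suc l"]) simp
    qed
  qed
next
  assume "\<exists>l. p = 2 ^ l"
  then obtain l where l: "p = 2 ^ l"
    by blast
  have "d = 1 \<or> even d" if "d dvd p" for d
    using that unfolding l divides_primepow_nat[OF two_is_prime_nat] by auto
  then show "ispow p"
    by (auto simp: ispow_def l)
qed

text \<open>\<open>2 ^ l < m\<close> holds exactly for the \<open>l\<close> below the bit length of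
  \<open>m - 1\<close>. So the bit length of \<open>k\<close> is the number of powers of two up to
  \<open>k\<close>.\<close>

lemma sum_ispow: "(\<Sum>p<m. of_bool (ispow p)) = length (nat_bits (m - 1))"
proof -
  have "{..<m} \<inter> Collect ispow = (\<lambda>l. 2 ^ l) ` {..<length (nat_bits (m - 1))}"
  proof -
    have "2 ^ l < m \<longleftrightarrow> l < length (nat_bits (m - 1))" for l
    proof -
      have "2 ^ l < m \<longleftrightarrow> \<not> m - 1 < 2 ^ l"
        by (cases m) (auto simp: less_Suc_eq_le not_less)
      also have "\<dots> \<longleftrightarrow> l < length (nat_bits (m - 1))"
        by (simp only: length_nat_bits_le[symmetric] not_le)
      finally show ?thesis .
    qed
    then show ?thesis
      unfolding ispow_iff set_eq_iff by blast
  qed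
  then have "card ({..<m} \<inter> Collect ispow) = length (nat_bits (m - 1))"
    by (simp add: card_image inj_on_def)
  then show ?thesis
    by (simp flip: of_bool_def)
qed

lemma ppred_ispow [pexp_intros]: "pexp A \<Longrightarrow> ppred (\<lambda>x \<sigma>. ispow (A x \<sigma>))"
  by (rule ppred_app1[of "\<lambda>_. ispow"]) (unfold ispow_def, intro pexp_intros)

lemma pexp_length_nat_bits [pexp_intros]:
  assumes "pexp A"
  shows "pexp (\<lambda>x \<sigma>. length (nat_bits (A x \<sigma>)))"
proof -
  have "pexp (\<lambda>x \<sigma>. \<Sum>p<Suc (A x \<sigma>). of_bool (ispow p))"
    by (intro pexp_intros assms)
  then show ?thesis
    by (simp only: sum_ispow) simp
qed

definition nat_bit :: "nat \<Rightarrow> nat \<Rightarrow> bool" where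
  "nat_bit k l \<longleftrightarrow> l < length (nat_bits k) \<and> nat_bits k ! l"

text \<open>Bit \<open>l\<close> is the parity of \<open>k div 2 ^ l\<close>. The power is found by
  search: it is the power of two that is preceded by exactly \<open>l\<close> smaller ones.\<close>

lemma nat_bit_eq:
  "nat_bit k l \<longleftrightarrow> (\<exists>p<Suc k. ispow p \<and> (\<Sum>q<p. of_bool (ispow q)) = l \<and> odd (k div p))"
proof -
  have log: "(\<Sum>q<2 ^ i. of_bool (ispow q)) = i" for i
  proof -
    have "length (nat_bits (2 ^ i - 1)) \<le> l \<longleftrightarrow> i \<le> l" for l
    proof -
      have "(2 :: nat) ^ i - 1 < 2 ^ l \<longleftrightarrow> (2 :: nat) ^ i \<le> 2 ^ l"
        using zero_less_power[of "2 :: nat" i] by linarith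
      also have "\<dots> \<longleftrightarrow> i \<le> l"
        by simp
      finally show ?thesis
        unfolding length_nat_bits_le .
    qed
    then show ?thesis
      unfolding sum_ispow using le_antisym by blast
  qed
  have pow: "ispow (2 ^ i)" for i
    unfolding ispow_iff by blast
  have "l < length (nat_bits k) \<longleftrightarrow> 2 ^ l < Suc k"
    using length_nat_bits_le[of k l] by auto
  then have "nat_bit k l \<longleftrightarrow> 2 ^ l < Suc k \<and> odd (k div 2 ^ l)"
    unfolding nat_bit_def using nth_nat_bits[of l k] by blast
  also have "\<dots> \<longleftrightarrow> (\<exists>p<Suc k. ispow p \<and> (\<Sum>q<p. of_bool (ispow q)) = l \<and> odd (k div p))"
    using pow log unfolding ispow_iff[of "p" for p] by metis
  finally show ?thesis .
qed

lemma ppred_nat_bit [pexp_intros]: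
  "pexp A \<Longrightarrow> pexp B \<Longrightarrow> ppred (\<lambda>x \<sigma>. nat_bit (A x \<sigma>) (B x \<sigma>))"
  by (rule ppred_app2[of "\<lambda>_. nat_bit"]) (unfold nat_bit_eq, intro pexp_intros)

section \<open>From satisfiability to connected odd cycle transversals\<close>

lemma connected_oct_iff:
  assumes "simple_graph G"
  shows "connected_oct G S \<longleftrightarrow> S \<subseteq> verts G \<and>
    (\<exists>col :: 'a \<Rightarrow> bool. \<forall>u\<in>verts G - S. \<forall>v\<in>verts G - S. {u, v} \<in> edges G \<longrightarrow> col u \<noteq> col v) \<and>
    (\<forall>u\<in>S. \<forall>v\<in>S. (u, v) \<in> {(x, y). x \<in> S \<and> y \<in> S \<and> {x, y} \<in> edges G}\<^sup>*)"
proof (cases "S \<subseteq> verts G")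
  case True
  have "bipartite (delete_verts G S) \<longleftrightarrow>
    (\<exists>col :: 'a \<Rightarrow> bool. \<forall>u\<in>verts G - S. \<forall>v\<in>verts G - S. {u, v} \<in> edges G \<longrightarrow> col u \<noteq> col v)"
  proof
    assume "bipartite (delete_verts G S)"
    then obtain A B where AB: "A \<inter> B = {}" "\<And>e. e \<in> edges G \<Longrightarrow> e \<subseteq> verts G - S \<Longrightarrow> \<exists>a\<in>A. \<exists>b\<in>B. e = {a, b}"
      unfolding bipartite_def delete_verts_def induced_def by auto
    have "(u \<in> A) \<noteq> (v \<in> A)" if uv: "u \<in> verts G - S" "v \<in> verts G - S" "{u, v} \<in> edges G" for u v
    proof -
      have "{u, v} \<subseteq> verts G - S"
        using uv by simp
      then obtain a b where "a \<in> A" "b \<in> B" "{u, v} = {a, b}"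
        using AB(2)[OF uv(3)] by blast
      then show ?thesis
        using AB(1) by (auto simp: doubleton_eq_iff)
    qed
    then show "\<exists>col :: 'a \<Rightarrow> bool. \<forall>u\<in>verts G - S. \<forall>v\<in>verts G - S. {u, v} \<in> edges G \<longrightarrow> col u \<noteq> col v"
      by (intro exI[of _ "\<lambda>u. u \<in> A"]) blast
  next
    assume "\<exists>col :: 'a \<Rightarrow> bool. \<forall>u\<in>verts G - S. \<forall>v\<in>verts G - S. {u, v} \<in> edges G \<longrightarrow> col u \<noteq> col v"
    then obtain col :: "'a \<Rightarrow> bool" where
      col: "\<And>u v. u \<in> verts G - S \<Longrightarrow> v \<in> verts G - S \<Longrightarrow> {u, v} \<in> edges G \<Longrightarrow> col u \<noteq> col v"
      by blast
    have "\<exists>a\<in>{u \<in> verts G - S. col u}. \<exists>b\<in>{u \<in> verts G - S. \<not> col u}. e = {a, b}"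
      if e: "e \<in> edges G" "e \<subseteq> verts G - S" for e
    proof -
      obtain u v where uv: "e = {u, v}"
        using assms e(1) unfolding simple_graph_def by (meson card_2_iff)
      have "col u \<noteq> col v"
        using col[of u v] e uv by simp
      then show ?thesis
        using e uv by (cases "col u") (auto simp: insert_commute)
    qed
    then show "bipartite (delete_verts G S)"
      unfolding bipartite_def delete_verts_def induced_def
      by (intro exI[of _ "{u \<in> verts G - S. col u}"] exI[of _ "{u \<in> verts G - S. \<not> col u}"]) auto
  qed
  moreover have "{(x, y). {x, y} \<in> edges (induced G S)} = {(x, y). x \<in> S \<and> y \<in> S \<and> {x, y} \<in> edges G}"
    by (auto simp: induced_def)
  moreover have "verts (induced G S) = S"
    using True by (auto simp: induced_def)
  ultimately show ?thesis
    using True unfolding connected_oct_def odd_cycle_transversal_def connected_graph_def by simp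
qed (simp add: connected_oct_def odd_cycle_transversal_def)

text \<open>The intersection graph of an indexed family. For distinct two-element sets it is a line
  graph whose root edges are named freely, be it by gadget edges or by numbers.\<close>

definition meet_graph :: "'e set \<Rightarrow> ('e \<Rightarrow> 'v set) \<Rightarrow> 'e sgraph" where
  "meet_graph V ends = \<lparr>verts = V,
     edges = {{e, f} | e f. e \<in> V \<and> f \<in> V \<and> e \<noteq> f \<and> ends e \<inter> ends f \<noteq> {}}\<rparr>"

lemma verts_meet_graph [simp]: "verts (meet_graph V ends) = V"
  by (simp add: meet_graph_def)

lemma edges_meet_graph [simp]:
  "{e, f} \<in> edges (meet_graph V ends) \<longleftrightarrow> e \<in> V \<and> f \<in> V \<and> e \<noteq> f \<and> ends e \<inter> ends f \<noteq> {}"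
  by (auto simp: meet_graph_def doubleton_eq_iff)

lemma simple_meet_graph: "finite V \<Longrightarrow> simple_graph (meet_graph V ends)"
  by (auto simp: simple_graph_def meet_graph_def)

text \<open>One direction suffices for an equivalence, as it also applies to the inverse of
  \<open>\<phi>\<close>.\<close>

lemma connected_oct_meet_graph_bij:
  assumes "finite V" and \<phi>: "bij_betw \<phi> V V'"
    and oct: "connected_oct (meet_graph V (\<lambda>e. ends (\<phi> e))) S"
  shows "\<exists>S'. connected_oct (meet_graph V' ends) S' \<and> card S' = card S"
proof -
  have fin: "finite V'"
    using assms by (metis bij_betw_finite)
  have inj: "inj_on \<phi> V" and im: "\<phi> ` V = V'"
    using \<phi> by (auto simp: bij_betw_def)
  define \<psi> where "\<psi> = inv_into V \<phi>"
  have \<psi>: "\<psi> y \<in> V" "\<phi> (\<psi> y) = y" if "y \<in> V'" for y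
    using that im by (auto simp: \<psi>_def inv_into_into f_inv_into_f)
  note oct = oct[unfolded connected_oct_iff[OF simple_meet_graph[OF assms(1)]] verts_meet_graph edges_meet_graph]
  note S = conjunct1[OF oct]
  obtain col :: "_ \<Rightarrow> bool" where col: "\<forall>u\<in>V - S. \<forall>v\<in>V - S.
      u \<in> V \<and> v \<in> V \<and> u \<noteq> v \<and> ends (\<phi> u) \<inter> ends (\<phi> v) \<noteq> {} \<longrightarrow> col u \<noteq> col v"
    using conjunct1[OF conjunct2[OF oct]] by (rule exE)
  let ?R = "{(x, y). x \<in> S \<and> y \<in> S \<and> x \<in> V \<and> y \<in> V \<and> x \<noteq> y \<and> ends (\<phi> x) \<inter> ends (\<phi> y) \<noteq> {}}"
  let ?R' = "{(x, y). x \<in> \<phi> ` S \<and> y \<in> \<phi> ` S \<and> x \<in> V' \<and> y \<in> V' \<and> x \<noteq> y \<and> ends x \<inter> ends y \<noteq> {}}"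
  have "(u, v) \<in> ?R\<^sup>* \<Longrightarrow> (\<phi> u, \<phi> v) \<in> ?R'\<^sup>*" for u v
  proof (induction rule: rtrancl_induct)
    case (step y z)
    then have "(\<phi> y, \<phi> z) \<in> ?R'"
      using inj im by (auto simp: inj_on_def)
    then show ?case
      using step.IH by (rule rtrancl_into_rtrancl[rotated])
  qed simp
  then have conn: "\<forall>u\<in>\<phi> ` S. \<forall>v\<in>\<phi> ` S. (u, v) \<in> ?R'\<^sup>*"
    using conjunct2[OF conjunct2[OF oct]] by blast
  have out: "\<psi> y \<in> V - S" if "y \<in> V' - \<phi> ` S" for y
    using that \<psi>[of y] by force
  have col': "\<forall>u\<in>V' - \<phi> ` S. \<forall>v\<in>V' - \<phi> ` S. u \<in> V' \<and> v \<in> V' \<and> u \<noteq> v \<and> ends u \<inter> ends v \<noteq> {} \<longrightarrow>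
      col (\<psi> u) \<noteq> col (\<psi> v)"
  proof (intro ballI impI)
    fix u v
    assume uv: "u \<in> V' - \<phi> ` S" "v \<in> V' - \<phi> ` S" "u \<in> V' \<and> v \<in> V' \<and> u \<noteq> v \<and> ends u \<inter> ends v \<noteq> {}"
    have "\<phi> (\<psi> u) = u" "\<phi> (\<psi> v) = v"
      using \<psi> uv by blast+
    moreover from this have "\<psi> u \<noteq> \<psi> v"
      using uv(3) by metis
    ultimately show "col (\<psi> u) \<noteq> col (\<psi> v)"
      using col[rule_format, OF out[OF uv(1)] out[OF uv(2)]] out[OF uv(1)] out[OF uv(2)] uv(3) by auto
  qed
  have "\<phi> ` S \<subseteq> V'"
    using S im by blast
  then have "connected_oct (meet_graph V' ends) (\<phi> ` S)"
    unfolding connected_oct_iff[OF simple_meet_graph[OF fin]] verts_meet_graph edges_meet_graph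
    by (intro conjI exI[of _ "\<lambda>y. col (\<psi> y)"] col' conn)
  then show ?thesis
    using card_image[of \<phi> S] inj_on_subset[OF inj S] by blast
qed

lemma is_line_graph_meet_graph:
  assumes "finite V" "\<And>e. e \<in> V \<Longrightarrow> card (ends e) = 2" "inj_on ends V"
  shows "is_line_graph (meet_graph V ends)"
proof -
  have fin: "finite (\<Union> (ends ` V))"
    using assms(1,2) by (auto intro: card_ge_0_finite)
  \<comment> \<open>Roots must have numbers as vertices, so the ends are transported along an
    injection into the numbers.\<close>
  obtain g :: "_ \<Rightarrow> nat" where g: "inj_on g (\<Union> (ends ` V))"
    using finite_imp_inj_to_nat_seg[OF fin] by metis
  define h where "h e = g ` ends e" for e
  define H where "H = \<lparr>verts = g ` \<Union> (ends ` V), edges = h ` V\<rparr>"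
  have "card (h e) = 2 \<and> h e \<subseteq> g ` \<Union> (ends ` V)" if e: "e \<in> V" for e
  proof -
    have "ends e \<subseteq> \<Union> (ends ` V)"
      using e by blast
    then show ?thesis
      using assms(2)[OF e] card_image[OF inj_on_subset[OF g]] unfolding h_def by (metis image_mono)
  qed
  then have "simple_graph H"
    using fin unfolding simple_graph_def H_def by auto
  have inj: "inj_on h V"
  proof (rule inj_onI)
    fix e f
    assume ef: "e \<in> V" "f \<in> V" "h e = h f"
    then have "ends e = ends f"
      unfolding h_def using inj_on_image_eq_iff[OF g, of "ends e" "ends f"] by blast
    then show "e = f"
      using ef assms(3) by (auto simp: inj_on_def)
  qed
  have meet: "h e \<inter> h f \<noteq> {} \<longleftrightarrow> ends e \<inter> ends f \<noteq> {}" if "e \<in> V" "f \<in> V" for e f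
    using g that unfolding h_def inj_on_def by blast
  have "graph_iso (meet_graph V ends) (line_graph H)"
    unfolding graph_iso_def
  proof (intro exI[of _ h] conjI ballI)
    show "bij_betw h (verts (meet_graph V ends)) (verts (line_graph H))"
      using inj by (simp add: bij_betw_def line_graph_def H_def)
    fix u v
    assume "u \<in> verts (meet_graph V ends)" "v \<in> verts (meet_graph V ends)"
    then have uv: "u \<in> V" "v \<in> V"
      by simp_all
    have "{h u, h v} \<in> edges (line_graph H) \<longleftrightarrow> h u \<noteq> h v \<and> h u \<inter> h v \<noteq> {}"
      using uv by (auto simp: line_graph_def H_def doubleton_eq_iff)
    also have "\<dots> \<longleftrightarrow> u \<noteq> v \<and> ends u \<inter> ends v \<noteq> {}"
      using uv meet inj by (auto simp: inj_on_def)
    finally show "{u, v} \<in> edges (meet_graph V ends) \<longleftrightarrow> {h u, h v} \<in> edges (line_graph H)"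
      using uv by simp
  qed
  then show ?thesis
    using \<open>simple_graph H\<close> unfolding is_line_graph_def by blast
qed

section \<open>The gadget graph of a formula\<close>

datatype vert = W nat | Leaf nat | Hub nat | HLeaf nat bool

datatype edge = Cyc nat | Pend nat | Ext nat | HPend nat bool

text \<open>\<open>lit c v\<close> is 1 or 2 if the variable \<open>v\<close> occurs positively or negatively in the clause \<open>c\<close>.
  The clauses are the hubs, and \<open>J\<close> is the central hub. The cycle of a variable has four vertices
  per clause, so vertex \<open>w\<close> belongs to the variable \<open>w div L\<close> and the clause \<open>w mod L div 4\<close>.\<close>

locale cnf =
  fixes X J :: nat and lit :: "nat \<Rightarrow> nat \<Rightarrow> nat"
  assumes X: "X > 0" and J: "J > 0"
    and nonempty: "\<And>c. c < J \<Longrightarrow> \<exists>v<X. lit c v = 1 \<or> lit c v = 2"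
begin

definition L where "L = 4 * J"
definition M where "M = X * L"
definition nxt where "nxt w = w div L * L + Suc (w mod L) mod L"
text \<open>Positions 0 to 3 form the block of a clause \<open>c\<close> in the cycle of a variable.
  If the variable is true, the edges 0-1 and 2-3 belong to the transversal, otherwise 1-2 and the
  edge from 3 to the next block. A positive literal puts 1 and 2 at hub \<open>c\<close>, so the
  first choice joins \<open>c\<close> with the central hub and the second does not; a negative
  literal puts 2 and 3 there, which exchanges the roles. Position 0 is always central and separates
  the blocks.\<close>

definition pat where "pat l m \<longleftrightarrow> l = 1 \<and> (m = 1 \<or> m = 2) \<or> l = 2 \<and> (m = 2 \<or> m = (3 :: nat))"
  for l :: nat
definition hub where
  "hub w = (if pat (lit (w mod L div 4) (w div L)) (w mod 4) then w mod L div 4 else J)"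

fun ends :: "edge \<Rightarrow> vert set" where
  "ends (Cyc w) = {W w, W (nxt w)}"
| "ends (Pend w) = {W w, Leaf w}"
| "ends (Ext w) = {W w, Hub (hub w)}"
| "ends (HPend h b) = {Hub h, HLeaf h b}"

definition E where
  "E = Cyc ` {..<M} \<union> Pend ` {..<M} \<union> Ext ` {..<M} \<union> (\<lambda>(h, b). HPend h b) ` ({..J} \<times> UNIV)"

definition satisfies where
  "satisfies a c \<longleftrightarrow> (\<exists>v<X. lit c v = 1 \<and> a v \<or> lit c v = 2 \<and> \<not> a v)"

definition sol where
  "sol a = Ext ` {..<M} \<union> Cyc ` {w \<in> {..<M}. even w \<longleftrightarrow> a (w div L)}"

lemma E_simps [simp]:
  "Cyc w \<in> E \<longleftrightarrow> w < M" "Pend w \<in> E \<longleftrightarrow> w < M" "Ext w \<in> E \<longleftrightarrow> w < M" "HPend h b \<in> E \<longleftrightarrow> h \<le> J"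
  by (auto simp: E_def)

lemma sol_simps [simp]:
  "Cyc w \<in> sol a \<longleftrightarrow> w < M \<and> (even w \<longleftrightarrow> a (w div L))" "Pend w \<notin> sol a" "Ext w \<in> sol a \<longleftrightarrow> w < M"
  "HPend h b \<notin> sol a"
  by (auto simp: sol_def)

lemma finite_E: "finite E"
  by (simp add: E_def)

lemma L_pos: "L > 0" "4 dvd L" "even L"
  using J by (auto simp: L_def)

lemma less_M: "w < M \<longleftrightarrow> w div L < X"
  using L_pos(1) by (simp add: M_def div_less_iff_less_mult)

lemma split_L: "r < L \<Longrightarrow> (v * L + r) div L = v" "r < L \<Longrightarrow> (v * L + r) mod L = r"
  by simp_all

lemma nxt_div [simp]: "nxt w div L = w div L"
  using L_pos by (simp add: nxt_def)

lemma nxt_mod: "nxt w mod L = Suc (w mod L) mod L"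
  by (simp add: nxt_def)

lemma nxt_less [simp]: "nxt w < M \<longleftrightarrow> w < M"
  by (simp add: less_M)

lemma mod_L_mod_4: "w mod L mod 4 = w mod 4"
  using L_pos by (simp add: mod_mod_cancel)

lemma nxt_mod_4: "nxt w mod 4 = Suc w mod 4"
proof -
  have "nxt w mod 4 = Suc (w mod L) mod L mod 4"
    using mod_L_mod_4[of "nxt w"] by (simp add: nxt_mod)
  also have "\<dots> = Suc (w mod L mod 4) mod 4"
    using L_pos by (simp add: mod_mod_cancel mod_Suc_eq)
  finally show ?thesis
    by (simp add: mod_L_mod_4 mod_Suc_eq)
qed

lemma even_nxt [simp]: "even (nxt w) \<longleftrightarrow> odd w"
proof -
  have "even (nxt w) \<longleftrightarrow> even (nxt w mod 4)" "even (Suc w) \<longleftrightarrow> even (Suc w mod 4)"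
    by presburger+
  then show ?thesis
    by (simp add: nxt_mod_4)
qed

lemma nxt_inject [simp]: "nxt w = nxt w' \<longleftrightarrow> w = w'"
proof
  assume eq: "nxt w = nxt w'"
  then have "w div L = w' div L" "Suc (w mod L) mod L = Suc (w' mod L) mod L"
    using nxt_div nxt_mod by metis+
  moreover from this(2) have "w mod L = w' mod L"
    by (auto simp: mod_Suc split: if_splits)
  ultimately show "w = w'"
    by (metis div_mult_mod_eq)
qed simp

lemma nxt_neq [simp]: "nxt w \<noteq> w" "w \<noteq> nxt w"
  using even_nxt[of w] by metis+

lemma nxt_nxt_neq: "nxt (nxt w) \<noteq> w"
proof
  assume "nxt (nxt w) = w"
  then have "Suc (Suc w) mod 4 = w mod 4"
    by (metis nxt_mod_4 mod_Suc_eq)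
  then show False
    by presburger
qed

lemma bij_nxt: "bij_betw nxt {..<M} {..<M}"
proof -
  have "inj_on nxt {..<M}"
    by (simp add: inj_on_def)
  moreover have "nxt ` {..<M} \<subseteq> {..<M}"
    by auto
  ultimately show ?thesis
    by (simp add: bij_betw_def endo_inj_surj)
qed

lemma card_ends: "card (ends e) = 2"
  by (cases e) auto

lemma inj_ends: "inj_on ends E"
proof (rule inj_onI)
  fix e f
  assume "ends e = ends f"
  then show "e = f"
    by (cases e; cases f) (auto simp: doubleton_eq_iff dest: nxt_nxt_neq[THEN notE])
qed

lemma block_less: "w mod L div 4 < J"
proof -
  have "w mod L < 4 * J"
    using L_pos by (simp flip: L_def)
  then show ?thesis
    by linarith
qed

lemma hub_eq_iff: "c < J \<Longrightarrow> hub w = c \<longleftrightarrow> w mod L div 4 = c \<and> pat (lit c (w div L)) (w mod 4)"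
  by (auto simp: hub_def)

lemma hub_le: "hub w \<le> J"
  using block_less[of w] by (simp add: hub_def)

lemma block_nxt:
  assumes "w mod 4 \<noteq> 3"
  shows "nxt w mod L div 4 = w mod L div 4"
proof -
  have "Suc (w mod L) mod 4 \<noteq> 0"
    using assms by (simp add: mod_Suc mod_L_mod_4)
  moreover from this have "Suc (w mod L) \<noteq> L"
    using L_pos by auto
  ultimately show ?thesis
    using L_pos by (simp add: nxt_mod mod_Suc div_Suc)
qed

text \<open>If the literal is false, the chosen parity is the one for which both ends of an edge are
  in the pattern or both are outside. Only position 3 has its successor in another block, and there
  neither end is at \<open>c\<close>.\<close>

lemma hub_nxt_unsat:
  assumes c: "c < J" and w: "w < M" "even w \<longleftrightarrow> a (w div L)" and unsat: "\<not> satisfies a c"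
  shows "hub w = c \<longleftrightarrow> hub (nxt w) = c"
proof -
  let ?l = "lit c (w div L)"
  have l: "?l = 1 \<Longrightarrow> odd w" "?l = 2 \<Longrightarrow> even w"
    using unsat w by (auto simp: satisfies_def less_M)
  have m: "even w \<longleftrightarrow> even (w mod 4)" "w mod 4 < 4"
    by presburger+
  have n: "nxt w mod 4 = Suc (w mod 4) mod 4"
    by (simp add: nxt_mod_4 mod_Suc_eq)
  consider "w mod 4 = 0" | "w mod 4 = 1" | "w mod 4 = 2" | "w mod 4 = 3"
    using m(2) by linarith
  then show ?thesis
    by cases (use c l m n block_nxt[of w] in \<open>auto simp: hub_eq_iff pat_def\<close>)
qed

lemma sat_link:
  assumes c: "c < J" and sat: "satisfies a c"
  shows "\<exists>w<M. (even w \<longleftrightarrow> a (w div L)) \<and> hub w = J \<and> hub (nxt w) = c"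
proof -
  obtain v where v: "v < X" "lit c v = 1 \<and> a v \<or> lit c v = 2 \<and> \<not> a v"
    using sat by (auto simp: satisfies_def)
  \<comment> \<open>Edge 0-1 for a true variable and 1-2 for a false one: both lead from the central
    hub into \<open>c\<close>.\<close>
  define i where "i = (if a v then 0 else 1 :: nat)"
  define w where "w = v * L + (4 * c + i)"
  have "4 * c + i < L"
    using c by (simp add: L_def i_def)
  then have w1: "w div L = v" "w mod L = 4 * c + i"
    by (simp_all add: w_def)
  then have w2: "w mod L div 4 = c" "w mod 4 = i"
    using mod_L_mod_4[of w] by (simp_all add: i_def)
  have w3: "even w \<longleftrightarrow> a v"
    using w2(2) by (cases "a v") (auto simp: i_def, presburger+)
  have "nxt w mod L div 4 = c" "nxt w mod 4 = Suc i mod 4"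
    using block_nxt[of w] w2 mod_Suc_eq[of w 4] by (simp_all add: nxt_mod_4 i_def)
  then have "hub (nxt w) = c"
    using c w1 v by (auto simp: hub_eq_iff pat_def i_def)
  moreover have "hub w = J"
    using w1 w2 v by (auto simp: hub_def pat_def i_def)
  ultimately show ?thesis
    using v w1 w3 by (intro exI[of _ w]) (auto simp: less_M)
qed

section \<open>Assignments and connectedness\<close>

abbreviation G where "G \<equiv> meet_graph E ends"

abbreviation link where
  "link S \<equiv> {(x, y). x \<in> S \<and> y \<in> S \<and> {x, y} \<in> edges G}"

lemma linkI: "x \<in> S \<Longrightarrow> y \<in> S \<Longrightarrow> x \<in> E \<Longrightarrow> y \<in> E \<Longrightarrow> v \<in> ends x \<Longrightarrow> v \<in> ends y \<Longrightarrow> (x, y) \<in> (link S)\<^sup>*"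
  by (cases "x = y") (auto intro!: r_into_rtrancl)

text \<open>Every element is linked to \<open>Ext 0\<close>, whose hub is \<open>J\<close> as for
  any position 0 of a block. A clause hub gets there through the cycle edge of
  \<open>sat_link\<close>.\<close>

lemma sol_connected:
  assumes sat: "\<And>c. c < J \<Longrightarrow> satisfies a c" and u: "u \<in> sol a" and v: "v \<in> sol a"
  shows "(u, v) \<in> (link (sol a))\<^sup>*"
proof -
  have sym: "((x, y) \<in> (link (sol a))\<^sup>*) = ((y, x) \<in> (link (sol a))\<^sup>*)" for x y
  proof -
    have "sym (link (sol a))"
      by (auto simp: sym_def insert_commute)
    then show ?thesis
      by (meson sym_rtrancl symD)
  qed
  have M: "0 < M" "hub 0 = J"
    using X L_pos by (auto simp: M_def hub_def pat_def)
  have root: "(Ext w, Ext 0) \<in> (link (sol a))\<^sup>*" if "w < M" "hub w = J" for w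
    using that M by (intro linkI[of _ _ _ "Hub J"]) auto
  have ext: "(Ext w, Ext 0) \<in> (link (sol a))\<^sup>*" if w: "w < M" for w
  proof (cases "hub w = J")
    case False
    then have c: "hub w < J"
      using hub_le[of w] by simp
    obtain z where z: "z < M" "even z \<longleftrightarrow> a (z div L)" "hub z = J" "hub (nxt z) = hub w"
      using sat_link[OF c sat[OF c]] by blast
    have "(Ext w, Ext (nxt z)) \<in> (link (sol a))\<^sup>*"
      using w z by (intro linkI[of _ _ _ "Hub (hub w)"]) auto
    also have "(Ext (nxt z), Cyc z) \<in> (link (sol a))\<^sup>*"
      using w z by (intro linkI[of _ _ _ "W (nxt z)"]) auto
    also have "(Cyc z, Ext z) \<in> (link (sol a))\<^sup>*"
      using w z by (intro linkI[of _ _ _ "W z"]) auto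
    also have "(Ext z, Ext 0) \<in> (link (sol a))\<^sup>*"
      using root z by blast
    finally show ?thesis .
  qed (use root w in blast)
  have "(x, Ext 0) \<in> (link (sol a))\<^sup>*" if "x \<in> sol a" for x
  proof (cases x)
    case (Cyc w)
    then have "w < M"
      using that by simp
    have "(x, Ext w) \<in> (link (sol a))\<^sup>*"
      using that Cyc by (intro linkI[of _ _ _ "W w"]) auto
    then show ?thesis
      using ext[OF \<open>w < M\<close>] by (rule rtrancl_trans)
  qed (use that ext in auto)
  then show ?thesis
    using u v sym[of "Ext 0" v] by (blast intro: rtrancl_trans)
qed

text \<open>The part of \<open>sol a\<close> around the hub of an unsatisfied clause is not linked to the hub \<open>J\<close>.\<close>

lemma sol_disconnected:
  assumes c: "c < J" and conn: "\<And>u v. u \<in> sol a \<Longrightarrow> v \<in> sol a \<Longrightarrow> (u, v) \<in> (link (sol a))\<^sup>*"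
  shows "satisfies a c"
proof (rule ccontr)
  assume unsat: "\<not> satisfies a c"
  define D where "D = {Ext w | w. hub w = c} \<union> {Cyc w | w. hub w = c \<and> hub (nxt w) = c}"
  have closed: "y \<in> D" if "x \<in> D" "(x, y) \<in> link (sol a)" for x y
  proof -
    have xy: "x \<in> sol a" "y \<in> sol a" "x \<noteq> y" "ends x \<inter> ends y \<noteq> {}"
      using that by auto
    have hn: "hub w = c \<longleftrightarrow> hub (nxt w) = c" if "Cyc w \<in> sol a" for w
      using hub_nxt_unsat[OF c _ _ unsat] that by simp
    show ?thesis
    proof (cases x)
      case (Cyc w)
      then have w: "hub w = c" "hub (nxt w) = c" "even w \<longleftrightarrow> a (w div L)"
        using that xy by (auto simp: D_def)
      show ?thesis
      proof (cases y)
        \<comment> \<open>Chosen edges of one cycle start at positions of equal parity, so no two of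
          them are consecutive.\<close>
        case [simp]: (Cyc w')
        then have "even w' \<longleftrightarrow> a (w' div L)"
          using xy by auto
        moreover have "w' = nxt w \<or> w = nxt w'"
          using xy \<open>x = Cyc w\<close> by auto
        ultimately have False
          using w even_nxt[of w] even_nxt[of w'] nxt_div[of w] nxt_div[of w'] by metis
        then show ?thesis ..
      qed (use xy Cyc w in \<open>auto simp: D_def\<close>)
    next
      case (Ext w)
      then have w: "hub w = c"
        using that by (auto simp: D_def)
      show ?thesis
      proof (cases y)
        case [simp]: (Cyc w')
        then have "w = w' \<or> w = nxt w'"
          using xy Ext by auto
        then show ?thesis
          using hn[of w'] xy w by (auto simp: D_def)
      qed (use xy Ext w in \<open>auto simp: D_def\<close>)
    qed (use xy in auto)
  qed
  have reach: "(x, y) \<in> (link (sol a))\<^sup>* \<Longrightarrow> x \<in> D \<Longrightarrow> y \<in> D" for x y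
    by (induction rule: rtrancl_induct) (use closed in blast)+
  obtain v where v: "v < X" "lit c v = 1 \<or> lit c v = 2"
    using nonempty[OF c] by blast
  \<comment> \<open>Position 2 lies in both patterns, so this vertex is at hub \<open>c\<close>
    whatever the sign of the literal.\<close>
  let ?w = "v * L + (4 * c + 2)"
  have "4 * c + 2 < L"
    using c by (simp add: L_def)
  then have w1: "?w div L = v" "?w mod L = 4 * c + 2"
    by (rule split_L)+
  have w2: "?w mod L div 4 = c" "?w mod 4 = 2"
    unfolding w1(2) mod_L_mod_4[of ?w, symmetric] by presburger+
  then have "hub ?w = c"
    using c v w1(1) by (auto simp: hub_eq_iff pat_def)
  then have "Ext ?w \<in> D"
    by (auto simp: D_def)
  moreover have "Ext 0 \<notin> D"
    using c by (auto simp: D_def hub_eq_iff pat_def)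
  moreover have "(Ext ?w, Ext 0) \<in> (link (sol a))\<^sup>*"
    using v w1 X by (intro conn) (auto simp: less_M)
  ultimately show False
    using reach by blast
qed

text \<open>\<open>nxt\<close> maps the chosen half of the cycle edges onto the other half. So
  \<open>M\<close> links and half of the \<open>M\<close> cycle edges are counted, where
  \<open>M = 4 * X * J\<close>.\<close>

lemma card_sol: "card (sol a) = 6 * X * J"
proof -
  define T where "T = {w \<in> {..<M}. even w \<longleftrightarrow> a (w div L)}"
  have "nxt ` T = {..<M} - T"
  proof (intro equalityI subsetI)
    fix y
    assume y: "y \<in> {..<M} - T"
    then obtain w where "w < M" "y = nxt w"
      using bij_nxt unfolding bij_betw_def by blast
    then show "y \<in> nxt ` T"
      using y by (auto simp: T_def)
  qed (auto simp: T_def)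
  then have "card T = card ({..<M} - T)"
    using card_image[of nxt T] by (simp add: inj_on_def)
  also have "\<dots> = M - card T"
    by (subst card_Diff_subset) (auto simp: T_def)
  finally have "2 * card T = M"
    using card_mono[of "{..<M}" T] by (simp add: T_def)
  moreover have "card (sol a) = M + card T"
    unfolding sol_def T_def[symmetric]
    by (subst card_Un_disjoint) (auto simp: card_image inj_on_def T_def)
  ultimately show ?thesis
    by (simp add: M_def L_def)
qed

text \<open>What is left are paths: a cycle edge with a pendant edge at either end, and the two
  pendant edges of a hub. Pendant edges and cycle edges get different colours; at a hub the label
  decides.\<close>

lemma sol_colouring:
  fixes a defines "col \<equiv> \<lambda>e. case e of Pend _ \<Rightarrow> True | HPend _ b \<Rightarrow> b | _ \<Rightarrow> False"
  assumes "u \<in> E - sol a" "v \<in> E - sol a" "{u, v} \<in> edges G"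
  shows "col u \<noteq> col v"
proof -
  have uv: "u \<noteq> v" "ends u \<inter> ends v \<noteq> {}"
    using assms by auto
  have "False" if "u = Cyc w" "v = Cyc w'" for w w'
  proof -
    have "(even w \<longleftrightarrow> \<not> a (w div L))" "(even w' \<longleftrightarrow> \<not> a (w' div L))" "w' = nxt w \<or> w = nxt w'"
      using that assms uv by auto
    then show False
      using even_nxt[of w] even_nxt[of w'] nxt_div[of w] nxt_div[of w'] by metis
  qed
  then show ?thesis
    using assms(2,3) uv by (cases u; cases v) (auto simp: col_def)
qed

section \<open>Counting the edges left by a small transversal\<close>

lemma card_edges: "card A = (\<Sum>w<M. of_bool (Cyc w \<in> A)) + (\<Sum>w<M. of_bool (Pend w \<in> A)) +
    (\<Sum>w<M. of_bool (Ext w \<in> A)) + (\<Sum>h\<le>J. of_bool (HPend h True \<in> A) + of_bool (HPend h False \<in> A))"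
  if "A \<subseteq> E"
proof -
  have "card A = (\<Sum>e\<in>E. of_bool (e \<in> A))"
    using that finite_E by (simp add: Int_absorb1)
  also have "E = ((Cyc ` {..<M} \<union> Pend ` {..<M}) \<union> Ext ` {..<M}) \<union>
      ((\<lambda>h. HPend h True) ` {..J} \<union> (\<lambda>h. HPend h False) ` {..J})"
    by (auto simp: E_def image_iff)
  also have "(\<Sum>e\<in>\<dots>. of_bool (e \<in> A)) = (\<Sum>w<M. of_bool (Cyc w \<in> A)) + (\<Sum>w<M. of_bool (Pend w \<in> A)) +
      (\<Sum>w<M. of_bool (Ext w \<in> A)) +
      ((\<Sum>h\<le>J. of_bool (HPend h True \<in> A)) + (\<Sum>h\<le>J. of_bool (HPend h False \<in> A)) :: nat)"
    by (subst sum.union_disjoint; (force simp del: sum_of_bool_eq)?)+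
      (simp add: sum.reindex inj_on_def del: sum_of_bool_eq)
  finally show ?thesis
    by (simp add: sum.distrib del: sum_of_bool_eq)
qed

lemma card_le_2:
  assumes "finite A" "\<And>x y z. x \<in> A \<Longrightarrow> y \<in> A \<Longrightarrow> z \<in> A \<Longrightarrow> x = y \<or> y = z \<or> x = z"
  shows "card A \<le> 2"
proof (rule ccontr)
  assume "\<not> card A \<le> 2"
  then obtain B where "B \<subseteq> A" "card B = 3"
    using obtain_subset_with_card_n[of 3 A] by auto
  then obtain x y z where "{x, y, z} \<subseteq> A" "x \<noteq> y" "y \<noteq> z" "x \<noteq> z"
    by (auto simp: card_3_iff)
  then show False
    using assms(2)[of x y z] by auto
qed

text \<open>Every vertex keeps at most two edges, since a triangle has no 2-colouring. Let
  \<open>?P\<close>, \<open>?C\<close>, \<open>?X\<close>, \<open>?H\<close> count the edges left of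
  the kinds \<open>Pend\<close>, \<open>Cyc\<close>, \<open>Ext\<close>, \<open>HPend\<close>.
  Summation over the cycle vertices gives \<open>?P + ?X + 2 * ?C \<le> 2 * M\<close>, over the hubs
  \<open>?H + ?X \<le> 2 * Suc J\<close>; moreover \<open>?P \<le> M\<close> and
  \<open>?H \<le> 2 * Suc J\<close>. All four together bound twice the number of edges left by
  \<open>3 * M + 4 * Suc J\<close>, so at least \<open>3 * M / 2 = 6 * X * J\<close> edges are in
  \<open>S\<close>, and equality makes all four tight.\<close>

lemma oct_is_sol:
  assumes oct: "connected_oct G S" and card: "card S \<le> 6 * X * J"
  shows "\<exists>a. S = sol a"
proof -
  note oct = oct[unfolded connected_oct_iff[OF simple_meet_graph[OF finite_E]] verts_meet_graph]
  define F where "F = E - S"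
  note S = conjunct1[OF oct]
  obtain col where col: "\<And>u v. u \<in> F \<Longrightarrow> v \<in> F \<Longrightarrow> {u, v} \<in> edges G \<Longrightarrow> col u \<noteq> (col v :: bool)"
    using conjunct1[OF conjunct2[OF oct]] unfolding F_def by blast
  have three: "x = y \<or> y = z \<or> x = z"
    if "x \<in> F" "y \<in> F" "z \<in> F" "v \<in> ends x" "v \<in> ends y" "v \<in> ends z" for x y z v
  proof (rule ccontr)
    assume "\<not> (x = y \<or> y = z \<or> x = z)"
    then have "{x, y} \<in> edges G" "{y, z} \<in> edges G" "{x, z} \<in> edges G"
      using that by (auto simp: F_def)
    then show False
      using col[of x y] col[of y z] col[of x z] that by auto
  qed
  define cy where "cy w = (of_bool (Cyc w \<in> F) :: nat)" for w
  define pe where "pe w = (of_bool (Pend w \<in> F) :: nat)" for w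
  define ex where "ex w = (of_bool (Ext w \<in> F) :: nat)" for w
  define hp where "hp h = (of_bool (HPend h True \<in> F) + of_bool (HPend h False \<in> F) :: nat)" for h
  have pe_le: "pe w \<le> 1" for w
    by (simp add: pe_def)
  have hp_le: "hp h \<le> 2" for h
    by (simp add: hp_def of_bool_def)
  have at_W: "pe (nxt w) + ex (nxt w) + cy (nxt w) + cy w \<le> 2" for w
    using three[of "Pend (nxt w)" "Ext (nxt w)" "Cyc (nxt w)" "W (nxt w)"]
      three[of "Pend (nxt w)" "Ext (nxt w)" "Cyc w" "W (nxt w)"]
      three[of "Pend (nxt w)" "Cyc (nxt w)" "Cyc w" "W (nxt w)"]
      three[of "Ext (nxt w)" "Cyc (nxt w)" "Cyc w" "W (nxt w)"]
    by (auto simp: pe_def ex_def cy_def)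
  have at_Hub: "hp h + (\<Sum>w<M. of_bool (hub w = h) * ex w) \<le> 2" for h
  proof -
    let ?A = "Ext ` ({..<M} \<inter> {w. hub w = h \<and> Ext w \<in> F})"
    let ?B = "HPend h ` {b. HPend h b \<in> F}"
    have "(\<Sum>w<M. of_bool (hub w = h) * ex w) = (\<Sum>w<M. of_bool (hub w = h \<and> Ext w \<in> F))"
      by (intro sum.cong) (auto simp: ex_def)
    also have "\<dots> = card ?A"
      by (simp add: card_image inj_on_def)
    finally have 1: "(\<Sum>w<M. of_bool (hub w = h) * ex w) = card ?A" .
    have "card {b. HPend h b \<in> F} = (\<Sum>b\<in>UNIV. of_bool (HPend h b \<in> F))"
      by simp
    also have "\<dots> = hp h"
      by (simp add: UNIV_bool hp_def del: sum_of_bool_eq)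
    finally have 2: "hp h = card ?B"
      by (simp add: card_image inj_on_def)
    have mem: "x \<in> F \<and> Hub h \<in> ends x" if "x \<in> ?A \<union> ?B" for x
      using that by auto
    have "card (?A \<union> ?B) \<le> 2"
    proof (rule card_le_2)
      show "finite (?A \<union> ?B)"
        by simp
      show "x = y \<or> y = z \<or> x = z" if "x \<in> ?A \<union> ?B" "y \<in> ?A \<union> ?B" "z \<in> ?A \<union> ?B" for x y z
        using mem[OF that(1)] mem[OF that(2)] mem[OF that(3)] three[of x y z "Hub h"] by argo
    qed
    moreover have "card (?A \<union> ?B) = card ?A + card ?B"
      by (rule card_Un_disjoint) auto
    ultimately show ?thesis
      using 1 2 by simp
  qed
  let ?P = "\<Sum>w<M. pe w" and ?C = "\<Sum>w<M. cy w" and ?X = "\<Sum>w<M. ex w" and ?H = "\<Sum>h\<le>J. hp h"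
  have re: "(\<Sum>w<M. g (nxt w)) = (\<Sum>w<M. g w)" for g :: "nat \<Rightarrow> nat"
    by (rule sum.reindex_bij_betw[OF bij_nxt])
  have M: "M = 4 * (X * J)"
    by (simp add: M_def L_def)
  have "card E = 3 * M + 2 * Suc J"
    by (subst card_edges) auto
  moreover have "card S + card F = card E"
    using S finite_E unfolding F_def by (metis card_Diff_subset card_mono finite_subset le_add_diff_inverse)
  moreover have "card F = ?C + ?P + ?X + ?H"
    unfolding cy_def pe_def ex_def hp_def by (rule card_edges) (auto simp: F_def)
  moreover have "(\<Sum>w<M. pe (nxt w) + ex (nxt w) + cy (nxt w) + cy w) \<le> 2 * M"
    using sum_mono[of "{..<M}" "\<lambda>w. pe (nxt w) + ex (nxt w) + cy (nxt w) + cy w" "\<lambda>_. 2"] at_W by simp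
  moreover have "(\<Sum>w<M. pe (nxt w) + ex (nxt w) + cy (nxt w) + cy w) = ?P + ?X + ?C + ?C"
    by (simp only: sum.distrib re)
  moreover have "?H + ?X \<le> 2 * Suc J"
  proof -
    have "(\<Sum>h\<le>J. of_bool (hub w = h) * ex w) = ex w" for w
      using hub_le[of w] by (simp add: of_bool_def if_distrib[of "\<lambda>t. t * _"] cong: if_cong)
    then have "?X = (\<Sum>w<M. \<Sum>h\<le>J. of_bool (hub w = h) * ex w)"
      by (simp only:)
    also have "\<dots> = (\<Sum>h\<le>J. \<Sum>w<M. of_bool (hub w = h) * ex w)"
      by (rule sum.swap)
    finally have "?H + ?X = (\<Sum>h\<le>J. hp h + (\<Sum>w<M. of_bool (hub w = h) * ex w))"
      by (simp add: sum.distrib)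
    also have "\<dots> \<le> (\<Sum>h\<le>J. 2)"
      by (rule sum_mono) (rule at_Hub)
    finally show ?thesis
      by simp
  qed
  moreover have "?P \<le> M"
    using sum_mono[of "{..<M}" pe "\<lambda>_. 1"] pe_le by simp
  moreover have "?H \<le> 2 * Suc J"
    using sum_mono[of "{..J}" hp "\<lambda>_. 2"] hp_le by simp
  moreover have "2 * card S \<le> 3 * M"
    using card unfolding M by (simp add: ac_simps)
  ultimately have "?P = M \<and> ?X = 0 \<and> ?H = 2 * Suc J \<and>
      (\<Sum>w<M. pe (nxt w) + ex (nxt w) + cy (nxt w) + cy w) = 2 * M"
    by linarith
  \<comment> \<open>The totals are written as sums of constants, so that equality of the sums
    carries over to the single terms.\<close>
  moreover have "M = (\<Sum>w<M. 1)" "2 * Suc J = (\<Sum>h\<le>J. 2)" "2 * M = (\<Sum>w<M. 2)"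
    by simp_all
  ultimately have tight: "?P = (\<Sum>w<M. 1)" "?X = 0" "?H = (\<Sum>h\<le>J. 2)"
    "(\<Sum>w<M. pe (nxt w) + ex (nxt w) + cy (nxt w) + cy w) = (\<Sum>w<M. 2)"
    by argo+
  have pe: "pe w = 1" if "w < M" for w
    using sum_mono_inv[OF tight(1), of w] that pe_le by simp
  have ex: "ex w = 0" if "w < M" for w
    using tight(2) that by simp
  have hp: "hp h = 2" if "h \<le> J" for h
    using sum_mono_inv[OF tight(3), of h] that hp_le by simp
  have alt: "cy (nxt w) + cy w = 1" if "w < M" for w
    using sum_mono_inv[OF tight(4), of w] that at_W pe[of "nxt w"] ex[of "nxt w"] by simp
  \<comment> \<open>By \<open>alt\<close> exactly one of two consecutive cycle edges is left, so
    each cycle is determined by its edge at position 0.\<close>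
  define a where "a v \<longleftrightarrow> Cyc (v * L) \<notin> F" for v
  have cyc: "Cyc (v * L + p) \<notin> F \<longleftrightarrow> (even p \<longleftrightarrow> a v)" if "v < X" "p < L" for v p
    using that(2)
  proof (induction p)
    case (Suc p)
    then have p: "p < L"
      by simp
    then have "nxt (v * L + p) = v * L + Suc p"
      using Suc.prems by (simp add: nxt_def)
    moreover have "v * L + p < M"
      using p that by (simp add: less_M)
    ultimately show ?case
      using Suc.IH[OF p] alt[of "v * L + p"] by (auto simp: cy_def split: if_splits)
  qed (simp add: a_def)
  have "e \<in> S \<longleftrightarrow> e \<in> sol a" if e: "e \<in> E" for e
  proof (cases e)
    case (Cyc w)
    then have w: "w < M"
      using e by simp
    have "Cyc (w div L * L + w mod L) \<notin> F \<longleftrightarrow> (even (w mod L) \<longleftrightarrow> a (w div L))"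
      using w L_pos by (intro cyc) (auto simp: less_M)
    moreover have "even (w mod L) \<longleftrightarrow> even w"
      using L_pos by (simp add: dvd_mod_iff)
    ultimately show ?thesis
      using Cyc w by (simp add: F_def)
  next
    case (Pend w)
    then show ?thesis
      using pe[of w] e by (auto simp: pe_def F_def)
  next
    case (Ext w)
    then show ?thesis
      using ex[of w] e by (auto simp: ex_def F_def)
  next
    case (HPend h b)
    then show ?thesis
      using hp[of h] e by (cases b) (auto simp: hp_def F_def of_bool_def split: if_splits)
  qed
  moreover have "sol a \<subseteq> E"
    by (auto simp: sol_def)
  ultimately show ?thesis
    using S by blast
qed

theorem oct_iff_sat:
  "(\<exists>S. connected_oct G S \<and> card S \<le> 6 * X * J) \<longleftrightarrow> (\<exists>a. \<forall>c<J. satisfies a c)"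
proof
  assume "\<exists>S. connected_oct G S \<and> card S \<le> 6 * X * J"
  then obtain a where "connected_oct G (sol a)"
    using oct_is_sol by blast
  then show "\<exists>a. \<forall>c<J. satisfies a c"
    unfolding connected_oct_iff[OF simple_meet_graph[OF finite_E]] using sol_disconnected by blast
next
  assume "\<exists>a. \<forall>c<J. satisfies a c"
  then obtain a where "\<And>c. c < J \<Longrightarrow> satisfies a c"
    by blast
  moreover have "sol a \<subseteq> E"
    by (auto simp: sol_def)
  ultimately have "connected_oct G (sol a)"
    unfolding connected_oct_iff[OF simple_meet_graph[OF finite_E]] verts_meet_graph
    by (intro conjI exI[of _ "\<lambda>e. case e of Pend _ \<Rightarrow> True | HPend _ b \<Rightarrow> b | _ \<Rightarrow> False"]
        ballI impI sol_colouring sol_connected)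
  then show "\<exists>S. connected_oct G S \<and> card S \<le> 6 * X * J"
    using card_sol[of a] by (intro exI[of _ "sol a"]) simp
qed

end

section \<open>Codes of instances, bit by bit\<close>

lemma concat_map_upt:
  "concat (map (\<lambda>i. map (f i) [0..<n]) [0..<m]) = map (\<lambda>p. f (p div n) (p mod n)) [0..<m * n]"
proof (induction m)
  case (Suc m)
  have "map (\<lambda>p. f (p div n) (p mod n)) [m * n..<m * n + n] = map (f m) [0..<n]"
    by (intro nth_equalityI) auto
  moreover have "[0..<Suc m * n] = [0..<m * n] @ [m * n..<m * n + n]"
    using upt_add_eq_append[of 0 "m * n" n] by (simp add: add.commute)
  ultimately show ?case
    using Suc by simp
qed simp

definition instance_length :: "nat \<Rightarrow> nat \<Rightarrow> nat" where
  "instance_length n k = n + 1 + n * n + length (nat_bits k)"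

definition instance_bit :: "nat \<Rightarrow> (nat \<Rightarrow> nat \<Rightarrow> bool) \<Rightarrow> nat \<Rightarrow> nat \<Rightarrow> bool" where
  "instance_bit n adj k i =
     (if i < n then True else if i = n then False
      else if i < n + 1 + n * n then adj ((i - (n + 1)) div n) ((i - (n + 1)) mod n)
      else nat_bit k (i - (n + 1 + n * n)))"

lemma encode_instance_eq_map:
  assumes "\<And>i j. i < n \<Longrightarrow> j < n \<Longrightarrow> adj i j \<longleftrightarrow> {i, j} \<in> E"
  shows "encode_instance n E k = map (instance_bit n adj k) [0..<instance_length n k]"
proof (rule nth_equalityI)
  have len: "length (encode_instance n E k) = instance_length n k"
    by (simp add: encode_instance_def instance_length_def concat_map_upt)
  then show "length (encode_instance n E k) = length (map (instance_bit n adj k) [0..<instance_length n k])"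
    by simp
  fix i
  assume "i < length (encode_instance n E k)"
  then have i: "i < instance_length n k"
    by (simp add: len)
  have cell: "{p div n, p mod n} \<in> E \<longleftrightarrow> adj (p div n) (p mod n)" if "p < n * n" for p
  proof -
    have "n > 0"
      using that by (cases n) auto
    then show ?thesis
      using assms[of "p div n" "p mod n"] that by (simp add: div_less_iff_less_mult)
  qed
  consider "i < n" | "i = n" | "n < i" "i < n + 1 + n * n" | "i \<ge> n + 1 + n * n"
    by linarith
  then have "encode_instance n E k ! i = instance_bit n adj k i"
  proof cases
    case 3
    then have "i - n = Suc (i - (n + 1))" "i - (n + 1) < n * n"
      by auto
    then show ?thesis
      using 3 cell[of "i - (n + 1)"]
      by (simp add: encode_instance_def instance_bit_def concat_map_upt nth_append)
  next
    case 4
    define l where "l = i - (n + 1 + n * n)"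
    have l: "i = n + 1 + n * n + l"
      using 4 by (simp add: l_def)
    then have "i - n = Suc (n * n + l)"
      by simp
    then show ?thesis
      using i l by (simp add: encode_instance_def instance_bit_def concat_map_upt nth_append nat_bit_def
        instance_length_def)
  qed (auto simp: encode_instance_def instance_bit_def nth_append)
  then show "encode_instance n E k ! i = map (instance_bit n adj k) [0..<instance_length n k] ! i"
    using i by simp
qed

lemma polytime_encode_instance:
  assumes n: "pexp (\<lambda>x \<sigma>. n x)" and k: "pexp (\<lambda>x \<sigma>. k x)" and adj: "ppred (\<lambda>x \<sigma>. adj x (\<sigma> 0) (\<sigma> 1))"
    and E: "\<And>x i j. i < n x \<Longrightarrow> j < n x \<Longrightarrow> adj x i j \<longleftrightarrow> {i, j} \<in> E x"
  shows "polytime (\<lambda>x. encode_instance (n x) (E x) (k x))"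
proof -
  have "encode_instance (n x) (E x) (k x) =
      map (instance_bit (n x) (adj x) (k x)) [0..<instance_length (n x) (k x)]" for x
    using E by (rule encode_instance_eq_map)
  moreover have "polytime (\<lambda>x. map (instance_bit (n x) (adj x) (k x)) [0..<instance_length (n x) (k x)])"
    unfolding instance_bit_def instance_length_def
    by (rule polytime_pexp) (intro pexp_intros n k ppred_app2[OF adj])+
  ultimately show ?thesis
    by simp
qed

lemma encode_instance_in_language:
  assumes "simple_graph \<lparr>verts = {..<n}, edges = E\<rparr>"
  shows "encode_instance n E k \<in> connected_oct_language C \<longleftrightarrow> C \<lparr>verts = {..<n}, edges = E\<rparr> \<and>
    (\<exists>S. connected_oct \<lparr>verts = {..<n}, edges = E\<rparr> S \<and> card S \<le> k)"
proof
  assume "encode_instance n E k \<in> connected_oct_language C"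
  then obtain m F l where F: "encode_instance n E k = encode_instance m F l"
      "simple_graph \<lparr>verts = {..<m}, edges = F\<rparr>" "C \<lparr>verts = {..<m}, edges = F\<rparr>"
      "\<exists>S. connected_oct \<lparr>verts = {..<m}, edges = F\<rparr> S \<and> card S \<le> l"
    unfolding connected_oct_language_def by blast
  then show "C \<lparr>verts = {..<n}, edges = E\<rparr> \<and>
      (\<exists>S. connected_oct \<lparr>verts = {..<n}, edges = E\<rparr> S \<and> card S \<le> k)"
    using encode_instance_inject[OF assms F(2,1)] by simp
next
  assume "C \<lparr>verts = {..<n}, edges = E\<rparr> \<and>
      (\<exists>S. connected_oct \<lparr>verts = {..<n}, edges = E\<rparr> S \<and> card S \<le> k)"
  then show "encode_instance n E k \<in> connected_oct_language C"
    unfolding connected_oct_language_def using assms by blast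
qed

text \<open>The residue modulo 4 is the tag of the constructor. Whether edges meet becomes a
  comparison of numbers.\<close>

fun vert_code :: "vert \<Rightarrow> nat" where
  "vert_code (W w) = 4 * w"
| "vert_code (Leaf w) = 4 * w + 1"
| "vert_code (Hub h) = 4 * h + 2"
| "vert_code (HLeaf h b) = 4 * (2 * h + of_bool b) + 3"

lemma inj_vert_code: "inj vert_code"
proof (rule injI)
  fix u v
  assume "vert_code u = vert_code v"
  then show "u = v"
    by (cases u; cases v) (auto simp: of_bool_def split: if_splits, presburger+)
qed

section \<open>Numbering the edges of the gadget graph\<close>

context cnf
begin

definition N where "N = 3 * M + 2 * Suc J"

definition dec where
  "dec e = (if e < M then Cyc e else if e < 2 * M then Pend (e - M) else if e < 3 * M then Ext (e - 2 * M)
     else HPend ((e - 3 * M) div 2) (odd (e - 3 * M)))"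

text \<open>\<open>end0\<close> and \<open>end1\<close> are the codes of the two ends of
  \<open>dec e\<close> in plain arithmetic. In the last case of \<open>end1\<close> the number
  \<open>e - 3 * M\<close> is \<open>2 * h + of_bool b\<close>.\<close>

definition end0 where
  "end0 e = (if e < M then 4 * e else if e < 2 * M then 4 * (e - M) else if e < 3 * M then 4 * (e - 2 * M)
     else 4 * ((e - 3 * M) div 2) + 2)"

definition end1 where
  "end1 e = (if e < M then 4 * nxt e else if e < 2 * M then 4 * (e - M) + 1
     else if e < 3 * M then 4 * hub (e - 2 * M) + 2 else 4 * (e - 3 * M) + 3)"

definition adj where
  "adj e f \<longleftrightarrow> e \<noteq> f \<and> (end0 e = end0 f \<or> end0 e = end1 f \<or> end1 e = end0 f \<or> end1 e = end1 f)"

lemma bij_dec: "bij_betw dec {..<N} E"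
proof (rule bij_betw_byWitness)
  let ?enc = "\<lambda>e. case e of Cyc w \<Rightarrow> w | Pend w \<Rightarrow> M + w | Ext w \<Rightarrow> 2 * M + w
    | HPend h b \<Rightarrow> 3 * M + (2 * h + of_bool b)"
  show "\<forall>e\<in>{..<N}. ?enc (dec e) = e"
  proof
    fix e
    show "?enc (dec e) = e"
    proof (cases "e < 3 * M")
      case False
      then obtain d where "e = 3 * M + d"
        using le_Suc_ex not_less by metis
      then show ?thesis
        by (simp add: dec_def)
    qed (auto simp: dec_def)
  qed
  show "\<forall>e\<in>E. dec (?enc e) = e"
    by (auto simp: E_def dec_def)
  show "dec ` {..<N} \<subseteq> E"
    by (auto simp: dec_def N_def)
  show "?enc ` E \<subseteq> {..<N}"
    by (auto simp: E_def N_def of_bool_def)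
qed

lemma vert_code_ends: "vert_code ` ends (dec e) = {end0 e, end1 e}"
proof (cases "e < 3 * M")
  case False
  then obtain d where "e = 3 * M + d"
    using le_Suc_ex not_less by metis
  moreover have "2 * (d div 2) + of_bool (odd d) = d"
    by simp
  ultimately show ?thesis
    by (simp add: dec_def end0_def end1_def)
qed (auto simp: dec_def end0_def end1_def)

lemma meet_iff_adj: "e \<noteq> f \<and> ends (dec e) \<inter> ends (dec f) \<noteq> {} \<longleftrightarrow> adj e f"
proof -
  have "ends (dec e) \<inter> ends (dec f) \<noteq> {} \<longleftrightarrow> vert_code ` ends (dec e) \<inter> vert_code ` ends (dec f) \<noteq> {}"
    using inj_vert_code by (simp add: image_Int[symmetric])
  then show ?thesis
    unfolding vert_code_ends adj_def by auto
qed

abbreviation GN where "GN \<equiv> meet_graph {..<N} (\<lambda>e. ends (dec e))"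

lemma GN_iff_sat:
  "encode_instance N (edges GN) (6 * X * J) \<in> connected_oct_language is_line_graph \<longleftrightarrow>
    (\<exists>a. \<forall>c<J. satisfies a c)"
proof -
  have eq: "\<lparr>verts = {..<N}, edges = edges GN\<rparr> = GN"
    by (simp add: meet_graph_def)
  have "inj_on (\<lambda>e. ends (dec e)) {..<N}"
    using bij_dec inj_ends comp_inj_on[of dec "{..<N}" ends] by (simp add: bij_betw_def comp_def)
  then have "is_line_graph GN"
    by (intro is_line_graph_meet_graph) (auto simp: card_ends)
  moreover have "simple_graph GN"
    by (simp add: simple_meet_graph)
  moreover have "(\<exists>S. connected_oct GN S \<and> card S \<le> k) \<longleftrightarrow> (\<exists>S. connected_oct G S \<and> card S \<le> k)" for k
  proof
    assume "\<exists>S. connected_oct GN S \<and> card S \<le> k"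
    then show "\<exists>S. connected_oct G S \<and> card S \<le> k"
      using connected_oct_meet_graph_bij[OF _ bij_dec, of ends] by fastforce
  next
    define enc where "enc = inv_into {..<N} dec"
    have enc: "bij_betw enc E {..<N}"
      unfolding enc_def using bij_dec by (rule bij_betw_inv_into)
    have "meet_graph E (\<lambda>e. ends (dec (enc e))) = G"
      unfolding meet_graph_def enc_def using bij_betw_inv_into_right[OF bij_dec] by fastforce
    moreover assume "\<exists>S. connected_oct G S \<and> card S \<le> k"
    ultimately show "\<exists>S. connected_oct GN S \<and> card S \<le> k"
      using connected_oct_meet_graph_bij[OF finite_E enc, of "\<lambda>e. ends (dec e)"] by fastforce
  qed
  ultimately show ?thesis
    using encode_instance_in_language[of N "edges GN" "6 * X * J" is_line_graph] oct_iff_sat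
    unfolding eq by simp
qed

end

text \<open>All that is used of the formula is that its size and its entries are definable; then so
  are the ends of every edge, and the instance is computed bit by bit.\<close>

theorem poly_reducible_cnf:
  assumes X: "pexp (\<lambda>x \<sigma>. X x)" and J: "pexp (\<lambda>x \<sigma>. J x)" and lit: "pexp (\<lambda>x \<sigma>. lit x (\<sigma> 0) (\<sigma> 1))"
    and cnf: "\<And>x. cnf (X x) (J x) (lit x)"
    and A: "\<And>x. x \<in> A \<longleftrightarrow> (\<exists>a. \<forall>c<J x. cnf.satisfies (X x) (lit x) a c)"
  shows "poly_reducible A (connected_oct_language is_line_graph)"
proof -
  let ?f = "\<lambda>x. encode_instance (cnf.N (X x) (J x))
    (edges (meet_graph {..<cnf.N (X x) (J x)} (\<lambda>e. cnf.ends (J x) (lit x) (cnf.dec (X x) (J x) e))))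
    (6 * X x * J x)"
  have L: "pexp (\<lambda>x \<sigma>. cnf.L (J x))"
    unfolding cnf.L_def[OF cnf] by (intro pexp_intros J)
  have M: "pexp (\<lambda>x \<sigma>. cnf.M (X x) (J x))"
    unfolding cnf.M_def[OF cnf] by (intro pexp_intros X L)
  have nxt: "pexp (\<lambda>x \<sigma>. cnf.nxt (J x) (\<sigma> 0))"
    unfolding cnf.nxt_def[OF cnf] by (intro pexp_intros L)
  have hub: "pexp (\<lambda>x \<sigma>. cnf.hub (J x) (lit x) (\<sigma> 0))"
    unfolding cnf.hub_def[OF cnf] cnf.pat_def[OF cnf] by (intro pexp_intros J L pexp_app2[OF lit])
  have end0: "pexp (\<lambda>x \<sigma>. cnf.end0 (X x) (J x) (\<sigma> 0))"
    unfolding cnf.end0_def[OF cnf] by (intro pexp_intros M)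
  have end1: "pexp (\<lambda>x \<sigma>. cnf.end1 (X x) (J x) (lit x) (\<sigma> 0))"
    unfolding cnf.end1_def[OF cnf] by (intro pexp_intros M pexp_app1[OF nxt] pexp_app1[OF hub])
  have "polytime ?f"
  proof (rule polytime_encode_instance)
    show "pexp (\<lambda>x \<sigma>. cnf.N (X x) (J x))"
      unfolding cnf.N_def[OF cnf] by (intro pexp_intros M J)
    show "pexp (\<lambda>x \<sigma>. 6 * X x * J x)"
      by (intro pexp_intros X J)
    show "ppred (\<lambda>x \<sigma>. cnf.adj (X x) (J x) (lit x) (\<sigma> 0) (\<sigma> 1))"
      unfolding cnf.adj_def[OF cnf] by (intro pexp_intros pexp_app1[OF end0] pexp_app1[OF end1])
    show "cnf.adj (X x) (J x) (lit x) i j \<longleftrightarrow> {i, j} \<in> edges (meet_graph {..<cnf.N (X x) (J x)}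
        (\<lambda>e. cnf.ends (J x) (lit x) (cnf.dec (X x) (J x) e)))"
      if "i < cnf.N (X x) (J x)" "j < cnf.N (X x) (J x)" for x i j
      using cnf.meet_iff_adj[OF cnf, where e = i and f = j] that by simp
  qed
  moreover have "x \<in> A \<longleftrightarrow> ?f x \<in> connected_oct_language is_line_graph" for x
    using A cnf.GN_iff_sat[OF cnf] by simp
  ultimately show ?thesis
    unfolding poly_reducible_def by blast
qed

section \<open>From polynomial time verifiers to satisfiability\<close>

lemma pair_word_Cons: "pair_word (b # x) u = True # b # pair_word x u"
  by (simp add: pair_word_def)

lemma length_pair_word [simp]: "length (pair_word x u) = 2 * length x + 1 + length u"
  by (induction x) (simp_all add: pair_word_Cons, simp add: pair_word_def)

lemma pair_word_nth:
  "m < length x \<Longrightarrow> pair_word x u ! (2 * m)"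
  "m < length x \<Longrightarrow> pair_word x u ! Suc (2 * m) = x ! m"
  "\<not> pair_word x u ! (2 * length x)"
  "pair_word x u ! Suc (2 * length x + l) = u ! l"
proof -
  show "m < length x \<Longrightarrow> pair_word x u ! (2 * m)"
    by (induction x arbitrary: m) (auto simp: pair_word_Cons less_Suc_eq_0_disj)
  show "m < length x \<Longrightarrow> pair_word x u ! Suc (2 * m) = x ! m"
    by (induction x arbitrary: m) (auto simp: pair_word_Cons less_Suc_eq_0_disj)
  show "\<not> pair_word x u ! (2 * length x)"
    by (induction x) (simp_all add: pair_word_Cons, simp add: pair_word_def)
  show "pair_word x u ! Suc (2 * length x + l) = u ! l"
    by (induction x) (simp_all add: pair_word_Cons, simp add: pair_word_def)
qed

text \<open>The state of the machine is treated as the content of one more tape, whose head stays in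
  cell 0. The function \<open>en\<close> enumerates the tuples of symbols that can be read in one step.\<close>

locale verifier =
  fixes M :: turing_machine and V :: "bool list set" and p q :: "nat poly"
    and en :: "nat \<Rightarrow> nat list" and Nt :: nat
  assumes wf: "wf_tm M" and computes: "computes_within M (\<lambda>z. [z \<in> V]) (poly q)"
    and en: "en ` {..<Nt} = {ss. length ss = Suc (num_tapes M) \<and>
      (\<forall>j<num_tapes M. ss ! j < num_symbols M) \<and> ss ! num_tapes M \<le> num_states M}"
begin

abbreviation k where "k \<equiv> num_tapes M"
abbreviation sigma where "sigma \<equiv> num_symbols M + num_states M + 1"

section \<open>Runs of the verifier as tables of cells and head positions\<close>

definition conf where "conf z t = (tm_step M ^^ t) (init_config M z)"

definition good :: "tm_config \<Rightarrow> bool" where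
  "good c \<longleftrightarrow> fst c \<le> num_states M \<and> length (snd c) = k \<and>
    (\<forall>j<k. \<forall>i. fst (snd c ! j) i < num_symbols M)"

text \<open>The state is read as the symbol of tape \<open>k\<close>. In the halting state every
  tape rewrites what it reads, so the table also describes the steps after halting.\<close>

definition action :: "nat list \<Rightarrow> nat \<times> (nat \<times> move) list" where
  "action ss = (if ss ! k < num_states M then trans M (ss ! k) (take k ss)
     else (ss ! k, map (\<lambda>s. (s, Stay)) (take k ss)))"

definition wr where
  "wr ss j = (if j < k then fst (snd (action ss) ! j) else fst (action ss))"

text \<open>Shifted by one to be a natural number; the value 1 on the state tape means no
  movement.\<close>

definition mv :: "nat list \<Rightarrow> nat \<Rightarrow> nat" where
  "mv ss j = (if j < k then nat (head_shift (snd (snd (action ss) ! j)) + 1) else 1)"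

definition cell where
  "cell z t j i = (if j < k then fst (snd (conf z t) ! j) i else if i = 0 then fst (conf z t) else 0)"

definition head where
  "head z t j = (if j < k then snd (snd (conf z t) ! j) else 0)"

definition reads where
  "reads z t = map (\<lambda>j. cell z t j (head z t j)) [0..<Suc k]"

lemma k_ge: "k \<ge> 2" "num_symbols M \<ge> 3"
  using wf by (auto simp: wf_tm_def)

lemma conf_Suc: "conf z (Suc t) = tm_step M (conf z t)"
  by (simp add: conf_def)

lemma good_init: "good (init_config M z)"
proof -
  have "fst ((word_tape z # replicate (k - 1) (word_tape [])) ! j) i < num_symbols M" if "j < k" for j i
    using k_ge that by (cases j) (auto simp: word_tape_def bit_symbol_def)
  then show ?thesis
    using k_ge by (auto simp: good_def init_config_def)
qed

lemma action_bounds: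
  assumes "length ss = Suc k" "\<forall>j<k. ss ! j < num_symbols M" "ss ! k \<le> num_states M"
  shows "fst (action ss) \<le> num_states M" "length (snd (action ss)) = k"
    "\<And>j. j < k \<Longrightarrow> fst (snd (action ss) ! j) < num_symbols M"
proof -
  have "fst (action ss) \<le> num_states M \<and> length (snd (action ss)) = k \<and>
      (\<forall>j<k. fst (snd (action ss) ! j) < num_symbols M)"
  proof (cases "ss ! k < num_states M")
    case True
    obtain q' as where tr: "trans M (ss ! k) (take k ss) = (q', as)"
      by fastforce
    moreover have "\<forall>s\<in>set (take k ss). s < num_symbols M" "length (take k ss) = k"
      using assms by (auto simp: all_set_conv_all_nth)
    ultimately have "q' \<le> num_states M" "length as = k" "\<forall>(s, d)\<in>set as. s < num_symbols M"
      using wf True unfolding wf_tm_def by metis+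
    then show ?thesis
      using True tr by (auto simp: action_def case_prod_beta)
  qed (use assms in \<open>auto simp: action_def\<close>)
  then show "fst (action ss) \<le> num_states M" "length (snd (action ss)) = k"
    "\<And>j. j < k \<Longrightarrow> fst (snd (action ss) ! j) < num_symbols M"
    by auto
qed

lemma good_symbols:
  assumes "good c" "ss = map read_tape (snd c) @ [fst c]"
  shows "length ss = Suc k" "\<forall>j<k. ss ! j < num_symbols M" "ss ! k \<le> num_states M"
  using assms by (auto simp: good_def read_tape_def nth_append)

lemma tm_step_action:
  assumes "good c" and ss: "ss = map read_tape (snd c) @ [fst c]"
  shows "tm_step M c = (fst (action ss), map2 act (snd (action ss)) (snd c))"
proof -
  have len: "length (snd c) = k"
    using assms(1) by (simp add: good_def)
  show ?thesis
  proof (cases "fst c < num_states M")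
    case True
    then show ?thesis
      using len by (simp add: action_def ss nth_append tm_step_def case_prod_beta)
  next
    case False
    have a: "action ss = (fst c, map (\<lambda>s. (s, Stay)) (map read_tape (snd c)))"
      using False len by (simp add: action_def ss nth_append)
    have "map2 act (map (\<lambda>s. (s, Stay)) (map read_tape (snd c))) (snd c) = snd c"
      by (intro nth_equalityI) (simp_all add: act_read)
    moreover have "tm_step M c = c"
      using False by (simp add: tm_step_def)
    ultimately show ?thesis
      unfolding a by simp
  qed
qed

lemma good_conf: "good (conf z t)"
proof (induction t)
  case 0
  show ?case
    using good_init by (simp add: conf_def)
next
  case (Suc t)
  let ?c = "conf z t"
  note a = tm_step_action[OF Suc refl] action_bounds[OF good_symbols[OF Suc refl]]
  have "length (snd ?c) = k"
    using Suc by (simp add: good_def)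
  then show ?case
    using a Suc by (auto simp: conf_Suc good_def act_def)
qed

lemma reads_eq: "reads z t = map read_tape (snd (conf z t)) @ [fst (conf z t)]"
proof (rule nth_equalityI)
  have len: "length (snd (conf z t)) = k"
    using good_conf[of z t] by (simp add: good_def)
  then show "length (reads z t) = length (map read_tape (snd (conf z t)) @ [fst (conf z t)])"
    by (simp add: reads_def)
  fix j
  assume "j < length (reads z t)"
  then have "j < Suc k"
    by (simp add: reads_def)
  then show "reads z t ! j = (map read_tape (snd (conf z t)) @ [fst (conf z t)]) ! j"
    using len by (auto simp: reads_def nth_append cell_def head_def read_tape_def less_Suc_eq simp del: upt_Suc)
qed

lemma step:
  assumes "j < Suc k"
  shows "cell z (Suc t) j i = (if i = head z t j then wr (reads z t) j else cell z t j i)"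
    and "head z (Suc t) j = head z t j + int (mv (reads z t) j) - 1"
proof -
  let ?c = "conf z t"
  have len: "length (snd ?c) = k"
    using good_conf[of z t] by (simp add: good_def)
  note a = tm_step_action[OF good_conf reads_eq[of z t]]
    action_bounds[OF good_symbols[OF good_conf reads_eq[of z t]]]
  have shift: "head_shift d + 1 \<ge> 0" for d
    by (cases d) auto
  show "cell z (Suc t) j i = (if i = head z t j then wr (reads z t) j else cell z t j i)"
    using assms a len by (auto simp: cell_def conf_Suc head_def wr_def act_def)
  show "head z (Suc t) j = head z t j + int (mv (reads z t) j) - 1"
    using assms a len shift by (auto simp: conf_Suc head_def mv_def act_def)
qed

lemma mv_le: "mv ss j \<le> 2"
proof -
  have "nat (head_shift d + 1) \<le> 2" for d
    by (cases d) auto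
  then show ?thesis
    by (simp add: mv_def)
qed

lemma head_bound: "j < Suc k \<Longrightarrow> \<bar>head z t j\<bar> \<le> int t"
proof (induction t)
  case 0
  have "snd ((word_tape z # replicate (k - 1) (word_tape [])) ! j) = 0" if "j < k"
    using that by (cases j) (auto simp: word_tape_def)
  then show ?case
    by (simp add: head_def conf_def init_config_def)
next
  case (Suc t)
  show ?case
    using Suc step(2)[OF Suc.prems, of z t] mv_le[of "reads z t" j] by linarith
qed

lemma head_0: "j < Suc k \<Longrightarrow> head z 0 j = 0"
  using head_bound[of j z 0] by simp

lemma cell_less: "j < Suc k \<Longrightarrow> cell z t j i < sigma"
  using good_conf[of z t] by (auto simp: cell_def good_def less_Suc_eq trans_less_add1)

lemma reads_in_range: "\<exists>s<Nt. en s = reads z t"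
proof -
  have "reads z t \<in> en ` {..<Nt}"
    unfolding en using good_conf[of z t] by (auto simp: reads_def cell_def good_def simp del: upt_Suc)
  then show ?thesis
    by auto
qed

lemma en_bounds:
  assumes "r < Nt"
  shows "length (en r) = Suc k" "j < Suc k \<Longrightarrow> en r ! j < sigma" "j < Suc k \<Longrightarrow> wr (en r) j < sigma"
proof -
  have "en r \<in> en ` {..<Nt}"
    using assms by simp
  then have e: "length (en r) = Suc k" "\<forall>j<k. en r ! j < num_symbols M" "en r ! k \<le> num_states M"
    unfolding en by auto
  note b = action_bounds[OF e]
  show "length (en r) = Suc k" "j < Suc k \<Longrightarrow> en r ! j < sigma" "j < Suc k \<Longrightarrow> wr (en r) j < sigma"
    using e b by (auto simp: wr_def less_Suc_eq trans_less_add1)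
qed

lemma reads_nth: "j < Suc k \<Longrightarrow> reads z t ! j = cell z t j (head z t j)"
  by (simp add: reads_def del: upt_Suc)

lemma length_reads: "length (reads z t) = Suc k"
  by (simp add: reads_def)

lemma cell_0:
  assumes "j < Suc k"
  shows "cell z 0 j i = (if j = 0 \<and> 0 \<le> i \<and> i < int (length z) then bit_symbol (z ! nat i) else 0)"
proof -
  have "fst ((word_tape z # replicate (k - 1) (word_tape [])) ! j) i =
      (if j = 0 \<and> 0 \<le> i \<and> i < int (length z) then bit_symbol (z ! nat i) else 0)" if "j < k"
    using that by (cases j) (auto simp: word_tape_def)
  then show ?thesis
    using k_ge by (auto simp: cell_def conf_def init_config_def)
qed

text \<open>A halted machine stays put, so one fixed time after the bound serves to inspect the
  output for all certificates.\<close>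

lemma conf_final:
  assumes "poly q (length z) \<le> t"
  shows "cell z t 1 0 = bit_symbol (z \<in> V)"
proof -
  obtain t0 where t0: "t0 \<le> poly q (length z)" "fst (conf z t0) = num_states M" "tm_output (conf z t0) [z \<in> V]"
    using computes unfolding computes_within_def conf_def by (metis (no_types, lifting))
  have "conf z (t0 + d) = conf z t0" for d
    by (induction d) (simp_all add: conf_Suc tm_step_def t0(2))
  then have "conf z t = conf z t0"
    using assms t0(1) by (metis le_add_diff_inverse le_trans)
  then show ?thesis
    using t0(3) k_ge by (simp add: cell_def tm_output_def)
qed

text \<open>Numbers of cells and head positions are shifted by \<open>T\<close>. The cells from \<open>T + U\<close> to
  \<open>T + U + P - 1\<close> of the input tape hold the certificate.\<close>

definition P :: "bool list \<Rightarrow> nat" where "P x = poly p (length x)"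
definition U :: "bool list \<Rightarrow> nat" where "U x = 2 * length x + 1"
definition T :: "bool list \<Rightarrow> nat" where "T x = poly q (U x + P x) + U x + P x + 1"
definition B :: "bool list \<Rightarrow> nat" where "B x = 2 * T x + (Suc k + sigma + Nt + 10)"

text \<open>Tables of the machine cut off to their finite range, the form that
  \<open>pexp_table2\<close> turns into an expression.\<close>

definition tab :: "(nat list \<Rightarrow> nat \<Rightarrow> nat) \<Rightarrow> nat \<Rightarrow> nat \<Rightarrow> nat" where
  "tab f r j = (if r < Nt \<and> j < Suc k then f (en r) j else 0)"

definition cert :: "bool list \<Rightarrow> nat \<Rightarrow> bool" where
  "cert x i \<longleftrightarrow> T x + U x \<le> i \<and> i < T x + U x + P x"

text \<open>The part of \<open>pair_word x u\<close> that does not depend on \<open>u\<close>: flags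
  True at even positions, bits of \<open>x\<close> at odd ones, and the flag False at
  \<open>2 * length x\<close>.\<close>

definition isym :: "bool list \<Rightarrow> nat \<Rightarrow> nat \<Rightarrow> nat" where
  "isym x j i = (if j \<noteq> 0 \<or> i < T x then 0 else
     if i - T x < 2 * length x then (if even (i - T x) \<or> bit_at x ((i - T x) div 2) then 2 else 1) else
     if i - T x = 2 * length x then 1 else 0)"

text \<open>The propositional variables, with digits \<open>d, t, j, i, s\<close> to the base \<open>B\<close>: at time \<open>t\<close>,
  cell \<open>i\<close> of tape \<open>j\<close> contains \<open>s\<close> (\<open>d = 0\<close>); the head of tape \<open>j\<close> is at \<open>i\<close> (\<open>d = 1\<close>); the head
  of tape \<open>j\<close> reads \<open>s\<close> (\<open>d = 2\<close>); all heads together read \<open>en s\<close> (\<open>d = 3\<close>).\<close>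

definition var where
  "var x d t j i s = d + B x * (t + B x * (j + B x * (i + B x * s)))"

text \<open>The digit \<open>d\<close> is the kind of the clause: 0 initial symbols outside the
  certificate; 1 a certificate cell holds a blank or a bit; 2 a blank in the certificate is followed
  by a blank; 3 heads start at cell 0; 4 a tape reads the symbol under its head; 5 the symbols read
  make up a tuple; 6 writing; 7 moving; 8 cells away from the head keep their symbol; 9 the output
  is not False.\<close>

definition ok where
  "ok x d t j i i' s r \<longleftrightarrow>
     d = 0 \<and> j < Suc k \<and> i \<le> 2 * T x \<and> \<not> (j = 0 \<and> cert x i) \<or>
     d = 1 \<and> cert x i \<or>
     d = 2 \<and> cert x i \<and> cert x (Suc i) \<or>
     d = 3 \<and> j < Suc k \<or>
     d = 4 \<and> t < T x \<and> j < Suc k \<and> i \<le> 2 * T x \<and> s < sigma \<or>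
     d = 5 \<and> t < T x \<and> r < Nt \<or>
     (d = 6 \<or> d = 7) \<and> t < T x \<and> r < Nt \<and> j < Suc k \<and> i \<le> 2 * T x \<or>
     d = 8 \<and> t < T x \<and> j < Suc k \<and> i \<le> 2 * T x \<and> i' \<le> 2 * T x \<and> i \<noteq> i' \<and> s < sigma \<or>
     d = (9 :: nat)"

text \<open>The clauses also have digits, and those that are not \<open>ok\<close> are replaced by a clause that
  occurs anyway.\<close>

definition pos where
  "pos x d t j i i' s r v \<longleftrightarrow>
    (if ok x d t j i i' s r then
       d = 0 \<and> v = var x 0 0 j i (isym x j i) \<or>
       d = 1 \<and> (v = var x 0 0 0 i 0 \<or> v = var x 0 0 0 i 1 \<or> v = var x 0 0 0 i 2) \<or>
       d = 2 \<and> v = var x 0 0 0 (Suc i) 0 \<or>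
       d = 3 \<and> v = var x 1 0 j (T x) 0 \<or>
       d = 4 \<and> v = var x 2 t j 0 s \<or>
       d = 5 \<and> v = var x 3 t 0 0 r \<or>
       d = 6 \<and> v = var x 0 (Suc t) j i (tab wr r j) \<or>
       d = 7 \<and> v = var x 1 (Suc t) j (i + tab mv r j - 1) 0 \<or>
       d = 8 \<and> v = var x 0 (Suc t) j i s
     else v = var x 1 0 0 (T x) 0)"

definition neg where
  "neg x d t j i i' s r v \<longleftrightarrow> ok x d t j i i' s r \<and>
    (d = 2 \<and> v = var x 0 0 0 i 0 \<or>
     d = 4 \<and> (v = var x 1 t j i 0 \<or> v = var x 0 t j i s) \<or>
     d = 5 \<and> (\<exists>j<Suc k. v = var x 2 t j 0 (tab nth r j)) \<or>
     (d = 6 \<or> d = 7) \<and> (v = var x 3 t 0 0 r \<or> v = var x 1 t j i 0) \<or>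
     d = 8 \<and> (v = var x 1 t j i' 0 \<or> v = var x 0 t j i s) \<or>
     d = 9 \<and> v = var x 0 (T x) 1 (T x) 1)"

text \<open>A variable has one sign per clause, and \<open>pos\<close> wins. This is why
  \<open>clauseI_neg\<close> excludes the positive literal.\<close>

definition litd :: "bool list \<Rightarrow> nat \<Rightarrow> nat \<Rightarrow> nat \<Rightarrow> nat \<Rightarrow> nat \<Rightarrow> nat \<Rightarrow> nat \<Rightarrow> nat \<Rightarrow> nat" where
  "litd x d t j i i' s r v = (if pos x d t j i i' s r v then 1 else if neg x d t j i i' s r v then 2 else 0)"

definition lit where
  "lit x c v = litd x (c mod B x) (c div B x mod B x) (c div B x div B x mod B x)
     (c div B x div B x div B x mod B x) (c div B x div B x div B x div B x mod B x)
     (c div B x div B x div B x div B x div B x mod B x)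
     (c div B x div B x div B x div B x div B x div B x) v"

section \<open>Variable and clause numbers as strings of digits\<close>

lemma B_gt: "2 * T x + Suc k < B x" "2 * T x + sigma < B x" "2 * T x + Nt < B x" "2 * T x + 9 < B x"
  by (simp_all add: B_def)

lemma var_digits:
  assumes "d < B x" "t < B x" "j < B x" "i < B x"
  shows "var x d t j i s mod B x = d" "var x d t j i s div B x mod B x = t"
    "var x d t j i s div B x div B x mod B x = j" "var x d t j i s div B x div B x div B x mod B x = i"
    "var x d t j i s div B x div B x div B x div B x = s"
  using assms by (simp_all add: var_def)

lemma var_inject:
  assumes "d < B x" "t < B x" "j < B x" "i < B x" "d' < B x" "t' < B x" "j' < B x" "i' < B x"
  shows "var x d t j i s = var x d' t' j' i' s' \<longleftrightarrow> d = d' \<and> t = t' \<and> j = j' \<and> i = i' \<and> s = s'"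
  using var_digits[OF assms(1-4), of s] var_digits[OF assms(5-8), of s'] by metis

lemma digit_less: "a < b \<Longrightarrow> c < b ^ n \<Longrightarrow> a + b * c < b ^ Suc n" for a b c :: nat
proof -
  assume "a < b" "c < b ^ n"
  then have "a + b * c < b * Suc c" "b * Suc c \<le> b * b ^ n"
    by (simp, intro mult_le_mono2) auto
  then show ?thesis
    by simp
qed

lemma var_less:
  assumes "d < B x" "t < B x" "j < B x" "i < B x" "s < B x"
  shows "var x d t j i s < B x ^ 5"
proof -
  have "s < B x ^ 1"
    using assms by simp
  then show ?thesis
    using digit_less[OF assms(4), of s 1]  digit_less[OF assms(3), of _ 2] digit_less[OF assms(2), of _ 3]
      digit_less[OF assms(1), of _ 4] unfolding var_def by (simp add: numeral_eq_Suc del: power_Suc)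
qed

text \<open>The seven arguments of \<open>litd\<close> before \<open>v\<close> are the digits of a
  clause number; the leading one is below the base because \<open>c < B x ^ 7\<close>.\<close>

lemma all_digits:
  "(\<forall>c<B x ^ 7. Q (lit x c)) \<longleftrightarrow>
    (\<forall>d t j i i' s r. d < B x \<longrightarrow> t < B x \<longrightarrow> j < B x \<longrightarrow> i < B x \<longrightarrow> i' < B x \<longrightarrow> s < B x \<longrightarrow> r < B x \<longrightarrow>
      Q (litd x d t j i i' s r))" (is "?L \<longleftrightarrow> ?R")
proof
  assume L: ?L
  show ?R
  proof (intro allI impI)
    fix d t j i i' s r
    assume b: "d < B x" "t < B x" "j < B x" "i < B x" "i' < B x" "s < B x" "r < B x"
    define c where "c = d + B x * (t + B x * (j + B x * (i + B x * (i' + B x * (s + B x * r)))))"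
    have "r < B x ^ 1"
      using b by simp
    then have "c < B x ^ 7"
      using digit_less[OF b(6), of r 1] digit_less[OF b(5), of _ 2] digit_less[OF b(4), of _ 3]
        digit_less[OF b(3), of _ 4] digit_less[OF b(2), of _ 5] digit_less[OF b(1), of _ 6]
      unfolding c_def by (simp add: numeral_eq_Suc del: power_Suc)
    then have "Q (lit x c)"
      using L by blast
    moreover have "lit x c = litd x d t j i i' s r"
      using b by (simp add: lit_def[abs_def] c_def)
    ultimately show "Q (litd x d t j i i' s r)"
      by simp
  qed
next
  assume R: ?R
  have Bpos: "B x > 0"
    using B_gt(1)[of x] by simp
  show ?L
  proof (intro allI impI)
    fix c
    assume c: "c < B x ^ 7"
    have "c div B x div B x div B x div B x div B x div B x < B x"
      using c Bpos by (simp add: div_less_iff_less_mult numeral_eq_Suc ac_simps)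
    then show "Q (lit x c)"
      using R Bpos unfolding lit_def[abs_def] by simp
  qed
qed

definition clause where
  "clause x a l \<longleftrightarrow> (\<exists>v<B x ^ 5. l v = (1 :: nat) \<and> a v \<or> l v = 2 \<and> \<not> a v)"

lemma clauseD:
  "clause x a (litd x d t j i i' s r) \<Longrightarrow>
    \<exists>v. pos x d t j i i' s r v \<and> a v \<or> neg x d t j i i' s r v \<and> \<not> a v"
  unfolding clause_def litd_def by (auto split: if_splits)

lemma clauseI_pos:
  "pos x d t j i i' s r v \<Longrightarrow> a v \<Longrightarrow> v < B x ^ 5 \<Longrightarrow> clause x a (litd x d t j i i' s r)"
  unfolding clause_def litd_def by auto

lemma clauseI_neg:
  "neg x d t j i i' s r v \<Longrightarrow> \<not> pos x d t j i i' s r v \<Longrightarrow> \<not> a v \<Longrightarrow> v < B x ^ 5 \<Longrightarrow>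
    clause x a (litd x d t j i i' s r)"
  unfolding clause_def litd_def by auto

lemma ok_cases [consumes 1, case_names 0 1 2 3 4 5 6 7 8 9]:
  assumes "ok x d t j i i' s r"
  obtains "d = 0" "j < Suc k" "i \<le> 2 * T x" "\<not> (j = 0 \<and> cert x i)"
  | "d = 1" "cert x i"
  | "d = 2" "cert x i" "cert x (Suc i)"
  | "d = 3" "j < Suc k"
  | "d = 4" "t < T x" "j < Suc k" "i \<le> 2 * T x" "s < sigma"
  | "d = 5" "t < T x" "r < Nt"
  | "d = 6" "t < T x" "r < Nt" "j < Suc k" "i \<le> 2 * T x"
  | "d = 7" "t < T x" "r < Nt" "j < Suc k" "i \<le> 2 * T x"
  | "d = 8" "t < T x" "j < Suc k" "i \<le> 2 * T x" "i' \<le> 2 * T x" "i \<noteq> i'" "s < sigma"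
  | "d = 9"
  using assms unfolding ok_def by (elim disjE conjE) (erule that; assumption)+

text \<open>Hence the cells \<open>0\<close> to \<open>2 * T x\<close> hold the whole input and all
  heads up to time \<open>T x\<close>, when the verifier has halted for every admissible
  certificate.\<close>

lemma T_ge: "T x \<ge> U x + P x + 1" "length z \<le> U x + P x \<Longrightarrow> poly q (length z) \<le> T x"
  using poly_nat_mono[of "length z" "U x + P x" q] by (auto simp: T_def)

lemma cert_le: "cert x i \<Longrightarrow> i < 2 * T x"
  using T_ge(1)[of x] by (simp add: cert_def)

lemma init_cert:
  "cell (pair_word x u) 0 0 (int (U x + l)) = (if l < length u then bit_symbol (u ! l) else 0)"
  using pair_word_nth(4)[of x u l] by (simp add: cell_0 U_def nat_add_distrib nat_mult_distrib)

lemma init_isym: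
  assumes "length u \<le> P x" "j < Suc k" "\<not> (j = 0 \<and> cert x i)"
  shows "cell (pair_word x u) 0 j (int i - int (T x)) = isym x j i"
proof (cases "j = 0 \<and> T x \<le> i")
  case True
  then obtain n where i: "i = T x + n"
    using le_Suc_ex by blast
  have j: "j = 0"
    using True by simp
  show ?thesis
  proof (cases "n < U x")
    case n: True
    have c: "cell (pair_word x u) 0 j (int i - int (T x)) = bit_symbol (pair_word x u ! n)"
      using n by (simp add: i j cell_0 U_def)
    have s: "isym x j i = (if n < 2 * length x then (if even n \<or> bit_at x (n div 2) then 2 else 1)
        else if n = 2 * length x then 1 else 0)"
      by (simp add: isym_def i j)
    define m where "m = n div 2"
    have "n = 2 * m \<and> m < length x \<or> n = Suc (2 * m) \<and> m < length x \<or> n = 2 * length x"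
      using n unfolding U_def m_def by presburger
    then consider "n = 2 * m" "m < length x" | "n = Suc (2 * m)" "m < length x" | "n = 2 * length x"
      by blast
    then show ?thesis
    proof cases
      case 1
      then show ?thesis
        unfolding c s by (simp add: pair_word_nth(1) bit_symbol_def)
    next
      case 2
      then show ?thesis
        unfolding c s by (simp add: pair_word_nth(2) bit_symbol_def bit_at_def)
    next
      case 3
      then show ?thesis
        unfolding c s by (simp add: pair_word_nth(3) bit_symbol_def)
    qed
  next
    case False
    then have "n \<ge> U x + P x"
      using assms(3) i j by (auto simp: cert_def)
    then show ?thesis
      using assms(1) by (auto simp: i j isym_def cell_0 U_def)
  qed
next
  case False
  then show ?thesis
    using assms(2) by (auto simp: isym_def cell_0)
qed

lemma clause_nonempty:
  assumes b: "d < B x" "t < B x" "j < B x" "i < B x" "i' < B x" "s < B x" "r < B x"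
  shows "\<exists>v<B x ^ 5. litd x d t j i i' s r v = 1 \<or> litd x d t j i i' s r v = 2"
proof -
  note B = B_gt[of x]
  have witness: ?thesis
    if "pos x d t j i i' s r (var x d' t' j' m s') \<or> neg x d t j i i' s r (var x d' t' j' m s')"
      "d' < B x" "t' < B x" "j' < B x" "m < B x" "s' < B x" for d' t' j' m s'
    using that var_less[OF that(2-)] unfolding litd_def by auto
  show ?thesis
  proof (cases "ok x d t j i i' s r")
    case False
    then show ?thesis
      by (intro witness[of 1 0 0 "T x" 0]) (use B in \<open>auto simp: pos_def\<close>)
  next
    case True
    from True show ?thesis
    proof (cases rule: ok_cases)
      case 0
      have "isym x j i \<le> 2"
        by (simp add: isym_def)
      then show ?thesis
        by (intro witness[of 0 0 j i "isym x j i"]) (use 0 True b B in \<open>auto simp: pos_def\<close>)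
    next
      case 1
      then show ?thesis
        by (intro witness[of 0 0 0 i 0]) (use True b B in \<open>auto simp: pos_def\<close>)
    next
      case 2
      then show ?thesis
        by (intro witness[of 0 0 0 i 0]) (use True b B in \<open>auto simp: neg_def\<close>)
    next
      case 3
      then show ?thesis
        by (intro witness[of 1 0 j "T x" 0]) (use True b B in \<open>auto simp: pos_def\<close>)
    next
      case 4
      then show ?thesis
        by (intro witness[of 2 t j 0 s]) (use True b B in \<open>auto simp: pos_def\<close>)
    next
      case 5
      then show ?thesis
        by (intro witness[of 3 t 0 0 r]) (use True b B in \<open>auto simp: pos_def\<close>)
    next
      case 6
      then show ?thesis
        by (intro witness[of 1 t j i 0]) (use True b B in \<open>auto simp: neg_def\<close>)
    next
      case 7
      then show ?thesis
        by (intro witness[of 1 t j i 0]) (use True b B in \<open>auto simp: neg_def\<close>)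
    next
      case 8
      then show ?thesis
        by (intro witness[of 0 t j i s]) (use True b B in \<open>auto simp: neg_def\<close>)
    next
      case 9
      then show ?thesis
        by (intro witness[of 0 "T x" 1 "T x" 1]) (use True b B in \<open>auto simp: neg_def\<close>)
    qed
  qed
qed

text \<open>An assignment may mark a cell with several symbols. The induction over time shows only
  that whatever holds in the run on the extracted certificate is marked; a rejecting run would mark
  the symbol that kind 9 forbids.\<close>

lemma clauses_sound:
  assumes cl: "\<And>d t j i i' s r. d < B x \<Longrightarrow> t < B x \<Longrightarrow> j < B x \<Longrightarrow> i < B x \<Longrightarrow> i' < B x \<Longrightarrow> s < B x \<Longrightarrow>
      r < B x \<Longrightarrow> clause x a (litd x d t j i i' s r)"
  shows "\<exists>u. length u \<le> P x \<and> pair_word x u \<in> V"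
proof -
  note B = B_gt[of x]
  note clD = clauseD[OF cl]
  \<comment> \<open>The certificate ends at its first cell marked blank; kind 2 propagates the blank
    to the rest.\<close>
  define l0 where "l0 = (LEAST l. l = P x \<or> a (var x 0 0 0 (T x + U x + l) 0))"
  have l0: "l0 = P x \<or> a (var x 0 0 0 (T x + U x + l0) 0)"
    unfolding l0_def by (rule LeastI[of _ "P x"]) simp
  have l0_le: "l0 \<le> P x"
    unfolding l0_def by (rule Least_le) simp
  have l0_less: "\<not> a (var x 0 0 0 (T x + U x + l) 0)" if "l < l0" for l
    using not_less_Least[OF that[unfolded l0_def]] by simp
  \<comment> \<open>Where the symbol 2 is not marked, kind 1 leaves only the symbol 1, as no cell
    before \<open>l0\<close> is marked blank.\<close>
  define u where "u = map (\<lambda>l. a (var x 0 0 0 (T x + U x + l) 2)) [0..<l0]"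
  define z where "z = pair_word x u"
  have u: "length u = l0"
    by (simp add: u_def)
  define hd where "hd t j = nat (head z t j + int (T x))" for t j
  have hd: "int (hd t j) = head z t j + int (T x)" "hd t j \<le> 2 * T x" if "t \<le> T x" "j < Suc k" for t j
    using head_bound[OF that(2), of z t] that(1) by (auto simp: hd_def)
  have blank: "a (var x 0 0 0 (T x + U x + l) 0)" if "l0 \<le> l" "l < P x" for l
    using that
  proof (induction l rule: dec_induct)
    case base
    then show ?case
      using l0 by auto
  next
    case (step l)
    have c: "cert x (T x + U x + l)" "cert x (Suc (T x + U x + l))"
      using step.prems by (auto simp: cert_def)
    show ?case
      using clD[of 2 0 0 "T x + U x + l" 0 0 0] c step cert_le[OF c(1)] B
      by (auto simp: pos_def neg_def ok_def)
  qed
  have init: "a (var x 0 0 j i (cell z 0 j (int i - int (T x))))" if j: "j < Suc k" and i: "i \<le> 2 * T x" for j i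
  proof (cases "j = 0 \<and> cert x i")
    case False
    then have "a (var x 0 0 j i (isym x j i))"
      using clD[of 0 0 j i 0 0 0] i j B by (auto simp: pos_def neg_def ok_def)
    then show ?thesis
      using init_isym[of u x j i] False u l0_le j by (simp add: z_def)
  next
    case True
    then obtain l where l: "i = T x + U x + l" "l < P x"
      unfolding cert_def by (metis add_less_cancel_left le_Suc_ex)
    have "int i - int (T x) = int (U x + l)"
      by (simp add: l)
    then have c: "cell z 0 j (int i - int (T x)) = (if l < length u then bit_symbol (u ! l) else 0)"
      using init_cert[of x u l] True by (simp add: z_def)
    show ?thesis
    proof (cases "l < l0")
      case l0: True
      have "a (var x 0 0 0 i 1) \<or> a (var x 0 0 0 i 2)"
        using clD[of 1 0 0 i 0 0 0] True i B l0_less[OF l0] l by (auto simp: pos_def neg_def ok_def)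
      then show ?thesis
        unfolding c using True l0 u l(1) by (auto simp: u_def bit_symbol_def)
    next
      case False
      then show ?thesis
        unfolding c using True u blank[of l] l by simp
    qed
  qed
  have run: "t \<le> T x \<Longrightarrow> (\<forall>j<Suc k. a (var x 1 t j (hd t j) 0) \<and>
      (\<forall>i\<le>2 * T x. a (var x 0 t j i (cell z t j (int i - int (T x))))))" for t
  proof (induction t)
    case 0
    have "a (var x 1 0 j (T x) 0)" if "j < Suc k" for j
      using clD[of 3 0 j 0 0 0 0] that B by (auto simp: pos_def neg_def ok_def)
    then show ?case
      using init head_0 by (auto simp: hd_def)
  next
    case (Suc t)
    then have t: "t < T x" "t \<le> T x"
      by auto
    have IH: "a (var x 1 t j (hd t j) 0)" "i \<le> 2 * T x \<Longrightarrow> a (var x 0 t j i (cell z t j (int i - int (T x))))"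
      if "j < Suc k" for j i
      using Suc that by auto
    have rd: "a (var x 2 t j 0 (reads z t ! j))" if j: "j < Suc k" for j
    proof -
      have s: "cell z t j (int (hd t j) - int (T x)) = reads z t ! j" "reads z t ! j < sigma"
        using hd(1)[OF t(2) j] j cell_less by (simp_all add: reads_nth)
      then show ?thesis
        using clD[of 4 t j "hd t j" 0 "reads z t ! j" 0] hd(2)[OF t(2) j] t j B
          IH(1)[OF j] IH(2)[OF j, of "hd t j"] by (auto simp: pos_def neg_def ok_def)
    qed
    obtain r where r: "r < Nt" "en r = reads z t"
      using reads_in_range by blast
    have R: "a (var x 3 t 0 0 r)"
      using clD[of 5 t 0 0 0 0 r] r rd t B by (auto simp: pos_def neg_def ok_def tab_def)
    show ?case
    proof (intro allI impI conjI)
      fix j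
      assume j: "j < Suc k"
      note h = hd[OF t(2) j]
      have "hd (Suc t) j = hd t j + mv (reads z t) j - 1"
        using hd[OF Suc.prems j] h step(2)[OF j, of z t] by linarith
      then show "a (var x 1 (Suc t) j (hd (Suc t) j) 0)"
        using clD[of 7 t j "hd t j" 0 0 r] h R IH(1)[OF j] r j t B
        by (auto simp: pos_def neg_def ok_def tab_def)
      fix i
      assume i: "i \<le> 2 * T x"
      show "a (var x 0 (Suc t) j i (cell z (Suc t) j (int i - int (T x))))"
      proof (cases "i = hd t j")
        case True
        then show ?thesis
          using clD[of 6 t j "hd t j" 0 0 r] h R IH(1)[OF j] r j t B step(1)[OF j, of z t "head z t j"]
          by (auto simp: pos_def neg_def ok_def tab_def)
      next
        case False
        then have "int i - int (T x) \<noteq> head z t j"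
          using h(1) by linarith
        then have "cell z (Suc t) j (int i - int (T x)) = cell z t j (int i - int (T x))"
          using step(1)[OF j] by simp
        moreover have "cell z t j (int i - int (T x)) < sigma"
          using j by (rule cell_less)
        moreover from this have "cell z t j (int i - int (T x)) < B x"
          using B(2) by linarith
        ultimately show ?thesis
          using clD[of 8 t j i "hd t j" "cell z t j (int i - int (T x))" 0] h IH(1)[OF j] IH(2)[OF j i]
            False i j t B by (auto simp: pos_def neg_def ok_def)
      qed
    qed
  qed
  have "\<forall>i\<le>2 * T x. a (var x 0 (T x) 1 i (cell z (T x) 1 (int i - int (T x))))"
    using run[of "T x"] k_ge by simp
  from this[rule_format, of "T x"] have "a (var x 0 (T x) 1 (T x) (cell z (T x) 1 0))"
    by simp
  moreover have "\<not> a (var x 0 (T x) 1 (T x) 1)"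
    using clD[of 9 0 0 0 0 0 0] B by (auto simp: pos_def neg_def ok_def)
  moreover have "cell z (T x) 1 0 = bit_symbol (z \<in> V)"
    using l0_le u by (intro conf_final T_ge(2)) (simp add: z_def U_def)
  ultimately have "z \<in> V"
    by (auto simp: bit_symbol_def split: if_splits)
  then show ?thesis
    using l0_le u unfolding z_def by blast
qed


text \<open>The assignment makes exactly the facts of the run on \<open>u\<close> true; each clause
  is a fact or an implication that holds along that run.\<close>

lemma clauses_complete:
  assumes u: "length u \<le> P x" "pair_word x u \<in> V"
  shows "\<exists>a. \<forall>d t j i i' s r. d < B x \<longrightarrow> t < B x \<longrightarrow> j < B x \<longrightarrow> i < B x \<longrightarrow> i' < B x \<longrightarrow> s < B x \<longrightarrow> r < B x \<longrightarrow>
    clause x a (litd x d t j i i' s r)"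
proof -
  define z where "z = pair_word x u"
  define tr where "tr d t j i s \<longleftrightarrow> d = 0 \<and> cell z t j (int i - int (T x)) = s \<or>
      d = 1 \<and> head z t j = int i - int (T x) \<or> d = 2 \<and> cell z t j (head z t j) = s \<or>
      d = 3 \<and> s < Nt \<and> en s = reads z t" for d t j i s :: nat
  define a where "a v = tr (v mod B x) (v div B x mod B x) (v div B x div B x mod B x)
      (v div B x div B x div B x mod B x) (v div B x div B x div B x div B x)" for v
  have a: "a (var x d t j i s) \<longleftrightarrow> tr d t j i s" if "d < B x" "t < B x" "j < B x" "i < B x" for d t j i s
    unfolding a_def var_digits[OF that] ..
  note B = B_gt[of x]
  have "clause x a (litd x d t j i i' s r)"
    if b: "d < B x" "t < B x" "j < B x" "i < B x" "i' < B x" "s < B x" "r < B x" for d t j i i' s r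
  proof -
    have c: "0 < B x" "Suc 0 < B x" "2 < B x" "3 < B x" "T x < B x" "t < T x \<Longrightarrow> Suc t < B x"
      using B by auto
    have satisfied: ?thesis
      if "tr d' t' j' m s'" "pos x d t j i i' s r (var x d' t' j' m s')"
        "d' < B x" "t' < B x" "j' < B x" "m < B x" "s' < B x" for d' t' j' m s'
      using that by (intro clauseI_pos[of x d t j i i' s r "var x d' t' j' m s'"] var_less) (simp_all add: a)
    have refuted: ?thesis
      if "\<not> tr d' t' j' m s'" "neg x d t j i i' s r (var x d' t' j' m s')"
        "\<not> pos x d t j i i' s r (var x d' t' j' m s')"
        "d' < B x" "t' < B x" "j' < B x" "m < B x" "s' < B x" for d' t' j' m s'
      using that by (intro clauseI_neg[of x d t j i i' s r "var x d' t' j' m s'"] var_less) (simp_all add: a)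
    show ?thesis
    proof (cases "ok x d t j i i' s r")
      case False
      have "tr 1 0 0 (T x) 0"
        using head_0[of 0 z] by (simp add: tr_def)
      then show ?thesis
        by (rule satisfied) (use False c in \<open>simp_all add: pos_def\<close>)
    next
      case ok: True
      from ok show ?thesis
      proof (cases rule: ok_cases)
        case 0
        have "isym x j i \<le> 2"
          by (simp add: isym_def)
        then have "isym x j i < B x"
          using c by simp
        moreover have "tr 0 0 j i (isym x j i)"
          using init_isym[OF u(1) 0(2,4)] by (simp add: tr_def z_def)
        ultimately show ?thesis
          by (intro satisfied[of 0 0 j i "isym x j i"]) (use 0 ok b c in \<open>simp_all add: pos_def\<close>)
      next
        case 1
        define s' where "s' = cell z 0 0 (int i - int (T x))"
        then have tr: "tr 0 0 0 i s'"
          by (simp add: tr_def)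
        have "s' \<le> 2"
          by (simp add: s'_def cell_0 bit_symbol_def)
        then have s': "s' < B x" "s' = 0 \<or> s' = 1 \<or> s' = 2"
          using c by auto
        have "pos x d t j i i' s r (var x 0 0 0 i s')"
          using 1 ok s'(2) by (auto simp: pos_def)
        then show ?thesis
          by (rule satisfied[OF tr]) (use b c s'(1) in simp_all)
      next
        case 2
        have pn: "pos x d t j i i' s r v \<longleftrightarrow> v = var x 0 0 0 (Suc i) 0" "neg x d t j i i' s r v \<longleftrightarrow> v = var x 0 0 0 i 0" for v
          using 2 ok by (simp_all add: pos_def neg_def)
        obtain l where l: "i = T x + U x + l"
          using 2 unfolding cert_def by (metis le_Suc_ex)
        have i: "int i - int (T x) = int (U x + l)" "int (Suc i) - int (T x) = int (U x + Suc l)"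
          by (simp_all add: l)
        \<comment> \<open>Bits are written as 1 and 2, so a blank certificate cell lies after the
          end of \<open>u\<close>, and so does its right neighbour.\<close>
        have "cell z 0 0 (int i - int (T x)) = 0 \<longrightarrow> cell z 0 0 (int (Suc i) - int (T x)) = 0"
          unfolding i z_def init_cert by (simp add: bit_symbol_def split: if_splits)
        moreover have "tr 0 0 0 m 0 \<longleftrightarrow> cell z 0 0 (int m - int (T x)) = 0" for m
          by (simp add: tr_def)
        ultimately have dis: "\<not> tr 0 0 0 i 0 \<or> tr 0 0 0 (Suc i) 0"
          by metis
        have "Suc i < B x"
          using cert_le[OF 2(3)] B by simp
        note c = c this
        show ?thesis
          by (insert dis, (elim disjE; (drule refuted | drule satisfied)))
            (use b c in \<open>simp_all add: pn var_inject\<close>)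
      next
        case 3
        have "tr 1 0 j (T x) 0"
          using head_0[OF 3(2), of z] by (simp add: tr_def)
        then show ?thesis
          by (rule satisfied) (use 3 ok b c in \<open>simp_all add: pos_def\<close>)
      next
        case 4
        have pn: "pos x d t j i i' s r v \<longleftrightarrow> v = var x 2 t j 0 s" "neg x d t j i i' s r v \<longleftrightarrow> v = var x 1 t j i 0 \<or> v = var x 0 t j i s" for v
          using 4 ok by (simp_all add: pos_def neg_def)
        note t = 4(2)
        have dis: "\<not> tr 1 t j i 0 \<or> \<not> tr 0 t j i s \<or> tr 2 t j 0 s"
          by (auto simp: tr_def)
        show ?thesis
          by (insert dis, (elim disjE; (drule refuted | drule satisfied)))
            (use b c t in \<open>simp_all add: pn var_inject\<close>)
      next
        case 5
        show ?thesis
        proof (cases "en r = reads z t")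
          case True
          then have "tr 3 t 0 0 r"
            using 5 by (simp add: tr_def)
          then show ?thesis
            by (rule satisfied) (use 5 ok b c in \<open>simp_all add: pos_def\<close>)
        next
          case False
          \<comment> \<open>A tuple other than the one read differs from it on some tape, and the
            negative literal for that tape is true.\<close>
          then obtain j' where j': "j' < Suc k" "en r ! j' \<noteq> reads z t ! j'"
            using en_bounds(1)[OF 5(3)] length_reads[of z t] nth_equalityI[of "en r" "reads z t"] by metis
          have tab: "tab nth r j' = en r ! j'" "en r ! j' < sigma"
            using 5 j' en_bounds(2)[OF 5(3) j'(1)] by (simp_all add: tab_def)
          have "\<not> tr 2 t j' 0 (tab nth r j')"
            using j' tab(1) by (simp add: tr_def reads_nth)
          moreover have "neg x d t j i i' s r (var x 2 t j' 0 (tab nth r j'))"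
            using 5 ok j' by (auto simp: neg_def)
          moreover have j'B: "j' < B x" "tab nth r j' < B x"
            using j' tab B by auto
          moreover have "pos x d t j i i' s r v \<longleftrightarrow> v = var x 3 t 0 0 r" for v
            using 5 ok by (simp add: pos_def)
          then have "\<not> pos x d t j i i' s r (var x 2 t j' 0 (tab nth r j'))"
            using b c j'B by (simp add: var_inject)
          ultimately show ?thesis
            using refuted b c by blast
        qed
      next
        case 6
        have pn: "pos x d t j i i' s r v \<longleftrightarrow> v = var x 0 (Suc t) j i (tab wr r j)" "neg x d t j i i' s r v \<longleftrightarrow> v = var x 3 t 0 0 r \<or> v = var x 1 t j i 0" for v
          using 6 ok by (simp_all add: pos_def neg_def)
        note t = 6(2)
        have s': "tab wr r j < B x"
          using 6 en_bounds(3)[OF 6(3,4)] B by (simp add: tab_def)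
        have dis: "\<not> tr 3 t 0 0 r \<or> \<not> tr 1 t j i 0 \<or> tr 0 (Suc t) j i (tab wr r j)"
          using 6 step(1)[OF 6(4), of z t] by (auto simp: tr_def tab_def)
        show ?thesis
          by (insert dis, (elim disjE; (drule refuted | drule satisfied)))
            (use b c t s' in \<open>simp_all add: pn var_inject\<close>)
      next
        case 7
        have pn: "pos x d t j i i' s r v \<longleftrightarrow> v = var x 1 (Suc t) j (i + tab mv r j - 1) 0" "neg x d t j i i' s r v \<longleftrightarrow> v = var x 3 t 0 0 r \<or> v = var x 1 t j i 0" for v
          using 7 ok by (simp_all add: pos_def neg_def)
        note t = 7(2)
        have m: "tab mv r j \<le> 2"
          using mv_le by (simp add: tab_def)
        then have s': "i + tab mv r j - 1 < B x"
          using 7(5) B by linarith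
        have "tr 1 (Suc t) j (i + tab mv r j - 1) 0" if "tr 3 t 0 0 r" "tr 1 t j i 0"
        proof -
          have h: "head z t j = int i - int (T x)" "tab mv r j = mv (reads z t) j"
            using that 7 by (simp_all add: tr_def tab_def)
          \<comment> \<open>Before time \<open>T x\<close> no head has reached the leftmost cell of
            the window, so the truncated subtraction in the new position is exact.\<close>
          then have "i > 0"
            using head_bound[OF 7(4), of z t] 7(2) by linarith
          then have "head z (Suc t) j = int (i + tab mv r j - 1) - int (T x)"
            using step(2)[OF 7(4), of z t] h m by linarith
          then show ?thesis
            by (simp add: tr_def)
        qed
        then have dis: "\<not> tr 3 t 0 0 r \<or> \<not> tr 1 t j i 0 \<or> tr 1 (Suc t) j (i + tab mv r j - 1) 0"
          by metis
        show ?thesis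
          by (insert dis, (elim disjE; (drule refuted | drule satisfied)))
            (use b c t s' in \<open>simp_all add: pn var_inject\<close>)
      next
        case 8
        have pn: "pos x d t j i i' s r v \<longleftrightarrow> v = var x 0 (Suc t) j i s" "neg x d t j i i' s r v \<longleftrightarrow> v = var x 1 t j i' 0 \<or> v = var x 0 t j i s" for v
          using 8 ok by (simp_all add: pos_def neg_def)
        note t = 8(2)
        have dis: "\<not> tr 1 t j i' 0 \<or> \<not> tr 0 t j i s \<or> tr 0 (Suc t) j i s"
          using 8 step(1)[OF 8(3), of z t] by (auto simp: tr_def)
        show ?thesis
          by (insert dis, (elim disjE; (drule refuted | drule satisfied)))
            (use b c t in \<open>simp_all add: pn var_inject\<close>)
      next
        case 9
        have "cell z (T x) 1 0 = 2"
          using u conf_final[OF T_ge(2), of z x] by (simp add: z_def U_def bit_symbol_def)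
        then have "\<not> tr 0 (T x) 1 (T x) 1"
          by (simp add: tr_def)
        then show ?thesis
          by (rule refuted) (use 9 ok b c in \<open>simp_all add: pos_def neg_def\<close>)
      qed
    qed
  qed
  then show ?thesis
    by blast
qed

lemma cnf_verifier: "cnf (B x ^ 5) (B x ^ 7) (lit x)"
proof
  have "B x > 0"
    using B_gt(1)[of x] by simp
  then show "B x ^ 5 > 0" "B x ^ 7 > 0"
    by simp_all
  have "\<forall>c<B x ^ 7. \<exists>v<B x ^ 5. lit x c v = 1 \<or> lit x c v = 2"
    unfolding all_digits[of x "\<lambda>l. \<exists>v<B x ^ 5. l v = 1 \<or> l v = 2"] by (intro allI impI clause_nonempty)
  then show "c < B x ^ 7 \<Longrightarrow> \<exists>v<B x ^ 5. lit x c v = 1 \<or> lit x c v = 2" for c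
    by blast
qed

lemma satisfiable_iff:
  "(\<exists>a. \<forall>c<B x ^ 7. cnf.satisfies (B x ^ 5) (lit x) a c) \<longleftrightarrow>
    (\<exists>u. length u \<le> P x \<and> pair_word x u \<in> V)"
proof -
  have "cnf.satisfies (B x ^ 5) (lit x) a c \<longleftrightarrow> clause x a (lit x c)" for a c
    unfolding cnf.satisfies_def[OF cnf_verifier] clause_def ..
  then show ?thesis
    using clauses_sound[of x] clauses_complete[of _ x] all_digits[of x "clause x a" for a] by metis
qed


section \<open>Definability of the clauses\<close>

lemma pexp_P: "pexp (\<lambda>x \<sigma>. P x)"
  unfolding P_def by (intro pexp_intros)

lemma pexp_U: "pexp (\<lambda>x \<sigma>. U x)"
  unfolding U_def by (intro pexp_intros)

lemma pexp_T: "pexp (\<lambda>x \<sigma>. T x)"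
  unfolding T_def by (intro pexp_intros pexp_U pexp_P)

lemma pexp_B: "pexp (\<lambda>x \<sigma>. B x)"
  unfolding B_def by (intro pexp_intros pexp_T)

lemma pexp_tab: "pexp R \<Longrightarrow> pexp J \<Longrightarrow> pexp (\<lambda>x \<sigma>. tab f (R x \<sigma>) (J x \<sigma>))"
  unfolding tab_def by (rule pexp_table2)

lemma ppred_cert: "pexp I \<Longrightarrow> ppred (\<lambda>x \<sigma>. cert x (I x \<sigma>))"
  unfolding cert_def by (intro pexp_intros pexp_U pexp_P pexp_T)

lemma pexp_isym: "pexp J \<Longrightarrow> pexp I \<Longrightarrow> pexp (\<lambda>x \<sigma>. isym x (J x \<sigma>) (I x \<sigma>))"
  unfolding isym_def by (intro pexp_intros pexp_T)

lemma pexp_var_code: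
  "pexp D \<Longrightarrow> pexp R \<Longrightarrow> pexp J \<Longrightarrow> pexp I \<Longrightarrow> pexp S \<Longrightarrow>
    pexp (\<lambda>x \<sigma>. var x (D x \<sigma>) (R x \<sigma>) (J x \<sigma>) (I x \<sigma>) (S x \<sigma>))"
  unfolding var_def by (intro pexp_intros pexp_B)

lemma pexp_lit: "pexp (\<lambda>x \<sigma>. lit x (\<sigma> 0) (\<sigma> 1))"
proof -
  have "pexp (\<lambda>x \<sigma>. litd x (\<sigma> 0) (\<sigma> 1) (\<sigma> 2) (\<sigma> 3) (\<sigma> 4) (\<sigma> 5) (\<sigma> 6) (\<sigma> 7))"
    unfolding litd_def pos_def neg_def ok_def
    by (intro pexp_var_code pexp_tab ppred_cert pexp_isym pexp_T pexp_intros)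
  \<comment> \<open>Variables 0 to 5 become the six lower digits of the clause number, 6 the
    quotient that remains, and 7 the number of the propositional variable.\<close>
  then have "pexp (\<lambda>x \<sigma>. (\<lambda>\<sigma>. litd x (\<sigma> 0) (\<sigma> 1) (\<sigma> 2) (\<sigma> 3) (\<sigma> 4) (\<sigma> 5) (\<sigma> 6) (\<sigma> 7))
      (\<lambda>i. if i = 7 then \<sigma> 1 else if i = 6 then (((\<lambda>c. c div B x) ^^ 6) (\<sigma> 0))
        else (((\<lambda>c. c div B x) ^^ i) (\<sigma> 0)) mod B x))"
  proof (rule pexp_subst)
    have div: "pexp (\<lambda>x \<sigma>. ((\<lambda>c. c div B x) ^^ i) (\<sigma> 0))" for i
      by (induction i) (simp_all add: pexp_var pexp_div pexp_B)
    show "pexp (\<lambda>x \<sigma>. if i = 7 then \<sigma> 1 else if i = 6 then (((\<lambda>c. c div B x) ^^ 6) (\<sigma> 0))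
        else (((\<lambda>c. c div B x) ^^ i) (\<sigma> 0)) mod B x)" for i
      by (intro pexp_intros div pexp_B)
  qed
  then show ?thesis
    unfolding lit_def by (simp add: numeral_eq_Suc)
qed

theorem poly_reducible_verifier:
  assumes "\<And>x. x \<in> A \<longleftrightarrow> (\<exists>u. length u \<le> poly p (length x) \<and> pair_word x u \<in> V)"
  shows "poly_reducible A (connected_oct_language is_line_graph)"
proof (rule poly_reducible_cnf)
  show "pexp (\<lambda>x \<sigma>. B x ^ 5)" "pexp (\<lambda>x \<sigma>. B x ^ 7)"
    by (intro pexp_intros pexp_B)+
  show "pexp (\<lambda>x \<sigma>. lit x (\<sigma> 0) (\<sigma> 1))"
    by (rule pexp_lit)
  show "cnf (B x ^ 5) (B x ^ 7) (lit x)" for x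
    by (rule cnf_verifier)
  show "x \<in> A \<longleftrightarrow> (\<exists>a. \<forall>c<B x ^ 7. cnf.satisfies (B x ^ 5) (lit x) a c)" for x
    using assms satisfiable_iff by (simp add: P_def)
qed

end

theorem NP_hard:
  assumes "A \<in> complexity_NP"
  shows "poly_reducible A (connected_oct_language is_line_graph)"
proof -
  obtain V and p :: "nat poly" where V: "V \<in> complexity_P"
    and A: "\<And>x. x \<in> A \<longleftrightarrow> (\<exists>u. length u \<le> poly p (length x) \<and> pair_word x u \<in> V)"
    using assms unfolding complexity_NP_def by blast
  obtain M and q :: "nat poly" where M: "wf_tm M" "computes_within M (\<lambda>z. [z \<in> V]) (poly q)"
    using V unfolding complexity_P_def polytime_def by blast
  let ?S = "{ss. length ss = Suc (num_tapes M) \<and> (\<forall>j<num_tapes M. ss ! j < num_symbols M) \<and>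
      ss ! num_tapes M \<le> num_states M}"
  \<comment> \<open>One bound for tape symbols and states alike embeds the tuples into words of
    fixed length over a finite alphabet.\<close>
  have "?S \<subseteq> {ss. set ss \<subseteq> {..num_symbols M + num_states M} \<and> length ss = Suc (num_tapes M)}"
    by (auto simp: in_set_conv_nth less_Suc_eq) (meson le_add1 less_imp_le_nat order_trans)
  then have "finite ?S"
    by (rule finite_subset) (simp add: finite_lists_length_eq)
  from finite_imp_nat_seg_image_inj_on[OF this] obtain en and Nt :: nat where "?S = en ` {i. i < Nt}"
    by (elim exE conjE)
  then have "en ` {..<Nt} = ?S"
    by (simp only: lessThan_def)
  then interpret verifier M V p q en Nt
    using M by unfold_locales
  show ?thesis
    using A by (rule poly_reducible_verifier)
qed

section \<open>Membership in NP\<close>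

text \<open>The certificate consists of a transversal \<open>S\<close>, a colouring of the remaining vertices, the
  relations \<open>R r\<close> of reachability within \<open>S\<close> in at most \<open>r\<close> steps, and the incidence relation \<open>I\<close>
  of a root graph, whose vertices can be taken to be numbers below \<open>2 * n\<close>.\<close>

definition check ::
  "nat \<Rightarrow> (nat \<Rightarrow> nat \<Rightarrow> bool) \<Rightarrow> (nat \<Rightarrow> bool) \<Rightarrow> (nat \<Rightarrow> bool) \<Rightarrow> (nat \<Rightarrow> nat \<Rightarrow> nat \<Rightarrow> bool) \<Rightarrow>
    (nat \<Rightarrow> nat \<Rightarrow> bool) \<Rightarrow> bool" where
  "check n adj S col R I \<longleftrightarrow>
     (\<forall>v<n. \<forall>w<n. \<not> S v \<and> \<not> S w \<and> adj v w \<longrightarrow> (col v \<longleftrightarrow> \<not> col w)) \<and>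
     (\<forall>v<n. \<forall>w<n. R 0 v w \<longrightarrow> v = w) \<and>
     (\<forall>r<n * n. \<forall>v<n. \<forall>w<n. R (Suc r) v w \<longrightarrow>
        (\<exists>t<n. R r v t \<and> (t = w \<or> S t \<and> S w \<and> adj t w))) \<and>
     (\<forall>v<n. \<forall>w<n. S v \<and> S w \<longrightarrow> R (n * n) v w) \<and>
     (\<forall>v<n. (\<Sum>a<2 * n. of_bool (I v a)) = (2 :: nat)) \<and>
     (\<forall>v<n. \<forall>w<n. v \<noteq> w \<longrightarrow> (\<exists>a<2 * n. I v a \<longleftrightarrow> \<not> I w a)) \<and>
     (\<forall>v<n. \<forall>w<n. adj v w \<longleftrightarrow> v \<noteq> w \<and> (\<exists>a<2 * n. I v a \<and> I w a))"

lemma check_cong: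
  assumes adj: "\<And>v w. v < n \<Longrightarrow> w < n \<Longrightarrow> adj' v w \<longleftrightarrow> adj v w"
    and S: "\<And>v. v < n \<Longrightarrow> S' v \<longleftrightarrow> S v" "\<And>v. v < n \<Longrightarrow> col' v \<longleftrightarrow> col v"
    and R: "\<And>r v w. r \<le> n * n \<Longrightarrow> v < n \<Longrightarrow> w < n \<Longrightarrow> R' r v w \<longleftrightarrow> R r v w"
    and I: "\<And>v a. v < n \<Longrightarrow> a < 2 * n \<Longrightarrow> I' v a \<longleftrightarrow> I v a"
  shows "check n adj' S' col' R' I' \<longleftrightarrow> check n adj S col R I"
proof -
  have "(\<Sum>a<2 * n. of_bool (I' v a)) = (\<Sum>a<2 * n. of_bool (I v a) :: nat)" if "v < n" for v
    using I that by (intro sum.cong) auto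
  then show ?thesis
    unfolding check_def by (simp add: adj S R I cong: conj_cong del: sum_of_bool_eq)
qed

definition adj_edges :: "nat \<Rightarrow> (nat \<Rightarrow> nat \<Rightarrow> bool) \<Rightarrow> nat set set" where
  "adj_edges n adj = {{v, w} | v w. v < n \<and> w < n \<and> adj v w}"

text \<open>The conditions bound \<open>R\<close> from above by reachability, level by level; only
  the last level is required to contain all pairs of \<open>S\<close>. The columns \<open>a\<close>
  with \<open>I v a\<close> are the two ends of the root edge \<open>v\<close>.\<close>

lemma check_sound:
  assumes "check n adj S col R I"
  defines "E \<equiv> adj_edges n adj"
  shows "simple_graph \<lparr>verts = {..<n}, edges = E\<rparr>" "is_line_graph \<lparr>verts = {..<n}, edges = E\<rparr>"
    "connected_oct \<lparr>verts = {..<n}, edges = E\<rparr> {v. v < n \<and> S v}"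
    "\<And>v w. v < n \<Longrightarrow> w < n \<Longrightarrow> {v, w} \<in> E \<longleftrightarrow> adj v w"
proof -
  have c1: "v < n \<Longrightarrow> w < n \<Longrightarrow> \<not> S v \<Longrightarrow> \<not> S w \<Longrightarrow> adj v w \<Longrightarrow> col v \<noteq> col w"
    and c2: "v < n \<Longrightarrow> w < n \<Longrightarrow> R 0 v w \<Longrightarrow> v = w"
    and c3: "r < n * n \<Longrightarrow> v < n \<Longrightarrow> w < n \<Longrightarrow> R (Suc r) v w \<Longrightarrow>
      \<exists>t<n. R r v t \<and> (t = w \<or> S t \<and> S w \<and> adj t w)"
    and c4: "v < n \<Longrightarrow> w < n \<Longrightarrow> S v \<Longrightarrow> S w \<Longrightarrow> R (n * n) v w"
    and c5: "v < n \<Longrightarrow> (\<Sum>a<2 * n. of_bool (I v a)) = (2 :: nat)"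
    and c6: "v < n \<Longrightarrow> w < n \<Longrightarrow> v \<noteq> w \<Longrightarrow> \<exists>a<2 * n. I v a \<noteq> I w a"
    and c7: "v < n \<Longrightarrow> w < n \<Longrightarrow> adj v w \<longleftrightarrow> v \<noteq> w \<and> (\<exists>a<2 * n. I v a \<and> I w a)" for r v w
    using assms unfolding check_def by simp_all
  define ends where "ends v = {a. a < 2 * n \<and> I v a}" for v
  have G: "\<lparr>verts = {..<n}, edges = E\<rparr> = meet_graph {..<n} ends"
    unfolding meet_graph_def E_def adj_edges_def ends_def using c7 by fastforce
  have "card (ends v) = 2" if "v < n" for v
    using c5[OF that] by (simp add: ends_def Int_def)
  moreover have "inj_on ends {..<n}"
  proof (rule inj_onI)
    fix v w
    assume vw: "v \<in> {..<n}" "w \<in> {..<n}" "ends v = ends w"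
    then have "a < 2 * n \<Longrightarrow> I v a = I w a" for a
      unfolding ends_def by auto
    then show "v = w"
      using c6[of v w] vw by auto
  qed
  ultimately show "is_line_graph \<lparr>verts = {..<n}, edges = E\<rparr>"
    unfolding G by (intro is_line_graph_meet_graph) auto
  show simple: "simple_graph \<lparr>verts = {..<n}, edges = E\<rparr>"
    unfolding G by (simp add: simple_meet_graph)
  \<comment> \<open>Symmetry of \<open>adj\<close> comes from its description by the incidence
    relation.\<close>
  have sym: "adj v w \<longleftrightarrow> adj w v" if "v < n" "w < n" for v w
    unfolding c7[OF that] c7[OF that(2,1)] by blast
  show edge: "{v, w} \<in> E \<longleftrightarrow> adj v w" if "v < n" "w < n" for v w
    unfolding E_def adj_edges_def using that sym[OF that] by (auto simp: doubleton_eq_iff)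
  let ?S = "{v. v < n \<and> S v}"
  let ?link = "{(x, y). x \<in> ?S \<and> y \<in> ?S \<and> {x, y} \<in> E}"
  have reach: "r \<le> n * n \<Longrightarrow> v < n \<Longrightarrow> w < n \<Longrightarrow> R r v w \<Longrightarrow> (v, w) \<in> ?link\<^sup>*" for r v w
  proof (induction r arbitrary: w)
    case 0
    then show ?case
      using c2 by auto
  next
    case (Suc r)
    then obtain t where t: "t < n" "R r v t" "t = w \<or> S t \<and> S w \<and> adj t w"
      using c3[of r v w] by auto
    then have "(v, t) \<in> ?link\<^sup>*"
      using Suc by simp
    moreover have "t = w \<or> (t, w) \<in> ?link"
      using t edge[of t w] Suc.prems by auto
    ultimately show ?case
      using rtrancl.rtrancl_into_rtrancl[of v t ?link w] by blast
  qed
  have "\<forall>u\<in>{..<n} - ?S. \<forall>v\<in>{..<n} - ?S. {u, v} \<in> E \<longrightarrow> col u \<noteq> col v"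
    using c1 edge by simp
  moreover have "\<forall>u\<in>?S. \<forall>v\<in>?S. (u, v) \<in> ?link\<^sup>*"
    by (intro ballI reach[OF le_refl]) (use c4 in auto)
  moreover have "?S \<subseteq> {..<n}"
    by auto
  ultimately show "connected_oct \<lparr>verts = {..<n}, edges = E\<rparr> ?S"
    unfolding connected_oct_iff[OF simple] sgraph.simps by (intro conjI exI[of _ col])
qed

lemma check_complete:
  assumes simple: "simple_graph \<lparr>verts = {..<n}, edges = E\<rparr>"
    and line: "is_line_graph \<lparr>verts = {..<n}, edges = E\<rparr>"
    and oct: "connected_oct \<lparr>verts = {..<n}, edges = E\<rparr> S"
  shows "\<exists>col R I. check n (\<lambda>v w. {v, w} \<in> E) (\<lambda>v. v \<in> S) col R I"
proof -
  note oct' = oct[unfolded connected_oct_iff[OF simple] sgraph.simps]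
  note S = conjunct1[OF oct'] and conn = conjunct2[OF conjunct2[OF oct']]
  obtain col :: "nat \<Rightarrow> bool" where
    col: "\<forall>u\<in>{..<n} - S. \<forall>v\<in>{..<n} - S. {u, v} \<in> E \<longrightarrow> col u \<noteq> col v"
    using conjunct1[OF conjunct2[OF oct']] by (rule exE)
  let ?link = "{(x, y). x \<in> S \<and> y \<in> S \<and> {x, y} \<in> E}"
  define R where "R r v w \<longleftrightarrow> (\<exists>m\<le>r. (v, w) \<in> ?link ^^ m)" for r v w
  have R_Suc: "\<exists>t<n. R r v t \<and> (t = w \<or> t \<in> S \<and> w \<in> S \<and> {t, w} \<in> E)"
    if R: "R (Suc r) v w" "v < n" "w < n" for r v w
  proof -
    obtain m where m: "m \<le> Suc r" "(v, w) \<in> ?link ^^ m"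
      using R unfolding R_def by blast
    show ?thesis
    proof (cases "m \<le> r")
      case True
      then show ?thesis
        using m R by (auto simp: R_def)
    next
      case False
      then have "(v, w) \<in> ?link ^^ Suc r"
        using m by (simp add: le_Suc_eq)
      then obtain t where t: "(v, t) \<in> ?link ^^ r" "(t, w) \<in> ?link"
        by (rule relpow_Suc_E)
      then have "t < n" "R r v t"
        using S by (auto simp: R_def)
      then show ?thesis
        using t by blast
    qed
  qed
  have sub: "?link \<subseteq> {..<n} \<times> {..<n}"
    using S by auto
  then have fin: "finite ?link"
    by (rule finite_subset) simp
  \<comment> \<open>Reachability takes at most as many steps as the relation has pairs, whence the
    \<open>n * n\<close> rounds of \<open>R\<close>.\<close>
  have card: "card ?link \<le> n * n"
    using card_mono[OF _ sub] by simp
  have R_all: "R (n * n) v w" if vw: "v \<in> S" "w \<in> S" for v w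
  proof -
    have "(v, w) \<in> (\<Union>m\<in>{m. m \<le> card ?link}. ?link ^^ m)"
      using conn vw unfolding rtrancl_finite_eq_relpow[OF fin] by blast
    then obtain m where "m \<le> card ?link" "(v, w) \<in> ?link ^^ m"
      by blast
    then show ?thesis
      unfolding R_def using card by (meson le_trans)
  qed
  obtain H :: "nat sgraph" and f where H: "simple_graph H" and bij: "bij_betw f {..<n} (edges H)"
    and f: "\<And>v w. v < n \<Longrightarrow> w < n \<Longrightarrow> {v, w} \<in> E \<longleftrightarrow> {f v, f w} \<in> edges (line_graph H)"
    using line unfolding is_line_graph_def graph_iso_def by (auto simp: line_graph_def)
  have line: "line_graph H = meet_graph (edges H) (\<lambda>e. e)"
    by (simp add: line_graph_def meet_graph_def)
  have fE: "f v \<in> edges H" "card (f v) = 2" if "v < n" for v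
    using bij that H by (auto simp: bij_betw_def simple_graph_def)
  have fin_f: "finite (f v)" if "v < n" for v
    using fE(2)[OF that] by (intro card_ge_0_finite) simp
  \<comment> \<open>The \<open>n\<close> root edges have at most \<open>2 * n\<close> ends, which
    can therefore be renumbered; isolated vertices of the root disappear.\<close>
  have "card (\<Union> (f ` {..<n})) \<le> (\<Sum>v<n. card (f v))"
    by (rule card_UN_le) simp
  also have "\<dots> = 2 * n"
    using fE by simp
  finally have "card (\<Union> (f ` {..<n})) \<le> card {..<2 * n}"
    by simp
  moreover have "finite (\<Union> (f ` {..<n}))"
    using fin_f by blast
  ultimately obtain g where g: "inj_on g (\<Union> (f ` {..<n}))" "g ` \<Union> (f ` {..<n}) \<subseteq> {..<2 * n}"
    using inj_on_iff_card_le[of "\<Union> (f ` {..<n})" "{..<2 * n}"] by auto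
  define I where "I v a \<longleftrightarrow> a \<in> g ` f v" for v a
  have sub: "f v \<subseteq> \<Union> (f ` {..<n})" "g ` f v \<subseteq> {..<2 * n}" if "v < n" for v
    using that g(2) by blast+
  have "(\<Sum>a<2 * n. of_bool (I v a)) = (2 :: nat)" if v: "v < n" for v
  proof -
    have "{..<2 * n} \<inter> {a. I v a} = g ` f v"
      using sub[OF v] by (auto simp: I_def)
    then show ?thesis
      using fE(2)[OF v] card_image[OF inj_on_subset[OF g(1) sub(1)[OF v]]] by simp
  qed
  moreover have "\<exists>a<2 * n. I v a \<longleftrightarrow> \<not> I w a" if vw: "v < n" "w < n" "v \<noteq> w" for v w
  proof -
    have "f v \<noteq> f w"
      using bij vw by (auto simp: bij_betw_def inj_on_def)
    then have "g ` f v \<noteq> g ` f w"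
      using inj_on_image_eq_iff[OF g(1) sub(1) sub(1)] vw by blast
    then show ?thesis
      using sub[OF vw(1)] sub[OF vw(2)] unfolding I_def by blast
  qed
  moreover have "{v, w} \<in> E \<longleftrightarrow> v \<noteq> w \<and> (\<exists>a<2 * n. I v a \<and> I w a)" if vw: "v < n" "w < n" for v w
  proof -
    have "{v, w} \<in> E \<longleftrightarrow> f v \<noteq> f w \<and> f v \<inter> f w \<noteq> {}"
      using vw fE(1) by (simp add: f line)
    also have "f v \<noteq> f w \<longleftrightarrow> v \<noteq> w"
      using bij vw by (auto simp: bij_betw_def inj_on_def)
    also have "f v \<inter> f w \<noteq> {} \<longleftrightarrow> g ` f v \<inter> g ` f w \<noteq> {}"
      using inj_on_image_Int[OF g(1) sub(1)[OF vw(1)] sub(1)[OF vw(2)]] by (metis image_is_empty)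
    also have "\<dots> \<longleftrightarrow> (\<exists>a<2 * n. I v a \<and> I w a)"
      using sub[OF vw(1)] unfolding I_def by blast
    finally show ?thesis .
  qed
  moreover have "R 0 v w \<longrightarrow> v = w" for v w
    by (simp add: R_def)
  ultimately have "check n (\<lambda>v w. {v, w} \<in> E) (\<lambda>v. v \<in> S) col R I"
    unfolding check_def using R_Suc R_all col by simp
  then show ?thesis
    by blast
qed

text \<open>The length of the initial run of true values, written as a bounded sum. It decodes the
  unary number of vertices and the flags of a pair.\<close>

definition prefix_ones :: "nat \<Rightarrow> (nat \<Rightarrow> bool) \<Rightarrow> nat" where
  "prefix_ones m b = (\<Sum>i<m. of_bool (\<forall>j<Suc i. b j))"

lemma prefix_ones_eq:
  assumes "n \<le> m" "\<And>j. j < n \<Longrightarrow> b j" "n < m \<Longrightarrow> \<not> b n"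
  shows "prefix_ones m b = n"
proof -
  have "{..<m} \<inter> {i. \<forall>j<Suc i. b j} = {..<n}"
  proof (intro set_eqI iffI)
    fix i
    assume i: "i \<in> {..<m} \<inter> {i. \<forall>j<Suc i. b j}"
    show "i \<in> {..<n}"
    proof (rule ccontr)
      assume "i \<notin> {..<n}"
      then have "n < Suc i" "n < m"
        using i by auto
      then show False
        using i assms(3) by blast
    qed
  qed (use assms in auto)
  then have "card ({..<m} \<inter> {i. \<forall>j<Suc i. b j}) = n"
    by simp
  then show ?thesis
    unfolding prefix_ones_def by simp
qed

lemma prefix_ones_prefix: "j < prefix_ones m b \<Longrightarrow> b j" "prefix_ones m b \<le> m"
  "prefix_ones m b < m \<Longrightarrow> \<not> b (prefix_ones m b)"
proof -
  define n where "n = (LEAST n. n = m \<or> \<not> b n)"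
  have 1: "n = m \<or> \<not> b n"
    unfolding n_def by (rule LeastI[of _ m]) simp
  have 2: "n \<le> m"
    unfolding n_def by (rule Least_le) simp
  have 3: "b j" if "j < n" for j
    using not_less_Least[OF that[unfolded n_def]] by simp
  have "prefix_ones m b = n"
    using 1 2 3 by (intro prefix_ones_eq) auto
  then show "j < prefix_ones m b \<Longrightarrow> b j" "prefix_ones m b \<le> m"
    "prefix_ones m b < m \<Longrightarrow> \<not> b (prefix_ones m b)"
    using 1 2 3 by auto
qed

text \<open>\<open>verify m X U\<close> checks the certificate \<open>U\<close> for a word with \<open>m\<close> bits \<open>X\<close>. The bound \<open>k\<close> may be
  exponential in \<open>m\<close>, and therefore the size \<open>s\<close> of the transversal is compared with it by
  excluding that the last part of the word represents a number below \<open>s\<close>.\<close>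

definition verify_at :: "nat \<Rightarrow> nat \<Rightarrow> nat \<Rightarrow> (nat \<Rightarrow> bool) \<Rightarrow> (nat \<Rightarrow> bool) \<Rightarrow> bool" where
  "verify_at n m s X U \<longleftrightarrow> n < m \<and> n + 1 + n * n \<le> m \<and> (m = n + 1 + n * n \<or> X (m - 1)) \<and>
     check n (\<lambda>v w. X (n + 1 + (v * n + w))) (\<lambda>v. U (4 * v)) (\<lambda>v. U (4 * v + 1))
       (\<lambda>r v w. U (4 * ((r * n + v) * n + w) + 2)) (\<lambda>v a. U (4 * (v * (2 * n) + a) + 3)) \<and>
     (\<forall>l<s. \<not> (length (nat_bits l) = m - (n + 1 + n * n) \<and>
        (\<forall>i<m - (n + 1 + n * n). nat_bit l i \<longleftrightarrow> X (n + 1 + n * n + i))))"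

definition verify :: "nat \<Rightarrow> (nat \<Rightarrow> bool) \<Rightarrow> (nat \<Rightarrow> bool) \<Rightarrow> bool" where
  "verify m X U \<longleftrightarrow> verify_at (prefix_ones m X) m (\<Sum>v<prefix_ones m X. of_bool (U (4 * v))) X U"

section \<open>Correctness of the certificate check\<close>

lemma eq_nat_bits_iff: "ys = nat_bits l \<longleftrightarrow> length (nat_bits l) = length ys \<and> (\<forall>i<length ys. nat_bit l i \<longleftrightarrow> ys ! i)"
  by (auto simp: nat_bit_def list_eq_iff_nth_eq)

lemma verify_sound:
  assumes "verify (length x) (bit_at x) U"
  shows "x \<in> connected_oct_language is_line_graph"
proof -
  define n where "n = prefix_ones (length x) (bit_at x)"
  define o' where "o' = n + 1 + n * n"
  define adj where "adj v w = bit_at x (n + 1 + (v * n + w))" for v w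
  define S where "S v = U (4 * v)" for v
  define E where "E = adj_edges n adj"
  have v: "n < length x" "o' \<le> length x" "length x = o' \<or> bit_at x (length x - 1)"
    and ch: "\<exists>col R I. check n adj S col R I"
    and small: "\<And>l. l < (\<Sum>v<n. of_bool (S v)) \<Longrightarrow> \<not> (length (nat_bits l) = length x - o' \<and>
        (\<forall>i<length x - o'. nat_bit l i \<longleftrightarrow> bit_at x (o' + i)))"
    using assms unfolding verify_def verify_at_def n_def[symmetric] adj_def[abs_def, symmetric] S_def[abs_def]
      o'_def by auto
  obtain col R I where "check n adj S col R I"
    using ch by blast
  note c = check_sound[OF this, folded E_def]
  define ys where "ys = drop o' x"
  \<comment> \<open>The check that a nonempty last part ends in True makes it the code of a
    number.\<close>
  have "ys = [] \<or> last ys"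
  proof (cases "length x = o'")
    case False
    then have "last ys = last x" "x \<noteq> []"
      using v(1,2) by (auto simp: ys_def last_drop)
    then show ?thesis
      using v(3) False by (simp add: last_conv_nth bit_at_def)
  qed (simp add: ys_def)
  then obtain k where k: "nat_bits k = ys"
    using nat_bits_canonical by blast
  have "x = encode_instance n E k"
  proof (rule nth_equalityI)
    have len: "instance_length n k = length x"
      using v(2) by (simp add: instance_length_def k ys_def o'_def)
    have enc: "encode_instance n E k = map (instance_bit n adj k) [0..<length x]"
      unfolding len[symmetric] using c(4) by (intro encode_instance_eq_map) auto
    show "length x = length (encode_instance n E k)"
      by (simp add: enc)
    fix i
    assume i: "i < length x"
    have "instance_bit n adj k i \<longleftrightarrow> bit_at x i"
    proof -
      consider "i < n" | "i = n" | "n < i" "i < o'" | "o' \<le> i"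
        by linarith
      then show ?thesis
      proof cases
        case 1
        then show ?thesis
          using prefix_ones_prefix(1)[of i "length x" "bit_at x"] by (simp add: instance_bit_def n_def)
      next
        case 2
        then show ?thesis
          using prefix_ones_prefix(3)[of "length x" "bit_at x"] v(1) by (simp add: instance_bit_def n_def)
      next
        case 3
        then have "n + 1 + ((i - (n + 1)) div n * n + (i - (n + 1)) mod n) = i"
          by simp
        then show ?thesis
          using 3 by (simp add: instance_bit_def adj_def o'_def)
      next
        case 4
        then have "\<not> i < n" "i \<noteq> n" "\<not> i < n + 1 + n * n"
          by (auto simp: o'_def)
        then have "instance_bit n adj k i \<longleftrightarrow> nat_bit k (i - o')"
          by (simp add: instance_bit_def o'_def)
        moreover have "i - o' < length x - o'"
          using 4 i by simp
        ultimately show ?thesis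
          using 4 i by (simp add: nat_bit_def k ys_def bit_at_def)
      qed
    qed
    then show "x ! i = encode_instance n E k ! i"
      using i by (simp add: enc bit_at_def)
  qed
  \<comment> \<open>Otherwise \<open>k\<close> itself would be one of the numbers \<open>l\<close>
    that the verifier has excluded.\<close>
  moreover have "card {v. v < n \<and> S v} \<le> k"
  proof (rule ccontr)
    assume "\<not> card {v. v < n \<and> S v} \<le> k"
    then have "k < (\<Sum>v<n. of_bool (S v))"
      by (simp add: Int_def)
    moreover have "length ys = length x - o'" "\<forall>i<length x - o'. ys ! i \<longleftrightarrow> bit_at x (o' + i)"
      using v(2) by (auto simp: ys_def bit_at_def)
    ultimately show False
      using small[of k] eq_nat_bits_iff[of ys k] k by auto
  qed
  ultimately show ?thesis
    using encode_instance_in_language[OF c(1)] c(2,3) by blast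
qed

lemma verify_complete:
  assumes "x \<in> connected_oct_language is_line_graph"
  shows "\<exists>U. verify (length x) (bit_at x) U"
proof -
  obtain n E k S where x: "x = encode_instance n E k" and simple: "simple_graph \<lparr>verts = {..<n}, edges = E\<rparr>"
    and line: "is_line_graph \<lparr>verts = {..<n}, edges = E\<rparr>"
    and oct: "connected_oct \<lparr>verts = {..<n}, edges = E\<rparr> S" and card: "card S \<le> k"
    using assms unfolding connected_oct_language_def by blast
  obtain col R I where ch: "check n (\<lambda>v w. {v, w} \<in> E) (\<lambda>v. v \<in> S) col R I"
    using check_complete[OF simple line oct] by blast
  have S: "S \<subseteq> {..<n}"
    using oct by (simp add: connected_oct_def odd_cycle_transversal_def)
  define adj where "adj v w \<longleftrightarrow> {v, w} \<in> E" for v w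
  have enc: "x = map (instance_bit n adj k) [0..<instance_length n k]"
    unfolding x by (rule encode_instance_eq_map) (simp add: adj_def)
  have len: "length x = n + 1 + n * n + length (nat_bits k)"
    by (simp add: enc instance_length_def)
  have bit: "bit_at x i \<longleftrightarrow> instance_bit n adj k i" if "i < length x" for i
    using that unfolding bit_at_def enc by simp
  have tail: "bit_at x (n + 1 + n * n + i) \<longleftrightarrow> nat_bits k ! i" if "i < length (nat_bits k)" for i
  proof -
    have "\<not> n + 1 + n * n + i < n" "n + 1 + n * n + i \<noteq> n" "\<not> n + 1 + n * n + i < n + 1 + n * n"
      by auto
    then show ?thesis
      using that len by (subst bit) (simp_all add: instance_bit_def nat_bit_def)
  qed
  have n: "prefix_ones (length x) (bit_at x) = n"
    by (rule prefix_ones_eq) (use len bit in \<open>simp_all add: instance_bit_def\<close>)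
  \<comment> \<open>Inverse to the indexing in \<open>verify_at\<close>: the residue modulo 4
    selects a part of the certificate, and the quotient packs the arguments.\<close>
  define U where "U i = (if i mod 4 = 0 then i div 4 \<in> S else if i mod 4 = 1 then col (i div 4)
      else if i mod 4 = 2 then R (i div 4 div n div n) (i div 4 div n mod n) (i div 4 mod n)
      else I (i div 4 div (2 * n)) (i div 4 mod (2 * n)))" for i
  have mod4: "(4 * i) mod 4 = 0" "(4 * i) div 4 = i" "(4 * i + 1) mod 4 = 1" "(4 * i + 1) div 4 = i"
    "(4 * i + 2) mod 4 = 2" "(4 * i + 2) div 4 = i" "(4 * i + 3) mod 4 = 3" "(4 * i + 3) div 4 = i" for i :: nat
    by presburger+
  have U: "U (4 * v) \<longleftrightarrow> v \<in> S" "U (4 * v + 1) \<longleftrightarrow> col v" for v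
    unfolding U_def mod4 by simp_all
  have UR: "U (4 * ((r * n + v) * n + w) + 2) \<longleftrightarrow> R r v w" if "v < n" "w < n" for r v w
    unfolding U_def mod4 using that by simp
  have UI: "U (4 * (v * (2 * n) + a) + 3) \<longleftrightarrow> I v a" if "a < 2 * n" for v a
    unfolding U_def mod4 using that by simp
  have XA: "bit_at x (n + 1 + (v * n + w)) \<longleftrightarrow> {v, w} \<in> E" if "v < n" "w < n" for v w
  proof -
    have "v * n + w < n * n"
      using that mult_le_mono1[of "Suc v" n n] by simp
    then show ?thesis
      using that len by (subst bit) (simp_all add: instance_bit_def adj_def)
  qed
  have "check n (\<lambda>v w. bit_at x (n + 1 + (v * n + w))) (\<lambda>v. U (4 * v)) (\<lambda>v. U (4 * v + 1))
       (\<lambda>r v w. U (4 * ((r * n + v) * n + w) + 2)) (\<lambda>v a. U (4 * (v * (2 * n) + a) + 3))"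
    using ch by (subst check_cong[where adj = "\<lambda>v w. {v, w} \<in> E" and S = "\<lambda>v. v \<in> S" and col = col and R = R and I = I])
      (rule XA U UR UI; assumption)+
  moreover have "\<not> (length (nat_bits l) = length x - (n + 1 + n * n) \<and>
      (\<forall>i<length x - (n + 1 + n * n). nat_bit l i \<longleftrightarrow> bit_at x (n + 1 + n * n + i)))"
    if l: "l < (\<Sum>v<n. of_bool (U (4 * v)))" for l
  proof
    assume "length (nat_bits l) = length x - (n + 1 + n * n) \<and>
      (\<forall>i<length x - (n + 1 + n * n). nat_bit l i \<longleftrightarrow> bit_at x (n + 1 + n * n + i))"
    then have "nat_bits k = nat_bits l"
      unfolding eq_nat_bits_iff using tail len by simp
    then have "l = k"
      by (simp add: nat_bits_inject)
    moreover have "(\<Sum>v<n. of_bool (U (4 * v))) = card S"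
      unfolding U using S by (simp add: Int_absorb1)
    ultimately show False
      using l card by simp
  qed
  moreover have "length x = n + 1 + n * n \<or> bit_at x (length x - 1)"
  proof (cases "nat_bits k = []")
    case False
    then have "nat_bits k ! (length (nat_bits k) - 1)"
      using last_nat_bits[of k] by (simp add: last_conv_nth)
    moreover have "length x - 1 = n + 1 + n * n + (length (nat_bits k) - 1)"
      using len False by (cases "nat_bits k") auto
    ultimately show ?thesis
      using tail[of "length (nat_bits k) - 1"] False by simp
  qed (use len in simp)
  ultimately have "verify (length x) (bit_at x) U"
    unfolding verify_def verify_at_def n using len by auto
  then show ?thesis
    by blast
qed

text \<open>The flags are at the even positions, and the first one that is not True ends the first
  component.\<close>

definition fst_len :: "bool list \<Rightarrow> nat" where
  "fst_len z = prefix_ones (length z) (\<lambda>i. bit_at z (2 * i))"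

definition fst_bit :: "bool list \<Rightarrow> nat \<Rightarrow> bool" where
  "fst_bit z i \<longleftrightarrow> i < fst_len z \<and> bit_at z (2 * i + 1)"

definition snd_bit :: "bool list \<Rightarrow> nat \<Rightarrow> bool" where
  "snd_bit z i \<longleftrightarrow> bit_at z (2 * fst_len z + 1 + i)"

lemma fst_len_pair_word [simp]: "fst_len (pair_word x u) = length x"
  unfolding fst_len_def by (rule prefix_ones_eq) (auto simp: bit_at_def pair_word_nth)

lemma fst_bit_pair_word [simp]: "fst_bit (pair_word x u) = bit_at x"
  by (auto simp: fst_bit_def bit_at_def pair_word_nth fun_eq_iff)

lemma snd_bit_pair_word [simp]: "snd_bit (pair_word x u) = bit_at u"
  by (auto simp: snd_bit_def bit_at_def pair_word_nth fun_eq_iff)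

section \<open>The certificate check in polynomial time\<close>

lemma pexp_fst_len: "pexp (\<lambda>z \<sigma>. fst_len z)"
  unfolding fst_len_def prefix_ones_def by (intro pexp_intros)

lemma ppred_fst_bit: "pexp A \<Longrightarrow> ppred (\<lambda>z \<sigma>. fst_bit z (A z \<sigma>))"
  unfolding fst_bit_def by (intro pexp_intros pexp_fst_len)

lemma ppred_snd_bit: "pexp A \<Longrightarrow> ppred (\<lambda>z \<sigma>. snd_bit z (A z \<sigma>))"
  unfolding snd_bit_def by (intro pexp_intros pexp_fst_len)

lemma polytime_verify: "polytime (\<lambda>z. [verify (fst_len z) (fst_bit z) (snd_bit z)])"
proof -
  have n: "pexp (\<lambda>z \<sigma>. prefix_ones (fst_len z) (fst_bit z))"
    unfolding prefix_ones_def by (intro pexp_intros pexp_fst_len ppred_fst_bit)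
  \<comment> \<open>The three numbers are variables here, so that they are definable bounds of the
    quantifiers; \<open>ppred_app3\<close> replaces them by their values.\<close>
  have "ppred (\<lambda>z \<sigma>. verify_at (\<sigma> 0) (\<sigma> 1) (\<sigma> 2) (fst_bit z) (snd_bit z))"
    unfolding verify_at_def check_def by (intro pexp_intros ppred_fst_bit ppred_snd_bit)
  then have "ppred (\<lambda>z \<sigma>. verify (fst_len z) (fst_bit z) (snd_bit z))"
    unfolding verify_def
    by (rule ppred_app3) (intro n pexp_fst_len ppred_snd_bit pexp_intros)+
  then have "polytime (\<lambda>z. map (\<lambda>i. verify (fst_len z) (fst_bit z) (snd_bit z)) [0..<1])"
    by (intro polytime_pexp pexp_intros)
  then show ?thesis
    by simp
qed

text \<open>Transversal and colouring use indices below \<open>n\<close>, reachability indices below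
  \<open>(n * n + 1) * n * n\<close> and incidences below \<open>2 * n * n\<close>, each spread by
  the factor 4, and \<open>n \<le> m\<close>. So certificates can be cut to polynomial
  length.\<close>

lemma verify_cong:
  assumes v: "verify m X U"
    and U: "\<And>i. i < 4 * ((m * m + 1) * m * m + 2 * m * m + m + 1) \<Longrightarrow> U' i \<longleftrightarrow> U i"
  shows "verify m X U'"
proof -
  define n where "n = prefix_ones m X"
  have n: "n \<le> m"
    unfolding n_def by (rule prefix_ones_prefix(2))
  have le: "i < 4 * ((m * m + 1) * m * m + 2 * m * m + m + 1)"
    if "i < 4 * j + 4" "j < (n * n + 1) * n * n \<or> j < n \<or> j < n * (2 * n)" for i j
  proof -
    have "(n * n + 1) * n * n \<le> (m * m + 1) * m * m" "n * (2 * n) \<le> 2 * m * m"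
      using n by (auto intro!: mult_le_mono add_mono)
    then have "j < (m * m + 1) * m * m + 2 * m * m + m"
      using that(2) n by linarith
    moreover have "i < 4 * (q + 1)" if "j < q" "i < 4 * j + 4" for q :: nat
      using that by (simp add: less_eq_Suc_le)
    ultimately show ?thesis
      using that(1) by blast
  qed
  have S: "U' (4 * v) \<longleftrightarrow> U (4 * v)" "U' (4 * v + 1) \<longleftrightarrow> U (4 * v + 1)" if "v < n" for v
    by (rule U, rule le[of _ v]; use that in simp)+
  have R: "U' (4 * ((r * n + v) * n + w) + 2) \<longleftrightarrow> U (4 * ((r * n + v) * n + w) + 2)"
    if "r \<le> n * n" "v < n" "w < n" for r v w
  proof (rule U, rule le[of _ "(r * n + v) * n + w"])
    have "(r * n + v) * n + w < (r * n + v + 1) * n"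
      using that(3) by simp
    also have "r * n + v + 1 \<le> (r + 1) * n"
      using that(2) by simp
    then have "(r * n + v + 1) * n \<le> (r + 1) * n * n"
      by (rule mult_le_mono1)
    also have "\<dots> \<le> (n * n + 1) * n * n"
      using that(1) by (intro mult_le_mono1) simp
    finally show "(r * n + v) * n + w < (n * n + 1) * n * n \<or> (r * n + v) * n + w < n \<or>
        (r * n + v) * n + w < n * (2 * n)"
      by simp
  qed simp
  have I: "U' (4 * (v * (2 * n) + a) + 3) \<longleftrightarrow> U (4 * (v * (2 * n) + a) + 3)" if "v < n" "a < 2 * n" for v a
  proof (rule U, rule le[of _ "v * (2 * n) + a"])
    have "v * (2 * n) + a < Suc v * (2 * n)"
      using that(2) by simp
    also have "\<dots> \<le> n * (2 * n)"
      using that(1) by (intro mult_le_mono1) simp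
    finally show "v * (2 * n) + a < (n * n + 1) * n * n \<or> v * (2 * n) + a < n \<or> v * (2 * n) + a < n * (2 * n)"
      by simp
  qed simp
  have "(\<Sum>v<n. of_bool (U' (4 * v))) = (\<Sum>v<n. of_bool (U (4 * v)) :: nat)"
    using S by (intro sum.cong) auto
  moreover have "check n adj (\<lambda>v. U' (4 * v)) (\<lambda>v. U' (4 * v + 1))
       (\<lambda>r v w. U' (4 * ((r * n + v) * n + w) + 2)) (\<lambda>v a. U' (4 * (v * (2 * n) + a) + 3)) \<longleftrightarrow>
     check n adj (\<lambda>v. U (4 * v)) (\<lambda>v. U (4 * v + 1))
       (\<lambda>r v w. U (4 * ((r * n + v) * n + w) + 2)) (\<lambda>v a. U (4 * (v * (2 * n) + a) + 3))" for adj
    by (rule check_cong) (rule refl S R I; assumption)+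
  ultimately have "verify m X U' \<longleftrightarrow> verify m X U"
    unfolding verify_def verify_at_def n_def[symmetric] by (simp only:)
  then show ?thesis
    using v by simp
qed

theorem NP_member: "connected_oct_language is_line_graph \<in> complexity_NP"
proof -
  let ?V = "{z. verify (fst_len z) (fst_bit z) (snd_bit z)}"
  \<comment> \<open>The number of certificate bits in \<open>verify_cong\<close>, expanded as a
    polynomial in \<open>m\<close>.\<close>
  let ?p = "[:4, 4, 12, 0, 4:] :: nat poly"
  have "?V \<in> complexity_P"
    using polytime_verify by (simp add: complexity_P_def)
  moreover have "x \<in> connected_oct_language is_line_graph \<longleftrightarrow>
      (\<exists>u. length u \<le> poly ?p (length x) \<and> pair_word x u \<in> ?V)" for x
  proof
    assume "x \<in> connected_oct_language is_line_graph"
    then obtain U where U: "verify (length x) (bit_at x) U"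
      using verify_complete by blast
    let ?m = "length x"
    define u where "u = map U [0..<4 * ((?m * ?m + 1) * ?m * ?m + 2 * ?m * ?m + ?m + 1)]"
    have "verify (length x) (bit_at x) (bit_at u)"
      using U by (rule verify_cong) (simp add: u_def bit_at_def)
    moreover have "length u = poly ?p (length x)"
      by (simp add: u_def algebra_simps)
    ultimately show "\<exists>u. length u \<le> poly ?p (length x) \<and> pair_word x u \<in> ?V"
      by (intro exI[of _ u]) simp
  next
    assume "\<exists>u. length u \<le> poly ?p (length x) \<and> pair_word x u \<in> ?V"
    then show "x \<in> connected_oct_language is_line_graph"
      using verify_sound by auto
  qed
  ultimately show ?thesis
    unfolding complexity_NP_def by blast
qed

theorem theorem2: "NP_complete (connected_oct_language is_line_graph)"
  unfolding NP_complete_def using NP_member NP_hard by blast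

end
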